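(* Let $\Gamma$ be a discrete group having only finitely many finite subgroups up to conjugacy. If $\mathbb{K}$ is a field of characteristic zero and $\mathcal{F}$ is any family of finite subgroups of $\Gamma$, then $G_{\mathcal{F}}(\mathbb{K}[\Gamma])=\mathbb{Z}$ if and only if $\mathcal{F}=\{\{1\}\}$.
   Context: A family $\mathcal{F}$ of finite subgroups of $\Gamma$ is a non-empty collection of finite subgroups of $\Gamma$ closed under conjugation and under taking subgroups. For a finite group $H$ and a field $\mathbb{K}$, $G(\mathbb{K}[H])$ is the Grothendieck ring of finitely generated $\mathbb{K}[H]$-modules (relations from short exact sequences; product given by $\otimes_{\mathbb{K}}$ with diagonal action). $G_{\mathcal{F}}(\mathbb{K}[\Gamma])=\varprojlim_{H\in\mathcal{F}} G(\mathbb{K}[H])$ is the subring of those $(x_H)\in\prod_{H\in\mathcal{F}}G(\mathbb{K}[H])$ such that (1) $\mathrm{res}^K_H(x_K)=x_H$ whenever $H\subseteq K$ are in $\mathcal{F}$, and (2) $C_\gamma^*(x_K)=x_H$ whenever $K=\gamma H\gamma^{-1}$, where $C_\gamma^*:G(\mathbb{K}[\gamma H\gamma^{-1}])\to G(\mathbb{K}[H])$ is induced by the homomorphism $H\to\gamma H\gamma^{-1}$, $h\mapsto \gamma h\gamma^{-1}$. The equality $G_{\mathcal{F}}(\mathbb{K}[\Gamma])=\mathbb{Z}$ means that this ring is isomorphic to $\mathbb{Z}$. *)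

theory Defs
  imports "HOL-Algebra.Algebra" "Jordan_Normal_Form.VS_Connect"
begin

hide_const (open) Wellorder_Constructions.zero Multiset.mult LinearCombinations.submodule

section \<open>Left modules over a ring that need not be commutative\<close>

text \<open>
  The library's locale \<^locale>\<open>Module.module\<close> requires a commutative ring; the following has the same
  axioms over an arbitrary ring. The module records are those of the library. They extend ring
  records, so they carry fields \<open>mult\<close> and \<open>one\<close>, which have no meaning here.
\<close>

locale left_module = R?: ring R + M?: abelian_group M
  for R :: "('r, 'c) ring_scheme" (structure) and M :: "('r, 'm, 'd) module_scheme" (structure) +
  assumes smult_closed:
      "\<lbrakk>a \<in> carrier R; x \<in> carrier M\<rbrakk> \<Longrightarrow> a \<odot>\<^bsub>M\<^esub> x \<in> carrier M"
    and smult_l_distr: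
      "\<lbrakk>a \<in> carrier R; b \<in> carrier R; x \<in> carrier M\<rbrakk> \<Longrightarrow>
        (a \<oplus>\<^bsub>R\<^esub> b) \<odot>\<^bsub>M\<^esub> x = a \<odot>\<^bsub>M\<^esub> x \<oplus>\<^bsub>M\<^esub> b \<odot>\<^bsub>M\<^esub> x"
    and smult_r_distr:
      "\<lbrakk>a \<in> carrier R; x \<in> carrier M; y \<in> carrier M\<rbrakk> \<Longrightarrow>
        a \<odot>\<^bsub>M\<^esub> (x \<oplus>\<^bsub>M\<^esub> y) = a \<odot>\<^bsub>M\<^esub> x \<oplus>\<^bsub>M\<^esub> a \<odot>\<^bsub>M\<^esub> y"
    and smult_assoc:
      "\<lbrakk>a \<in> carrier R; b \<in> carrier R; x \<in> carrier M\<rbrakk> \<Longrightarrow>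
        (a \<otimes>\<^bsub>R\<^esub> b) \<odot>\<^bsub>M\<^esub> x = a \<odot>\<^bsub>M\<^esub> (b \<odot>\<^bsub>M\<^esub> x)"
    and smult_one:
      "x \<in> carrier M \<Longrightarrow> \<one>\<^bsub>R\<^esub> \<odot>\<^bsub>M\<^esub> x = x"

definition fin_gen :: "('r, 'c) ring_scheme \<Rightarrow> ('r, 'm, 'd) module_scheme \<Rightarrow> bool" where
  "fin_gen R M \<longleftrightarrow>
    (\<exists>S. finite S \<and> S \<subseteq> carrier M \<and> (\<forall>N. submodule N R M \<and> S \<subseteq> N \<longrightarrow> N = carrier M))"

definition lmod_hom ::
  "('r, 'c) ring_scheme \<Rightarrow> ('r, 'm, 'd) module_scheme \<Rightarrow> ('r, 'n, 'e) module_scheme \<Rightarrow> ('m \<Rightarrow> 'n) set"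
  where
  "lmod_hom R M N =
    {f \<in> hom (add_monoid M) (add_monoid N).
      \<forall>a\<in>carrier R. \<forall>x\<in>carrier M. f (a \<odot>\<^bsub>M\<^esub> x) = a \<odot>\<^bsub>N\<^esub> f x}"

text \<open>Exactness of \<open>0 \<rightarrow> A \<rightarrow> B \<rightarrow> C \<rightarrow> 0\<close> with maps \<open>f\<close> and \<open>g\<close>.\<close>

definition lmod_short_exact ::
  "('r, 'c) ring_scheme \<Rightarrow> ('r, 'm) module \<Rightarrow> ('m \<Rightarrow> 'm) \<Rightarrow> ('r, 'm) module \<Rightarrow> ('m \<Rightarrow> 'm)
    \<Rightarrow> ('r, 'm) module \<Rightarrow> bool" where
  "lmod_short_exact R A f B g C \<longleftrightarrow>
    f \<in> lmod_hom R A B \<and> g \<in> lmod_hom R B C \<and>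
    inj_on f (carrier A) \<and> f ` carrier A = a_kernel B C g \<and> g ` carrier B = carrier C"


section \<open>Group algebras of finite groups\<close>

text \<open>
  For a finite group \<open>H\<close>, the algebra \<open>K[H]\<close> consists of the functions on the ambient type that
  vanish outside \<open>carrier H\<close>. The field \<open>K\<close> is the type \<^typ>\<open>'k\<close>; as a ring record it is
  \<^const>\<open>class_ring\<close>.
\<close>

definition group_algebra :: "('g, 'b) monoid_scheme \<Rightarrow> ('g \<Rightarrow> 'k::field) ring" where
  "group_algebra H =
    \<lparr>carrier = {a. \<forall>g. g \<notin> carrier H \<longrightarrow> a g = 0},
     mult = (\<lambda>a b g. \<Sum>(h, h') \<in> {(h, h'). h \<in> carrier H \<and> h' \<in> carrier H \<and> h \<otimes>\<^bsub>H\<^esub> h' = g}. a h * b h'),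
     one = (\<lambda>g. if g = \<one>\<^bsub>H\<^esub> then 1 else 0),
     zero = (\<lambda>_. 0),
     add = (\<lambda>a b g. a g + b g)\<rparr>"

definition ga_single :: "'g \<Rightarrow> 'k::field \<Rightarrow> 'g \<Rightarrow> 'k" where
  "ga_single h c = (\<lambda>g. if g = h then c else 0)"

text \<open>The homomorphism \<open>K[H] \<rightarrow> K[G]\<close> extending a group homomorphism \<open>\<phi>\<close> from \<open>H\<close> to \<open>G\<close>.\<close>

definition ga_map :: "('g, 'b) monoid_scheme \<Rightarrow> ('g \<Rightarrow> 'g) \<Rightarrow> ('g \<Rightarrow> 'k::field) \<Rightarrow> 'g \<Rightarrow> 'k" where
  "ga_map H \<phi> a = (\<lambda>g. \<Sum>h \<in> {h \<in> carrier H. \<phi> h = g}. a h)"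

text \<open>
  The \<open>K[H]\<close>-modules form a proper class. If \<open>H\<close> is finite, then a finitely generated one is
  finite-dimensional over \<open>K\<close>, hence isomorphic to one whose carrier is a set of sequences in \<open>K\<close>
  (finitely supported ones suffice). So all modules are taken with carrier in \<^typ>\<open>nat \<Rightarrow> 'k\<close>; the
  carrier and its module structure are otherwise arbitrary, not necessarily the pointwise one.
\<close>

type_synonym ('g, 'k) gmod = "('g \<Rightarrow> 'k, nat \<Rightarrow> 'k) module"

definition fg_gmods :: "('g, 'b) monoid_scheme \<Rightarrow> ('g, 'k::field) gmod set" where
  "fg_gmods H = {M. left_module (group_algebra H) M \<and> fin_gen (group_algebra H) M}"

definition restrict_scalars ::
  "('g, 'b) monoid_scheme \<Rightarrow> ('g, 'k::field) gmod \<Rightarrow> ('k, nat \<Rightarrow> 'k) module" where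
  "restrict_scalars H M =
    \<lparr>carrier = carrier M, mult = mult M, one = one M, zero = zero M, add = add M,
     smult = (\<lambda>c x. ga_single \<one>\<^bsub>H\<^esub> c \<odot>\<^bsub>M\<^esub> x)\<rparr>"

definition pullback ::
  "('g, 'b) monoid_scheme \<Rightarrow> ('g \<Rightarrow> 'g) \<Rightarrow> ('g, 'k::field) gmod \<Rightarrow> ('g, 'k) gmod" where
  "pullback H \<phi> M = M\<lparr>smult := \<lambda>a x. ga_map H \<phi> a \<odot>\<^bsub>M\<^esub> x\<rparr>"

text \<open>The one-dimensional module \<open>K\<close> with trivial action, placed in the zeroth coordinate.\<close>

definition trivial_gmod :: "('g, 'b) monoid_scheme \<Rightarrow> ('g, 'k::field) gmod" where
  "trivial_gmod H =
    \<lparr>carrier = {v. \<forall>i>0. v i = 0}, mult = undefined, one = undefined,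
     zero = (\<lambda>_. 0), add = (\<lambda>v w i. v i + w i),
     smult = (\<lambda>a v i. (\<Sum>h\<in>carrier H. a h) * v i)\<rparr>"


section \<open>Tensor products\<close>

definition lmod_bilinear ::
  "('r, 'c) ring_scheme \<Rightarrow> ('r, 'm) module \<Rightarrow> ('r, 'm) module \<Rightarrow> ('r, 'm) module
    \<Rightarrow> ('m \<Rightarrow> 'm \<Rightarrow> 'm) \<Rightarrow> bool" where
  "lmod_bilinear R M N V \<beta> \<longleftrightarrow>
    (\<forall>x\<in>carrier M. \<beta> x \<in> lmod_hom R N V) \<and> (\<forall>y\<in>carrier N. (\<lambda>x. \<beta> x y) \<in> lmod_hom R M V)"

text \<open>
  For commutative \<open>R\<close>: \<open>T\<close> with \<open>\<tau>\<close> is a tensor product of \<open>M\<close> and \<open>N\<close>. The universal property is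
  tested on modules in the same carrier type. This determines \<open>T\<close> up to isomorphism as soon as that
  type contains a copy of the tensor product, as it does for finite-dimensional vector spaces over
  \<open>K\<close> with carriers in \<^typ>\<open>nat \<Rightarrow> 'k\<close>.
\<close>

definition is_tensor ::
  "('r, 'c) ring_scheme \<Rightarrow> ('r, 'm) module \<Rightarrow> ('r, 'm) module \<Rightarrow> ('r, 'm) module
    \<Rightarrow> ('m \<Rightarrow> 'm \<Rightarrow> 'm) \<Rightarrow> bool" where
  "is_tensor R M N T \<tau> \<longleftrightarrow>
    left_module R T \<and> lmod_bilinear R M N T \<tau> \<and>
    (\<forall>V \<beta>. left_module R V \<and> lmod_bilinear R M N V \<beta> \<longrightarrow>
      (\<exists>!f. f \<in> extensional (carrier T) \<and> f \<in> lmod_hom R T V \<and>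
        (\<forall>x\<in>carrier M. \<forall>y\<in>carrier N. f (\<tau> x y) = \<beta> x y)))"

text \<open>The tensor product over \<open>K\<close> with the diagonal action \<open>h (x \<otimes> y) = h x \<otimes> h y\<close>.\<close>

definition is_diag_tensor ::
  "('g, 'b) monoid_scheme \<Rightarrow> ('g, 'k::field) gmod \<Rightarrow> ('g, 'k) gmod \<Rightarrow> ('g, 'k) gmod
    \<Rightarrow> ((nat \<Rightarrow> 'k) \<Rightarrow> (nat \<Rightarrow> 'k) \<Rightarrow> (nat \<Rightarrow> 'k)) \<Rightarrow> bool" where
  "is_diag_tensor H M N T \<tau> \<longleftrightarrow>
    is_tensor class_ring (restrict_scalars H M) (restrict_scalars H N) (restrict_scalars H T) \<tau> \<and>
    (\<forall>h\<in>carrier H. \<forall>x\<in>carrier M. \<forall>y\<in>carrier N.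
      ga_single h 1 \<odot>\<^bsub>T\<^esub> \<tau> x y = \<tau> (ga_single h 1 \<odot>\<^bsub>M\<^esub> x) (ga_single h 1 \<odot>\<^bsub>N\<^esub> y))"

definition diag_tensor ::
  "('g, 'b) monoid_scheme \<Rightarrow> ('g, 'k::field) gmod \<Rightarrow> ('g, 'k) gmod \<Rightarrow> ('g, 'k) gmod" where
  "diag_tensor H M N = (SOME T. T \<in> fg_gmods H \<and> (\<exists>\<tau>. is_diag_tensor H M N T \<tau>))"


section \<open>The Grothendieck ring\<close>

text \<open>
  The free abelian group on the finitely generated modules, with the bilinear extension of the
  tensor product. As a ring it only becomes associative and unital in the quotient below, since the
  tensor product is associative and unital up to isomorphism.
\<close>

definition free_gmods :: "('g, 'b) monoid_scheme \<Rightarrow> (('g, 'k::field) gmod \<Rightarrow>\<^sub>0 int) ring" where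
  "free_gmods H =
    \<lparr>carrier = carrier (free_Abelian_group (fg_gmods H)),
     mult = (\<lambda>x y. frag_extend (\<lambda>M. frag_extend (\<lambda>N. frag_of (diag_tensor H M N)) y) x),
     one = frag_of (trivial_gmod H), zero = 0, add = (+)\<rparr>"

definition exact_relations :: "('g, 'b) monoid_scheme \<Rightarrow> (('g, 'k::field) gmod \<Rightarrow>\<^sub>0 int) set" where
  "exact_relations H =
    generate (add_monoid (free_gmods H))
      {frag_of B - frag_of A - frag_of C | A B C.
        A \<in> fg_gmods H \<and> B \<in> fg_gmods H \<and> C \<in> fg_gmods H \<and>
        (\<exists>f g. lmod_short_exact (group_algebra H) A f B g C)}"

definition groth_ring :: "('g, 'b) monoid_scheme \<Rightarrow> (('g, 'k::field) gmod \<Rightarrow>\<^sub>0 int) set ring" where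
  "groth_ring H = free_gmods H Quot exact_relations H"

text \<open>
  The map \<open>G(K[G]) \<rightarrow> G(K[H])\<close>, \<open>[M] \<mapsto> [\<phi>\<^sup>*M]\<close>, for a homomorphism \<open>\<phi>\<close> from \<open>H\<close> to \<open>G\<close>. It is written
  on cosets as a union over representatives, as in the library's \<^const>\<open>rcoset_mult\<close>.
\<close>

definition groth_pullback ::
  "('g, 'b) monoid_scheme \<Rightarrow> ('g \<Rightarrow> 'g) \<Rightarrow> (('g, 'k::field) gmod \<Rightarrow>\<^sub>0 int) set
    \<Rightarrow> (('g, 'k) gmod \<Rightarrow>\<^sub>0 int) set" where
  "groth_pullback H \<phi> C =
    (\<Union>x\<in>C. exact_relations H +>\<^bsub>free_gmods H\<^esub> frag_extend (\<lambda>M. frag_of (pullback H \<phi> M)) x)"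


section \<open>Families of finite subgroups and the inverse limit\<close>

definition conj_subgroup :: "('g, 'b) monoid_scheme \<Rightarrow> 'g \<Rightarrow> 'g set \<Rightarrow> 'g set" where
  "conj_subgroup \<Gamma> \<gamma> H = \<gamma> <#\<^bsub>\<Gamma>\<^esub> H #>\<^bsub>\<Gamma>\<^esub> inv\<^bsub>\<Gamma>\<^esub> \<gamma>"

definition finite_subgroups :: "('g, 'b) monoid_scheme \<Rightarrow> 'g set set" where
  "finite_subgroups \<Gamma> = {H. subgroup H \<Gamma> \<and> finite H}"

definition conjugacy :: "('g, 'b) monoid_scheme \<Rightarrow> ('g set \<times> 'g set) set" where
  "conjugacy \<Gamma> =
    {(H, L) \<in> finite_subgroups \<Gamma> \<times> finite_subgroups \<Gamma>. \<exists>\<gamma>\<in>carrier \<Gamma>. L = conj_subgroup \<Gamma> \<gamma> H}"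

definition subgroup_family :: "('g, 'b) monoid_scheme \<Rightarrow> 'g set set \<Rightarrow> bool" where
  "subgroup_family \<Gamma> \<F> \<longleftrightarrow>
    \<F> \<noteq> {} \<and> \<F> \<subseteq> finite_subgroups \<Gamma> \<and>
    (\<forall>H\<in>\<F>. \<forall>\<gamma>\<in>carrier \<Gamma>. conj_subgroup \<Gamma> \<gamma> H \<in> \<F>) \<and>
    (\<forall>H\<in>\<F>. \<forall>L. subgroup L \<Gamma> \<and> L \<subseteq> H \<longrightarrow> L \<in> \<F>)"

definition family_groth_ring ::
  "('g, 'b) monoid_scheme \<Rightarrow> 'g set set \<Rightarrow> ('g set \<Rightarrow> (('g, 'k::field) gmod \<Rightarrow>\<^sub>0 int) set) ring" where
  "family_groth_ring \<Gamma> \<F> =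
    (let G = (\<lambda>H. groth_ring (\<Gamma>\<lparr>carrier := H\<rparr>)) in
    \<lparr>carrier = {x \<in> (\<Pi>\<^sub>E H\<in>\<F>. carrier (G H)).
       (\<forall>H\<in>\<F>. \<forall>L\<in>\<F>. H \<subseteq> L \<longrightarrow> groth_pullback (\<Gamma>\<lparr>carrier := H\<rparr>) (\<lambda>h. h) (x L) = x H) \<and>
       (\<forall>H\<in>\<F>. \<forall>\<gamma>\<in>carrier \<Gamma>.
         groth_pullback (\<Gamma>\<lparr>carrier := H\<rparr>) (\<lambda>h. \<gamma> \<otimes>\<^bsub>\<Gamma>\<^esub> h \<otimes>\<^bsub>\<Gamma>\<^esub> inv\<^bsub>\<Gamma>\<^esub> \<gamma>) (x (conj_subgroup \<Gamma> \<gamma> H)) = x H)},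
     mult = (\<lambda>x y. \<lambda>H\<in>\<F>. x H \<otimes>\<^bsub>G H\<^esub> y H),
     one = (\<lambda>H\<in>\<F>. \<one>\<^bsub>G H\<^esub>),
     zero = (\<lambda>H\<in>\<F>. \<zero>\<^bsub>G H\<^esub>),
     add = (\<lambda>x y. \<lambda>H\<in>\<F>. x H \<oplus>\<^bsub>G H\<^esub> y H)\<rparr>)"

end

theory Submission
  imports Defs
begin

text \<open>
  In characteristic zero, taking the vectors fixed by a finite group is exact, so for every subgroup
  \<open>S\<close> of \<open>H\<close> the dimension of the \<open>S\<close>-fixed vectors is an additive function on \<open>G(K[H])\<close>. Let \<open>n > 0\<close>
  be a common multiple of the orders of the finite subgroups. The permutation module of a free
  \<open>H\<close>-set with \<open>n\<close> elements depends only on \<open>n\<close>, hence these modules are compatible under restriction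
  and conjugation and define an element of \<open>G\<^sub>\<F>\<close>. If \<open>G\<^sub>\<F>\<close> is isomorphic to the integers, then this
  element is a multiple of \<open>1\<close>, so in each of its components all of the module would be fixed by \<open>H\<close>,
  which forces \<open>H\<close> to be trivial. Conversely, the dimension identifies the Grothendieck ring of the
  trivial group with the integers.
\<close>

section \<open>Group algebras and modules\<close>

text \<open>The regular modules K[H] themselves do not form a compatible family: K[L] restricts to
  [L:H] copies of K[H]. Passing to K[H]^(n/|H|) with one n for all H repairs this, and such an n
  exists because conjugate subgroups have equal order, so finitely many conjugacy classes mean
  finitely many orders. That the resulting element is not a multiple of 1 is seen without characters
  or a decomposition into simple modules: the dimensions of the vectors fixed by the trivial
  subgroup and by all of H agree on multiples of the trivial module, but differ on a permutation
  module with a free action of a nontrivial H.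

  An isomorphism with the integers is additive and sends 1 to 1, which already determines it on
  multiples of 1. Products of classes are computed over the trivial group alone. There the dimension
  decides equality of classes, so independence of representatives follows by counting dimensions
  instead of from exactness of the tensor product.\<close>

lemma ga_support_induct [consumes 2, case_names zero add]:
  fixes a :: "'g \<Rightarrow> 'k::field"
  assumes "finite S" and "\<And>g. g \<notin> S \<Longrightarrow> a g = 0"
    and zero: "P (\<lambda>_. 0)"
    and add: "\<And>h c b. \<lbrakk>h \<in> S; \<And>g. g \<notin> S \<Longrightarrow> b g = 0; P b\<rbrakk> \<Longrightarrow> P (\<lambda>g. ga_single h c g + b g)"
  shows "P a"
proof -
  have "P a" if "finite T" "T \<subseteq> S" "\<And>g. g \<notin> T \<Longrightarrow> a g = 0" for T a
    using that
  proof (induction T arbitrary: a)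
    case empty
    then have "a = (\<lambda>_. 0)" by auto
    with zero show ?case by simp
  next
    case (insert x T)
    let ?b = "a(x := 0)"
    have "P ?b" using insert by (intro insert.IH) auto
    moreover have "a = (\<lambda>g. ga_single x (a x) g + ?b g)"
      by (auto simp: ga_single_def)
    moreover have "\<And>g. g \<notin> S \<Longrightarrow> ?b g = 0" using insert.prems by auto
    ultimately show ?case using add[of x ?b "a x"] insert.prems by auto
  qed
  with assms(1,2) show ?thesis by blast
qed

lemma group_algebra_simps [simp]:
  "carrier (group_algebra H) = {a. \<forall>g. g \<notin> carrier H \<longrightarrow> a g = 0}"
  "\<one>\<^bsub>group_algebra H\<^esub> = ga_single \<one>\<^bsub>H\<^esub> 1"
  "\<zero>\<^bsub>group_algebra H\<^esub> = (\<lambda>_. 0)"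
  "a \<oplus>\<^bsub>group_algebra H\<^esub> b = (\<lambda>g. a g + b g)"
  by (auto simp: group_algebra_def ga_single_def)

lemma ga_single_add: "ga_single h (c + d) = (\<lambda>g. ga_single h c g + ga_single h d g)"
  by (auto simp: ga_single_def)

lemma ga_single_zero [simp]: "ga_single h 0 = (\<lambda>_. 0)"
  by (auto simp: ga_single_def)

lemma ga_single_outside: "h \<in> carrier H \<Longrightarrow> g \<notin> carrier H \<Longrightarrow> ga_single h c g = 0"
  by (auto simp: ga_single_def)

lemma sum_ga_single [simp]:
  "finite A \<Longrightarrow> h \<in> A \<Longrightarrow> (\<Sum>g\<in>A. ga_single h c g * F g) = c * F h"
  "finite A \<Longrightarrow> h \<in> A \<Longrightarrow> (\<Sum>g\<in>A. ga_single h c g) = c"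
  by (simp_all add: ga_single_def if_distrib[of "\<lambda>x. x * _"] cong: if_cong)

locale finite_group = group G for G :: "('g, 'b) monoid_scheme" (structure) +
  assumes finite_carrier [simp]: "finite (carrier G)"
begin

text \<open>Pairing a product with a test function \<open>F\<close> avoids manipulating the fibres
  of the multiplication. With \<open>F\<close> an indicator it gives single coefficients and hence
  associativity; with \<open>F\<close> a coordinate of a moved vector it gives the action law of
  permutation modules.\<close>

lemma sum_ga_mult:
  fixes F :: "'g \<Rightarrow> 'k::field"
  shows "(\<Sum>g\<in>carrier G. (a \<otimes>\<^bsub>group_algebra G\<^esub> b) g * F g) =
    (\<Sum>h\<in>carrier G. \<Sum>k\<in>carrier G. a h * b k * F (h \<otimes> k))"
proof -
  let ?P = "carrier G \<times> carrier G"
  have "(\<Sum>g\<in>carrier G. (a \<otimes>\<^bsub>group_algebra G\<^esub> b) g * F g) =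
      (\<Sum>g\<in>carrier G. \<Sum>p\<in>{p \<in> ?P. fst p \<otimes> snd p = g}. a (fst p) * b (snd p) * F (fst p \<otimes> snd p))"
  proof (intro sum.cong refl)
    fix g
    have "{(h, h'). h \<in> carrier G \<and> h' \<in> carrier G \<and> h \<otimes> h' = g} = {p \<in> ?P. fst p \<otimes> snd p = g}"
      by auto
    then show "(a \<otimes>\<^bsub>group_algebra G\<^esub> b) g * F g =
        (\<Sum>p\<in>{p \<in> ?P. fst p \<otimes> snd p = g}. a (fst p) * b (snd p) * F (fst p \<otimes> snd p))"
      by (simp add: group_algebra_def sum_distrib_right case_prod_beta)
  qed
  also have "\<dots> = (\<Sum>p\<in>?P. a (fst p) * b (snd p) * F (fst p \<otimes> snd p))"
    by (rule sum.group) auto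
  finally show ?thesis by (simp add: sum.cartesian_product case_prod_beta)
qed

lemma ga_mult_outside: "g \<notin> carrier G \<Longrightarrow> (a \<otimes>\<^bsub>group_algebra G\<^esub> b) g = (0::'k::field)"
  by (auto simp: group_algebra_def intro!: sum.neutral)

lemma ga_mult_apply:
  fixes a b :: "'g \<Rightarrow> 'k::field"
  assumes "g \<in> carrier G"
  shows "(a \<otimes>\<^bsub>group_algebra G\<^esub> b) g =
    (\<Sum>h\<in>carrier G. \<Sum>k\<in>carrier G. a h * b k * (if h \<otimes> k = g then 1 else 0))"
  using sum_ga_mult[of a b "\<lambda>x. if x = g then 1 else 0"] assms
  by (simp add: if_distrib[of "\<lambda>x. _ * x"] cong: if_cong)

lemma ga_single_mult:
  assumes "h \<in> carrier G" "k \<in> carrier G"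
  shows "ga_single h c \<otimes>\<^bsub>group_algebra G\<^esub> ga_single k d = ga_single (h \<otimes> k) (c * d :: 'k::field)"
proof
  fix g
  show "(ga_single h c \<otimes>\<^bsub>group_algebra G\<^esub> ga_single k d) g = ga_single (h \<otimes> k) (c * d) g"
  proof (cases "g \<in> carrier G")
    case True
    have "(\<Sum>x\<in>carrier G. \<Sum>y\<in>carrier G. ga_single h c x * ga_single k d y * (if x \<otimes> y = g then 1 else 0))
      = (\<Sum>x\<in>carrier G. ga_single h c x * (\<Sum>y\<in>carrier G. ga_single k d y * (if x \<otimes> y = g then 1 else 0)))"
      by (simp add: sum_distrib_left mult.assoc)
    with True assms show ?thesis
      by (simp add: ga_mult_apply) (auto simp: ga_single_def)
  next
    case False
    with assms show ?thesis by (auto simp: ga_mult_outside ga_single_def)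
  qed
qed

lemma ga_l_distr:
  "(\<lambda>g. a g + b g) \<otimes>\<^bsub>group_algebra G\<^esub> c =
    (\<lambda>g. (a \<otimes>\<^bsub>group_algebra G\<^esub> c) g + (b \<otimes>\<^bsub>group_algebra G\<^esub> c) g :: 'k::field)"
  by (simp add: group_algebra_def case_prod_beta distrib_right sum.distrib)

lemma ga_r_distr:
  "c \<otimes>\<^bsub>group_algebra G\<^esub> (\<lambda>g. a g + b g) =
    (\<lambda>g. (c \<otimes>\<^bsub>group_algebra G\<^esub> a) g + (c \<otimes>\<^bsub>group_algebra G\<^esub> b) g :: 'k::field)"
  by (simp add: group_algebra_def case_prod_beta distrib_left sum.distrib)

lemma ga_assoc:
  fixes a b c :: "'g \<Rightarrow> 'k::field"
  shows "(a \<otimes>\<^bsub>group_algebra G\<^esub> b) \<otimes>\<^bsub>group_algebra G\<^esub> c =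
    a \<otimes>\<^bsub>group_algebra G\<^esub> (b \<otimes>\<^bsub>group_algebra G\<^esub> c)"
proof
  fix g
  show "((a \<otimes>\<^bsub>group_algebra G\<^esub> b) \<otimes>\<^bsub>group_algebra G\<^esub> c) g =
    (a \<otimes>\<^bsub>group_algebra G\<^esub> (b \<otimes>\<^bsub>group_algebra G\<^esub> c)) g"
  proof (cases "g \<in> carrier G")
    case True
    let ?d = "\<lambda>x. if x = g then 1 else (0::'k)"
    have "((a \<otimes>\<^bsub>group_algebra G\<^esub> b) \<otimes>\<^bsub>group_algebra G\<^esub> c) g =
        (\<Sum>x\<in>carrier G. (a \<otimes>\<^bsub>group_algebra G\<^esub> b) x * (\<Sum>l\<in>carrier G. c l * ?d (x \<otimes> l)))"
      using True by (simp add: ga_mult_apply[of g] sum_distrib_left mult.assoc)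
    also have "\<dots> = (\<Sum>h\<in>carrier G. \<Sum>k\<in>carrier G. \<Sum>l\<in>carrier G. a h * b k * c l * ?d (h \<otimes> k \<otimes> l))"
      by (subst sum_ga_mult) (simp add: sum_distrib_left mult.assoc)
    also have "\<dots> = (\<Sum>h\<in>carrier G. \<Sum>k\<in>carrier G. \<Sum>l\<in>carrier G. b k * c l * (a h * ?d (h \<otimes> (k \<otimes> l))))"
      by (intro sum.cong refl) (simp add: m_assoc)
    also have "\<dots> = (\<Sum>h\<in>carrier G. \<Sum>y\<in>carrier G. (b \<otimes>\<^bsub>group_algebra G\<^esub> c) y * (a h * ?d (h \<otimes> y)))"
      by (subst sum_ga_mult) simp
    also have "\<dots> = (a \<otimes>\<^bsub>group_algebra G\<^esub> (b \<otimes>\<^bsub>group_algebra G\<^esub> c)) g"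
      using True by (simp add: ga_mult_apply[of g] ac_simps)
    finally show ?thesis .
  qed (simp add: ga_mult_outside)
qed

lemma ga_one_mult:
  fixes a :: "'g \<Rightarrow> 'k::field"
  assumes "\<And>g. g \<notin> carrier G \<Longrightarrow> a g = 0"
  shows "ga_single \<one> 1 \<otimes>\<^bsub>group_algebra G\<^esub> a = a"
    and "a \<otimes>\<^bsub>group_algebra G\<^esub> ga_single \<one> 1 = a"
proof -
  have z: "(\<lambda>_. 0) \<otimes>\<^bsub>group_algebra G\<^esub> b = (\<lambda>_. 0::'k)" "b \<otimes>\<^bsub>group_algebra G\<^esub> (\<lambda>_. 0) = (\<lambda>_. 0::'k)" for b
    by (auto simp: group_algebra_def intro!: sum.neutral)
  show "ga_single \<one> 1 \<otimes>\<^bsub>group_algebra G\<^esub> a = a"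
    using finite_carrier assms
    by (induction rule: ga_support_induct) (simp_all add: z ga_r_distr ga_single_mult)
  show "a \<otimes>\<^bsub>group_algebra G\<^esub> ga_single \<one> 1 = a"
    using finite_carrier assms
    by (induction rule: ga_support_induct) (simp_all add: z ga_l_distr ga_single_mult)
qed

lemma ring_group_algebra: "ring (group_algebra G :: ('g \<Rightarrow> 'k::field) ring)"
proof (rule ringI)
  show "abelian_group (group_algebra G :: ('g \<Rightarrow> 'k) ring)"
  proof (rule abelian_groupI)
    fix x :: "'g \<Rightarrow> 'k" assume "x \<in> carrier (group_algebra G)"
    then show "\<exists>y\<in>carrier (group_algebra G). y \<oplus>\<^bsub>group_algebra G\<^esub> x = \<zero>\<^bsub>group_algebra G\<^esub>"
      by (intro bexI[of _ "\<lambda>g. - x g"]) auto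
  qed (auto simp: ac_simps)
  show "Group.monoid (group_algebra G :: ('g \<Rightarrow> 'k) ring)"
    by (rule monoidI) (auto simp: ga_mult_outside ga_assoc ga_one_mult ga_single_outside[OF one_closed])
qed (auto simp: ga_l_distr ga_r_distr)

end

section \<open>Left modules and their homomorphisms\<close>

lemma left_moduleI:
  assumes "ring R" "abelian_group M"
    and "\<And>a x. \<lbrakk>a \<in> carrier R; x \<in> carrier M\<rbrakk> \<Longrightarrow> a \<odot>\<^bsub>M\<^esub> x \<in> carrier M"
    and "\<And>a b x. \<lbrakk>a \<in> carrier R; b \<in> carrier R; x \<in> carrier M\<rbrakk> \<Longrightarrow>
        (a \<oplus>\<^bsub>R\<^esub> b) \<odot>\<^bsub>M\<^esub> x = a \<odot>\<^bsub>M\<^esub> x \<oplus>\<^bsub>M\<^esub> b \<odot>\<^bsub>M\<^esub> x"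
    and "\<And>a x y. \<lbrakk>a \<in> carrier R; x \<in> carrier M; y \<in> carrier M\<rbrakk> \<Longrightarrow>
        a \<odot>\<^bsub>M\<^esub> (x \<oplus>\<^bsub>M\<^esub> y) = a \<odot>\<^bsub>M\<^esub> x \<oplus>\<^bsub>M\<^esub> a \<odot>\<^bsub>M\<^esub> y"
    and "\<And>a b x. \<lbrakk>a \<in> carrier R; b \<in> carrier R; x \<in> carrier M\<rbrakk> \<Longrightarrow>
        (a \<otimes>\<^bsub>R\<^esub> b) \<odot>\<^bsub>M\<^esub> x = a \<odot>\<^bsub>M\<^esub> (b \<odot>\<^bsub>M\<^esub> x)"
    and "\<And>x. x \<in> carrier M \<Longrightarrow> \<one>\<^bsub>R\<^esub> \<odot>\<^bsub>M\<^esub> x = x"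
  shows "left_module R M"
  using assms by (intro left_module.intro left_module_axioms.intro) auto

text \<open>Makes linear algebra (bases, dimension, rank-nullity) available for modules whose
  definition is phrased over arbitrary rings, in particular for the test modules in
  \<open>is_tensor\<close>.\<close>

lemma left_module_class_ring_iff:
  "left_module (class_ring :: 'k::field ring) V \<longleftrightarrow> vectorspace (class_ring :: 'k ring) V"
proof
  assume "left_module (class_ring :: 'k ring) V"
  then interpret left_module "class_ring :: 'k ring" V .
  show "vectorspace (class_ring :: 'k ring) V"
    unfolding vectorspace_def
    using class_field smult_closed smult_l_distr smult_r_distr smult_assoc smult_one
    by (intro conjI moduleI) (auto simp: M.abelian_group_axioms field.is_ring[OF class_field] intro: fieldE)
next
  assume "vectorspace (class_ring :: 'k ring) V"
  then interpret vectorspace "class_ring :: 'k ring" V .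
  show "left_module (class_ring :: 'k ring) V"
    using smult_l_distr smult_r_distr smult_assoc1 smult_one
    by (intro left_moduleI M.abelian_group_axioms smult_closed) (auto simp: field.is_ring[OF class_field] intro: cring.axioms fieldE(1))
qed

lemma (in left_module) smult_zero_left: "x \<in> carrier M \<Longrightarrow> \<zero>\<^bsub>R\<^esub> \<odot>\<^bsub>M\<^esub> x = \<zero>\<^bsub>M\<^esub>"
  using smult_l_distr[of "\<zero>\<^bsub>R\<^esub>" "\<zero>\<^bsub>R\<^esub>" x] smult_closed[of "\<zero>\<^bsub>R\<^esub>" x]
  by (metis M.add.r_cancel_one' R.l_zero R.zero_closed)

lemma (in left_module) smult_zero_right: "a \<in> carrier R \<Longrightarrow> a \<odot>\<^bsub>M\<^esub> \<zero>\<^bsub>M\<^esub> = \<zero>\<^bsub>M\<^esub>"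
  using smult_r_distr[of a "\<zero>\<^bsub>M\<^esub>" "\<zero>\<^bsub>M\<^esub>"] smult_closed[of a "\<zero>\<^bsub>M\<^esub>"]
  by (metis M.add.r_cancel_one' M.l_zero M.zero_closed)

lemma lmod_homI:
  assumes "\<And>x. x \<in> carrier M \<Longrightarrow> f x \<in> carrier N"
    and "\<And>x y. \<lbrakk>x \<in> carrier M; y \<in> carrier M\<rbrakk> \<Longrightarrow> f (x \<oplus>\<^bsub>M\<^esub> y) = f x \<oplus>\<^bsub>N\<^esub> f y"
    and "\<And>a x. \<lbrakk>a \<in> carrier R; x \<in> carrier M\<rbrakk> \<Longrightarrow> f (a \<odot>\<^bsub>M\<^esub> x) = a \<odot>\<^bsub>N\<^esub> f x"
  shows "f \<in> lmod_hom R M N"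
  using assms by (auto simp: lmod_hom_def hom_def)

lemma lmod_homD:
  assumes "f \<in> lmod_hom R M N"
  shows "x \<in> carrier M \<Longrightarrow> f x \<in> carrier N"
    and "\<lbrakk>x \<in> carrier M; y \<in> carrier M\<rbrakk> \<Longrightarrow> f (x \<oplus>\<^bsub>M\<^esub> y) = f x \<oplus>\<^bsub>N\<^esub> f y"
    and "\<lbrakk>a \<in> carrier R; x \<in> carrier M\<rbrakk> \<Longrightarrow> f (a \<odot>\<^bsub>M\<^esub> x) = a \<odot>\<^bsub>N\<^esub> f x"
  using assms by (auto simp: lmod_hom_def hom_def)

lemma lmod_hom_zero:
  assumes "f \<in> lmod_hom R M N" "abelian_group M" "abelian_group N"
  shows "f \<zero>\<^bsub>M\<^esub> = \<zero>\<^bsub>N\<^esub>"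
proof -
  interpret M: abelian_group M by fact
  interpret N: abelian_group N by fact
  have "f \<zero>\<^bsub>M\<^esub> \<oplus>\<^bsub>N\<^esub> f \<zero>\<^bsub>M\<^esub> = f \<zero>\<^bsub>M\<^esub>"
    using lmod_homD(2)[OF assms(1), of "\<zero>\<^bsub>M\<^esub>" "\<zero>\<^bsub>M\<^esub>"] by simp
  moreover have "f \<zero>\<^bsub>M\<^esub> \<in> carrier N" using lmod_homD(1)[OF assms(1)] by simp
  ultimately show ?thesis by (metis N.add.r_cancel_one')
qed

lemma lmod_hom_inv_into:
  assumes f: "f \<in> lmod_hom R M N" "bij_betw f (carrier M) (carrier N)" and "left_module R M"
  shows "inv_into (carrier M) f \<in> lmod_hom R N M"
proof -
  interpret left_module R M by fact
  let ?g = "inv_into (carrier M) f"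
  have g: "?g y \<in> carrier M" "f (?g y) = y" if "y \<in> carrier N" for y
    using that f(2) by (auto simp: bij_betw_def inv_into_into f_inv_into_f)
  have gf: "?g (f x) = x" if "x \<in> carrier M" for x
    using that f(2) by (simp add: bij_betw_def inv_into_f_f)
  show ?thesis
  proof (rule lmod_homI)
    fix x y assume "x \<in> carrier N" "y \<in> carrier N"
    then show "?g (x \<oplus>\<^bsub>N\<^esub> y) = ?g x \<oplus>\<^bsub>M\<^esub> ?g y"
      using gf[of "?g x \<oplus>\<^bsub>M\<^esub> ?g y"] g lmod_homD(2)[OF f(1), of "?g x" "?g y"] by simp
  next
    fix a x assume "a \<in> carrier R" "x \<in> carrier N"
    then show "?g (a \<odot>\<^bsub>N\<^esub> x) = a \<odot>\<^bsub>M\<^esub> ?g x"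
      using gf[of "a \<odot>\<^bsub>M\<^esub> ?g x"] g lmod_homD(3)[OF f(1), of a "?g x"] smult_closed by simp
  qed (use g in auto)
qed

lemma lmod_hom_comp:
  "f \<in> lmod_hom R M N \<Longrightarrow> g \<in> lmod_hom R N L \<Longrightarrow> (\<lambda>x. g (f x)) \<in> lmod_hom R M L"
  by (rule lmod_homI) (auto simp: lmod_homD)

lemma fg_gmodsD:
  assumes "M \<in> fg_gmods H"
  shows "left_module (group_algebra H) M" "abelian_group M"
  using assms by (auto simp: fg_gmods_def left_module_def)

lemma abelian_group_cong:
  assumes "abelian_group M" "carrier N = carrier M" "\<zero>\<^bsub>N\<^esub> = \<zero>\<^bsub>M\<^esub>"
    and add: "\<And>x y. x \<oplus>\<^bsub>N\<^esub> y = x \<oplus>\<^bsub>M\<^esub> y"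
  shows "abelian_group N"
proof -
  interpret abelian_group M by fact
  show ?thesis
    by (rule abelian_groupI) (use assms l_neg a_inv_closed in \<open>auto simp: a_ac\<close>)
qed

section \<open>Modules over the group algebra as vector spaces over K\<close>

context finite_group
begin

lemma ga_single_factor:
  "h \<in> carrier G \<Longrightarrow> ga_single h c = ga_single \<one> c \<otimes>\<^bsub>group_algebra G\<^esub> ga_single h (1::'k::field)"
  "h \<in> carrier G \<Longrightarrow> ga_single h c = ga_single h (1::'k::field) \<otimes>\<^bsub>group_algebra G\<^esub> ga_single \<one> c"
  by (simp_all add: ga_single_mult)

lemma ga_single_closed [simp]:
  "h \<in> carrier G \<Longrightarrow> ga_single h c \<in> carrier (group_algebra G :: ('g \<Rightarrow> 'k::field) ring)"
  by (simp add: ga_single_outside)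

lemma ga_single_one_closed [simp]:
  "ga_single \<one> c \<in> carrier (group_algebra G :: ('g \<Rightarrow> 'k::field) ring)"
  by (rule ga_single_closed) simp

lemma
  assumes "left_module (group_algebra G) (M :: ('g, 'k::field) gmod)" "h \<in> carrier G"
  shows ga_single_smult:
    "x \<in> carrier M \<Longrightarrow> ga_single h c \<odot>\<^bsub>M\<^esub> x = ga_single \<one> c \<odot>\<^bsub>M\<^esub> (ga_single h 1 \<odot>\<^bsub>M\<^esub> x)"
    and ga_single_smult_commute:
    "x \<in> carrier M \<Longrightarrow> ga_single h 1 \<odot>\<^bsub>M\<^esub> (ga_single \<one> c \<odot>\<^bsub>M\<^esub> x) = ga_single \<one> c \<odot>\<^bsub>M\<^esub> (ga_single h 1 \<odot>\<^bsub>M\<^esub> x)"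
proof -
  interpret left_module "group_algebra G" M by fact
  note cl = ga_single_closed[OF assms(2), of 1] ga_single_one_closed[of c]
  show 1: "ga_single h c \<odot>\<^bsub>M\<^esub> x = ga_single \<one> c \<odot>\<^bsub>M\<^esub> (ga_single h 1 \<odot>\<^bsub>M\<^esub> x)" if "x \<in> carrier M"
    using smult_assoc[OF cl(2,1) that] ga_single_factor(1)[OF assms(2), of c] by simp
  show "ga_single h 1 \<odot>\<^bsub>M\<^esub> (ga_single \<one> c \<odot>\<^bsub>M\<^esub> x) = ga_single \<one> c \<odot>\<^bsub>M\<^esub> (ga_single h 1 \<odot>\<^bsub>M\<^esub> x)"
    if "x \<in> carrier M"
    using smult_assoc[OF cl that] ga_single_factor(2)[OF assms(2), of c] 1[OF that] by simp
qed

text \<open>By support induction, an element of K[G] acts as a finite sum of scaled group elements,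
  so additive closure reduces everything to those.\<close>

lemma ga_smult_closedI:
  assumes "left_module (group_algebra G) (M :: ('g, 'k::field) gmod)"
    and "a \<in> carrier (group_algebra G)" "x \<in> carrier M" "\<zero>\<^bsub>M\<^esub> \<in> N"
    and add: "\<And>x y. \<lbrakk>x \<in> N; y \<in> N\<rbrakk> \<Longrightarrow> x \<oplus>\<^bsub>M\<^esub> y \<in> N"
    and single: "\<And>h c. h \<in> carrier G \<Longrightarrow> ga_single h c \<odot>\<^bsub>M\<^esub> x \<in> N"
  shows "a \<odot>\<^bsub>M\<^esub> x \<in> N"
proof -
  interpret left_module "group_algebra G" M by fact
  show ?thesis
  proof (rule ga_support_induct[where S = "carrier G" and a = a and P = "\<lambda>a. a \<odot>\<^bsub>M\<^esub> x \<in> N"])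
    show "(\<lambda>_. 0) \<odot>\<^bsub>M\<^esub> x \<in> N"
      using assms(3,4) smult_zero_left[of x] by simp
  next
    fix h c b
    assume h: "h \<in> carrier G" "\<And>g. g \<notin> carrier G \<Longrightarrow> b g = 0" "b \<odot>\<^bsub>M\<^esub> x \<in> N"
    have "(\<lambda>g. ga_single h c g + b g) \<odot>\<^bsub>M\<^esub> x = ga_single h c \<odot>\<^bsub>M\<^esub> x \<oplus>\<^bsub>M\<^esub> b \<odot>\<^bsub>M\<^esub> x"
      using smult_l_distr[of "ga_single h c" b x] h assms(3) by (simp add: ga_single_outside)
    with h single add show "(\<lambda>g. ga_single h c g + b g) \<odot>\<^bsub>M\<^esub> x \<in> N" by simp
  qed (use assms(2) in auto)
qed

lemma vectorspace_restrict_scalars: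
  assumes "left_module (group_algebra G) (M :: ('g, 'k::field) gmod)"
  shows "vectorspace class_ring (restrict_scalars G M)"
proof -
  interpret left_module "group_algebra G" M by fact
  let ?K = "class_ring :: 'k ring"
  have ab: "abelian_group (restrict_scalars G M)"
    by (rule abelian_group_cong[OF M.abelian_group_axioms]) (auto simp: restrict_scalars_def)
  have s: "ga_single \<one> c \<odot>\<^bsub>M\<^esub> x \<in> carrier M" if "x \<in> carrier M" for c x
    using smult_closed[OF ga_single_one_closed that] .
  have "left_module ?K (restrict_scalars G M)"
  proof (rule left_moduleI)
    show "ring ?K" by (simp add: field.is_ring[OF class_field])
  next
    fix a b :: 'k and x assume "x \<in> carrier (restrict_scalars G M)"
    then have x: "x \<in> carrier M" by (simp add: restrict_scalars_def)
    show "(a \<oplus>\<^bsub>?K\<^esub> b) \<odot>\<^bsub>restrict_scalars G M\<^esub> x =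
        a \<odot>\<^bsub>restrict_scalars G M\<^esub> x \<oplus>\<^bsub>restrict_scalars G M\<^esub> b \<odot>\<^bsub>restrict_scalars G M\<^esub> x"
      using smult_l_distr[OF ga_single_one_closed[of a] ga_single_one_closed[of b] x]
      by (simp add: restrict_scalars_def ga_single_add)
    show "(a \<otimes>\<^bsub>?K\<^esub> b) \<odot>\<^bsub>restrict_scalars G M\<^esub> x =
        a \<odot>\<^bsub>restrict_scalars G M\<^esub> (b \<odot>\<^bsub>restrict_scalars G M\<^esub> x)"
      using smult_assoc[OF ga_single_one_closed[of a] ga_single_one_closed[of b] x]
      by (simp add: restrict_scalars_def ga_single_mult)
  next
    fix x assume "x \<in> carrier (restrict_scalars G M)"
    then show "\<one>\<^bsub>?K\<^esub> \<odot>\<^bsub>restrict_scalars G M\<^esub> x = x"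
      using smult_one by (simp add: restrict_scalars_def)
  next
    fix a :: 'k and x y assume "x \<in> carrier (restrict_scalars G M)" "y \<in> carrier (restrict_scalars G M)"
    then show "a \<odot>\<^bsub>restrict_scalars G M\<^esub> (x \<oplus>\<^bsub>restrict_scalars G M\<^esub> y) =
        a \<odot>\<^bsub>restrict_scalars G M\<^esub> x \<oplus>\<^bsub>restrict_scalars G M\<^esub> a \<odot>\<^bsub>restrict_scalars G M\<^esub> y"
      using smult_r_distr[OF ga_single_one_closed] by (simp add: restrict_scalars_def)
  qed (use ab s in \<open>auto simp: restrict_scalars_def\<close>)
  then show ?thesis by (simp add: left_module_class_ring_iff)
qed

lemma restrict_scalars_simps [simp]:
  "carrier (restrict_scalars G M) = carrier M"
  "x \<oplus>\<^bsub>restrict_scalars G M\<^esub> y = x \<oplus>\<^bsub>M\<^esub> y"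
  "\<zero>\<^bsub>restrict_scalars G M\<^esub> = \<zero>\<^bsub>M\<^esub>"
  "c \<odot>\<^bsub>restrict_scalars G M\<^esub> x = ga_single \<one> c \<odot>\<^bsub>M\<^esub> x"
  by (simp_all add: restrict_scalars_def)

text \<open>A finite set generating over \<open>K[G]\<close> becomes, after translating by \<open>G\<close>, a finite spanning set.\<close>

lemma fg_gmods_span:
  assumes "M \<in> fg_gmods G"
  obtains A where "finite A" "A \<subseteq> carrier M"
    "\<And>N. \<lbrakk>\<zero>\<^bsub>M\<^esub> \<in> N; \<And>x y. \<lbrakk>x \<in> N; y \<in> N\<rbrakk> \<Longrightarrow> x \<oplus>\<^bsub>M\<^esub> y \<in> N;
      \<And>c x. x \<in> N \<Longrightarrow> ga_single \<one> c \<odot>\<^bsub>M\<^esub> x \<in> N; A \<subseteq> N; N \<subseteq> carrier M\<rbrakk> \<Longrightarrow> N = carrier M"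
proof -
  have lm: "left_module (group_algebra G) M" using assms by (simp add: fg_gmods_def)
  note oneG = one_closed
  interpret left_module "group_algebra G" M by fact
  obtain S where S: "finite S" "S \<subseteq> carrier M"
    "\<And>N. submodule N (group_algebra G) M \<Longrightarrow> S \<subseteq> N \<Longrightarrow> N = carrier M"
    using assms by (auto simp: fg_gmods_def fin_gen_def)
  let ?A = "(\<lambda>(h, s). ga_single h 1 \<odot>\<^bsub>M\<^esub> s) ` (carrier G \<times> S)"
  have gen: "N = carrier M"
    if zero: "\<zero>\<^bsub>M\<^esub> \<in> N" and add: "\<And>x y. \<lbrakk>x \<in> N; y \<in> N\<rbrakk> \<Longrightarrow> x \<oplus>\<^bsub>M\<^esub> y \<in> N"
      and smult: "\<And>c x. x \<in> N \<Longrightarrow> ga_single \<one> c \<odot>\<^bsub>M\<^esub> x \<in> N" and A: "?A \<subseteq> N" and N: "N \<subseteq> carrier M" for N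
  proof -
    \<comment> \<open>The vectors whose whole G-orbit lies in \<open>N\<close>. This is a
      K[G]-submodule although \<open>N\<close> is only a K-subspace, and it contains
      \<open>S\<close> because all translates of \<open>S\<close> lie in \<open>N\<close>; so it is
      everything.\<close>
    define N' where "N' = {x \<in> carrier M. \<forall>h\<in>carrier G. ga_single h 1 \<odot>\<^bsub>M\<^esub> x \<in> N}"
    have add': "x \<oplus>\<^bsub>M\<^esub> y \<in> N'" if "x \<in> N'" "y \<in> N'" for x y
      using that smult_r_distr[OF ga_single_closed] add by (auto simp: N'_def)
    have zero': "\<zero>\<^bsub>M\<^esub> \<in> N'"
      using zero smult_zero_right[OF ga_single_closed] by (auto simp: N'_def)
    have single': "ga_single h c \<odot>\<^bsub>M\<^esub> x \<in> N'" if "h \<in> carrier G" "x \<in> N'" for h c x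
    proof -
      have "ga_single k 1 \<odot>\<^bsub>M\<^esub> (ga_single h c \<odot>\<^bsub>M\<^esub> x) \<in> N" if k: "k \<in> carrier G" for k
      proof -
        have "ga_single k 1 \<odot>\<^bsub>M\<^esub> (ga_single h c \<odot>\<^bsub>M\<^esub> x) = ga_single (k \<otimes> h) c \<odot>\<^bsub>M\<^esub> x"
          using smult_assoc[OF ga_single_closed ga_single_closed, of k h x 1 c] k \<open>h \<in> carrier G\<close> \<open>x \<in> N'\<close>
          by (simp add: ga_single_mult N'_def)
        also have "\<dots> = ga_single \<one> c \<odot>\<^bsub>M\<^esub> (ga_single (k \<otimes> h) 1 \<odot>\<^bsub>M\<^esub> x)"
          using ga_single_smult[OF lm, of "k \<otimes> h" x c] k \<open>h \<in> carrier G\<close> \<open>x \<in> N'\<close> by (simp add: N'_def)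
        also have "\<dots> \<in> N" using smult k \<open>h \<in> carrier G\<close> \<open>x \<in> N'\<close> by (simp add: N'_def)
        finally show ?thesis .
      qed
      then show ?thesis using that smult_closed[OF ga_single_closed] by (auto simp: N'_def)
    qed
    have smult': "a \<odot>\<^bsub>M\<^esub> x \<in> N'" if "a \<in> carrier (group_algebra G)" "x \<in> N'" for a x
    proof (rule ga_smult_closedI[OF lm that(1) _ zero' add'])
      show "x \<in> carrier M" using that(2) by (simp add: N'_def)
    qed (use single' that(2) in blast)+
    have "submodule N' (group_algebra G) M"
    proof (intro Module.submodule.intro Module.submodule_axioms.intro M.add.subgroupI)
      show "N' \<subseteq> carrier M" by (auto simp: N'_def)
      show "N' \<noteq> {}" using zero' by auto
      fix x assume x: "x \<in> N'"
      then have xc: "x \<in> carrier M" by (simp add: N'_def)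
      have "ga_single \<one> (-1) \<odot>\<^bsub>M\<^esub> x \<oplus>\<^bsub>M\<^esub> x = (ga_single \<one> (-1) \<oplus>\<^bsub>group_algebra G\<^esub> \<one>\<^bsub>group_algebra G\<^esub>) \<odot>\<^bsub>M\<^esub> x"
        using smult_l_distr[OF ga_single_one_closed R.one_closed xc] smult_one[OF xc] by simp
      also have "ga_single \<one> (-1) \<oplus>\<^bsub>group_algebra G\<^esub> \<one>\<^bsub>group_algebra G\<^esub> = \<zero>\<^bsub>group_algebra G\<^esub>"
        by (auto simp: ga_single_def)
      finally have "ga_single \<one> (-1) \<odot>\<^bsub>M\<^esub> x \<oplus>\<^bsub>M\<^esub> x = \<zero>\<^bsub>M\<^esub>" using smult_zero_left[OF xc] by simp
      then have "\<ominus>\<^bsub>M\<^esub> x = ga_single \<one> (-1) \<odot>\<^bsub>M\<^esub> x"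
        using xc smult_closed[OF ga_single_one_closed xc] M.minus_equality by simp
      then show "\<ominus>\<^bsub>M\<^esub> x \<in> N'" using single'[OF oneG x] by simp
    qed (use add' smult' in auto)
    moreover have "S \<subseteq> N'" using S(2) A by (auto simp: N'_def)
    ultimately have "N' = carrier M" by (rule S(3))
    then have "ga_single \<one> 1 \<odot>\<^bsub>M\<^esub> x \<in> N" if "x \<in> carrier M" for x
      using that by (auto simp: N'_def)
    then show "N = carrier M" using N smult_one by auto
  qed
  show ?thesis
  proof (rule that)
    show "finite ?A" using S by simp
    show "?A \<subseteq> carrier M" using S smult_closed[OF ga_single_closed] by auto
  qed (rule gen)
qed

lemma fin_dim_restrict_scalars:
  assumes "M \<in> fg_gmods G"
  shows "vectorspace.fin_dim class_ring (restrict_scalars G M)"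
proof -
  interpret V: vectorspace class_ring "restrict_scalars G M"
    by (intro vectorspace_restrict_scalars fg_gmodsD assms)
  obtain A where A: "finite A" "A \<subseteq> carrier M"
    "\<And>N. \<lbrakk>\<zero>\<^bsub>M\<^esub> \<in> N; \<And>x y. \<lbrakk>x \<in> N; y \<in> N\<rbrakk> \<Longrightarrow> x \<oplus>\<^bsub>M\<^esub> y \<in> N;
      \<And>c x. x \<in> N \<Longrightarrow> ga_single \<one> c \<odot>\<^bsub>M\<^esub> x \<in> N; A \<subseteq> N; N \<subseteq> carrier M\<rbrakk> \<Longrightarrow> N = carrier M"
    using fg_gmods_span[OF assms] by metis
  have sub: "LinearCombinations.submodule class_ring (V.span A) (restrict_scalars G M)"
    using A(2) by (intro V.span_is_submodule) simp
  have "V.span A = carrier M"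
    using sub V.in_own_span[of A] A(2)
    by (intro A(3)) (auto simp: LinearCombinations.submodule_def)
  with A show ?thesis by (auto simp: V.fin_dim_def)
qed

text \<open>Every K[G]-submodule is a K-subspace, so a finite set that spans over K generates over
  K[G].\<close>

lemma fin_genI:
  assumes "left_module (group_algebra G) (M :: ('g, 'k::field) gmod)"
    and "finite A" "A \<subseteq> carrier M"
    and "\<And>N. \<lbrakk>\<zero>\<^bsub>M\<^esub> \<in> N; \<And>x y. \<lbrakk>x \<in> N; y \<in> N\<rbrakk> \<Longrightarrow> x \<oplus>\<^bsub>M\<^esub> y \<in> N;
      \<And>c x. x \<in> N \<Longrightarrow> ga_single \<one> c \<odot>\<^bsub>M\<^esub> x \<in> N; A \<subseteq> N; N \<subseteq> carrier M\<rbrakk> \<Longrightarrow> N = carrier M"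
  shows "M \<in> fg_gmods G"
proof -
  have "N = carrier M" if N: "submodule N (group_algebra G) M" "A \<subseteq> N" for N
  proof (rule assms(4))
    interpret Module.submodule N "group_algebra G" M by fact
    show "\<zero>\<^bsub>M\<^esub> \<in> N" "N \<subseteq> carrier M" using one_closed subset by auto
    show "x \<oplus>\<^bsub>M\<^esub> y \<in> N" if "x \<in> N" "y \<in> N" for x y using m_closed[OF that] by simp
    show "ga_single \<one> c \<odot>\<^bsub>M\<^esub> x \<in> N" if "x \<in> N" for c x
      using that by (intro smult_closed ga_single_closed) auto
  qed (use N in auto)
  with assms show ?thesis by (auto simp: fg_gmods_def fin_gen_def)
qed

end

section \<open>Pullbacks, permutation modules and Grothendieck classes\<close>

lemma ga_zero_mult [simp]:
  "(\<lambda>_. 0) \<otimes>\<^bsub>group_algebra G\<^esub> b = (\<lambda>_. 0::'k::field)"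
  "b \<otimes>\<^bsub>group_algebra G\<^esub> (\<lambda>_. 0) = (\<lambda>_. 0::'k::field)"
  by (auto simp: group_algebra_def intro!: sum.neutral)

locale finite_group_hom = H: finite_group H + G: finite_group G
  for H :: "('g, 'b) monoid_scheme" and G :: "('g, 'b) monoid_scheme" +
  fixes \<phi> :: "'g \<Rightarrow> 'g"
  assumes hom: "\<phi> \<in> hom H G"
begin

lemma hom_closed: "h \<in> carrier H \<Longrightarrow> \<phi> h \<in> carrier G"
  using hom by (auto simp: hom_def)

lemma hom_one: "\<phi> \<one>\<^bsub>H\<^esub> = \<one>\<^bsub>G\<^esub>"
  by (rule hom_one[OF hom H.is_group G.is_group])

lemma ga_map_closed: "ga_map H \<phi> a \<in> carrier (group_algebra G)"
  using hom_closed by (auto simp: ga_map_def intro!: sum.neutral)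

lemma ga_map_zero [simp]: "ga_map H \<phi> (\<lambda>_. 0) = (\<lambda>_. 0)"
  by (simp add: ga_map_def)

lemma ga_map_add: "ga_map H \<phi> (\<lambda>g. a g + b g) = (\<lambda>g. ga_map H \<phi> a g + ga_map H \<phi> b g)"
  by (simp add: ga_map_def sum.distrib)

lemma ga_map_single: "h \<in> carrier H \<Longrightarrow> ga_map H \<phi> (ga_single h c) = ga_single (\<phi> h) c"
proof
  fix g assume "h \<in> carrier H"
  have "(\<Sum>x\<in>{x \<in> carrier H. \<phi> x = g}. ga_single h c x) = (if h \<in> {x \<in> carrier H. \<phi> x = g} then c else 0)"
    by (simp add: ga_single_def)
  with \<open>h \<in> carrier H\<close> show "ga_map H \<phi> (ga_single h c) g = ga_single (\<phi> h) c g"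
    by (auto simp: ga_map_def ga_single_def)
qed

lemma sum_ga_map:
  fixes F :: "'g \<Rightarrow> 'k::field"
  shows "(\<Sum>g\<in>carrier G. ga_map H \<phi> a g * F g) = (\<Sum>h\<in>carrier H. a h * F (\<phi> h))"
proof -
  have "(\<Sum>g\<in>carrier G. ga_map H \<phi> a g * F g) =
      (\<Sum>g\<in>carrier G. \<Sum>h\<in>{h \<in> carrier H. \<phi> h = g}. a h * F (\<phi> h))"
    by (simp add: ga_map_def sum_distrib_right)
  also have "\<dots> = (\<Sum>h\<in>carrier H. a h * F (\<phi> h))"
    by (rule sum.group) (auto simp: hom_closed)
  finally show ?thesis .
qed

text \<open>Both sides are bilinear; one support induction in each argument reduces the claim to
  products of group elements, where \<open>\<phi>\<close> is multiplicative.\<close>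

lemma ga_map_mult:
  fixes a b :: "'g \<Rightarrow> 'k::field"
  assumes a: "a \<in> carrier (group_algebra H)" and b: "b \<in> carrier (group_algebra H)"
  shows "ga_map H \<phi> (a \<otimes>\<^bsub>group_algebra H\<^esub> b) = ga_map H \<phi> a \<otimes>\<^bsub>group_algebra G\<^esub> ga_map H \<phi> b"
proof -
  have single: "ga_map H \<phi> (ga_single h c \<otimes>\<^bsub>group_algebra H\<^esub> b) =
      ga_map H \<phi> (ga_single h c) \<otimes>\<^bsub>group_algebra G\<^esub> ga_map H \<phi> b" if h: "h \<in> carrier H" for h and c :: 'k
  proof (rule ga_support_induct[where S = "carrier H" and a = b and P = "\<lambda>b. ga_map H \<phi> (ga_single h c \<otimes>\<^bsub>group_algebra H\<^esub> b) =
      ga_map H \<phi> (ga_single h c) \<otimes>\<^bsub>group_algebra G\<^esub> ga_map H \<phi> b"])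
    fix k d and b :: "'g \<Rightarrow> 'k"
    assume "k \<in> carrier H" "ga_map H \<phi> (ga_single h c \<otimes>\<^bsub>group_algebra H\<^esub> b) =
      ga_map H \<phi> (ga_single h c) \<otimes>\<^bsub>group_algebra G\<^esub> ga_map H \<phi> b"
    with h show "ga_map H \<phi> (ga_single h c \<otimes>\<^bsub>group_algebra H\<^esub> (\<lambda>g. ga_single k d g + b g)) =
      ga_map H \<phi> (ga_single h c) \<otimes>\<^bsub>group_algebra G\<^esub> ga_map H \<phi> (\<lambda>g. ga_single k d g + b g)"
      using hom_mult[OF hom] hom_closed
      by (simp add: H.ga_r_distr G.ga_r_distr ga_map_add ga_map_single H.ga_single_mult G.ga_single_mult)
  qed (use b in auto)
  show ?thesis
  proof (rule ga_support_induct[where S = "carrier H" and a = a and P = "\<lambda>a. ga_map H \<phi> (a \<otimes>\<^bsub>group_algebra H\<^esub> b) =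
      ga_map H \<phi> a \<otimes>\<^bsub>group_algebra G\<^esub> ga_map H \<phi> b"])
    fix h c and a :: "'g \<Rightarrow> 'k"
    assume "h \<in> carrier H" "ga_map H \<phi> (a \<otimes>\<^bsub>group_algebra H\<^esub> b) =
      ga_map H \<phi> a \<otimes>\<^bsub>group_algebra G\<^esub> ga_map H \<phi> b"
    then show "ga_map H \<phi> ((\<lambda>g. ga_single h c g + a g) \<otimes>\<^bsub>group_algebra H\<^esub> b) =
      ga_map H \<phi> (\<lambda>g. ga_single h c g + a g) \<otimes>\<^bsub>group_algebra G\<^esub> ga_map H \<phi> b"
      by (simp add: H.ga_l_distr G.ga_l_distr ga_map_add single)
  qed (use a in auto)
qed

lemma pullback_simps [simp]:
  "carrier (pullback H \<phi> M) = carrier M"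
  "x \<oplus>\<^bsub>pullback H \<phi> M\<^esub> y = x \<oplus>\<^bsub>M\<^esub> y"
  "\<zero>\<^bsub>pullback H \<phi> M\<^esub> = \<zero>\<^bsub>M\<^esub>"
  "a \<odot>\<^bsub>pullback H \<phi> M\<^esub> x = ga_map H \<phi> a \<odot>\<^bsub>M\<^esub> x"
  by (simp_all add: pullback_def)

lemma left_module_pullback:
  assumes "left_module (group_algebra G) (M :: ('g, 'k::field) gmod)"
  shows "left_module (group_algebra H) (pullback H \<phi> M)"
proof -
  interpret left_module "group_algebra G" M by fact
  show ?thesis
  proof (rule left_moduleI[OF H.ring_group_algebra])
    show "abelian_group (pullback H \<phi> M)"
      by (rule abelian_group_cong[OF M.abelian_group_axioms]) auto
  next
    fix a b :: "'g \<Rightarrow> 'k" and x assume "a \<in> carrier (group_algebra H)" "b \<in> carrier (group_algebra H)"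
      "x \<in> carrier (pullback H \<phi> M)"
    then show "(a \<oplus>\<^bsub>group_algebra H\<^esub> b) \<odot>\<^bsub>pullback H \<phi> M\<^esub> x =
        a \<odot>\<^bsub>pullback H \<phi> M\<^esub> x \<oplus>\<^bsub>pullback H \<phi> M\<^esub> b \<odot>\<^bsub>pullback H \<phi> M\<^esub> x"
      and "(a \<otimes>\<^bsub>group_algebra H\<^esub> b) \<odot>\<^bsub>pullback H \<phi> M\<^esub> x =
        a \<odot>\<^bsub>pullback H \<phi> M\<^esub> (b \<odot>\<^bsub>pullback H \<phi> M\<^esub> x)"
      using smult_l_distr[OF ga_map_closed ga_map_closed] smult_assoc[OF ga_map_closed ga_map_closed]
        ga_map_mult[of a b]
      by (simp_all add: ga_map_add)
  next
    fix x assume "x \<in> carrier (pullback H \<phi> M)"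
    then show "\<one>\<^bsub>group_algebra H\<^esub> \<odot>\<^bsub>pullback H \<phi> M\<^esub> x = x"
      using smult_one by (simp add: ga_map_single hom_one)
  qed (simp_all add: smult_closed[OF ga_map_closed] smult_r_distr[OF ga_map_closed])
qed

text \<open>The spanning condition from \<open>fg_gmods_span\<close> mentions only addition and
  scalars from K. A homomorphism maps the unit to the unit, so pulling back leaves these unchanged
  and the same finite set serves.\<close>

lemma pullback_fg_gmods:
  assumes M: "M \<in> fg_gmods G"
  shows "pullback H \<phi> M \<in> fg_gmods H"
proof -
  obtain A where "finite A" "A \<subseteq> carrier M"
    "\<And>N. \<lbrakk>\<zero>\<^bsub>M\<^esub> \<in> N; \<And>x y. \<lbrakk>x \<in> N; y \<in> N\<rbrakk> \<Longrightarrow> x \<oplus>\<^bsub>M\<^esub> y \<in> N;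
      \<And>c x. x \<in> N \<Longrightarrow> ga_single \<one>\<^bsub>G\<^esub> c \<odot>\<^bsub>M\<^esub> x \<in> N; A \<subseteq> N; N \<subseteq> carrier M\<rbrakk> \<Longrightarrow> N = carrier M"
    using G.fg_gmods_span[OF M] by metis
  then show ?thesis
    by (intro H.fin_genI[of _ A] left_module_pullback fg_gmodsD(1)[OF M])
      (auto simp: ga_map_single hom_one)
qed

lemma lmod_hom_pullback:
  "f \<in> lmod_hom (group_algebra G) M N \<Longrightarrow>
    f \<in> lmod_hom (group_algebra H) (pullback H \<phi> M) (pullback H \<phi> N)"
  by (intro lmod_homI) (simp_all del: group_algebra_simps add: lmod_homD ga_map_closed)

text \<open>Pulling back alters scalar multiplication only, so injectivity, kernel and image of the
  two maps stay as they are.\<close>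

lemma lmod_short_exact_pullback:
  "lmod_short_exact (group_algebra G) A f B g C \<Longrightarrow>
    lmod_short_exact (group_algebra H) (pullback H \<phi> A) f (pullback H \<phi> B) g (pullback H \<phi> C)"
  by (simp add: lmod_short_exact_def lmod_hom_pullback a_kernel_def')

end


section \<open>Permutation modules\<close>

definition perm_action :: "('g, 'b) monoid_scheme \<Rightarrow> nat \<Rightarrow> ('g \<Rightarrow> nat \<Rightarrow> nat) \<Rightarrow> bool" where
  "perm_action G n \<alpha> \<longleftrightarrow>
    (\<forall>h\<in>carrier G. \<forall>i. \<alpha> h i < n \<longleftrightarrow> i < n) \<and> (\<forall>i. \<alpha> \<one>\<^bsub>G\<^esub> i = i) \<and>
    (\<forall>h\<in>carrier G. \<forall>k\<in>carrier G. \<forall>i. \<alpha> (h \<otimes>\<^bsub>G\<^esub> k) i = \<alpha> k (\<alpha> h i))"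

text \<open>A right action on the indices makes the functions on \<open>{..<n}\<close> a left module.\<close>

definition perm_gmod :: "('g, 'b) monoid_scheme \<Rightarrow> nat \<Rightarrow> ('g \<Rightarrow> nat \<Rightarrow> nat) \<Rightarrow> ('g, 'k::field) gmod" where
  "perm_gmod G n \<alpha> =
    \<lparr>carrier = {v. \<forall>i\<ge>n. v i = 0}, mult = undefined, one = undefined,
     zero = (\<lambda>_. 0), add = (\<lambda>v w i. v i + w i),
     smult = (\<lambda>a v i. \<Sum>h\<in>carrier G. a h * v (\<alpha> h i))\<rparr>"

lemma perm_gmod_simps [simp]:
  "carrier (perm_gmod G n \<alpha>) = {v. \<forall>i\<ge>n. v i = 0}"
  "\<zero>\<^bsub>perm_gmod G n \<alpha>\<^esub> = (\<lambda>_. 0)"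
  "v \<oplus>\<^bsub>perm_gmod G n \<alpha>\<^esub> w = (\<lambda>i. v i + w i)"
  "a \<odot>\<^bsub>perm_gmod G n \<alpha>\<^esub> v = (\<lambda>i. \<Sum>h\<in>carrier G. a h * v (\<alpha> h i))"
  by (simp_all add: perm_gmod_def)

text \<open>Lets everything proved for permutation modules apply to the unit of the Grothendieck
  ring, as the permutation module of a single point.\<close>

lemma trivial_gmod_eq_perm_gmod: "trivial_gmod G = perm_gmod G 1 (\<lambda>_ i. i)"
  by (auto simp: trivial_gmod_def perm_gmod_def sum_distrib_right Suc_le_eq)

lemma perm_action_trivial: "perm_action G n (\<lambda>_ i. i)"
  by (simp add: perm_action_def)

lemma coordinate_induct:
  fixes N :: "(nat \<Rightarrow> 'k::field) set"
  assumes "(\<lambda>_. 0) \<in> N" "\<And>v w. v \<in> N \<Longrightarrow> w \<in> N \<Longrightarrow> (\<lambda>i. v i + w i) \<in> N"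
    and "\<And>k c. k < n \<Longrightarrow> (\<lambda>i. if i = k then c else 0) \<in> N"
    and "\<And>i. i \<ge> n \<Longrightarrow> v i = 0"
  shows "v \<in> N"
proof -
  have "v \<in> N" if "k \<le> n" "\<And>i. i \<ge> k \<Longrightarrow> v i = 0" for k v
    using that
  proof (induction k arbitrary: v)
    case 0
    then have "v = (\<lambda>_. 0)" by auto
    with assms(1) show ?case by simp
  next
    case (Suc k)
    have "v(k := 0) \<in> N" using Suc.prems by (intro Suc.IH) auto
    with assms(2)[OF this assms(3)[of k "v k"]] Suc.prems
    have "(\<lambda>i. (v(k := 0)) i + (if i = k then v k else 0)) \<in> N" by simp
    moreover have "(\<lambda>i. (v(k := 0)) i + (if i = k then v k else 0)) = v" by auto
    ultimately show ?case by simp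
  qed
  with assms(4) show ?thesis by blast
qed

context finite_group
begin

lemma perm_gmod_fg_gmods:
  assumes "perm_action G n \<alpha>"
  shows "perm_gmod G n \<alpha> \<in> (fg_gmods G :: ('g, 'k::field) gmod set)"
proof (rule fin_genI)
  let ?M = "perm_gmod G n \<alpha> :: ('g, 'k) gmod"
  show "left_module (group_algebra G) ?M"
  proof (rule left_moduleI[OF ring_group_algebra])
    show "abelian_group ?M"
    proof (rule abelian_groupI)
      fix x assume "x \<in> carrier ?M"
      then show "\<exists>y\<in>carrier ?M. y \<oplus>\<^bsub>?M\<^esub> x = \<zero>\<^bsub>?M\<^esub>"
        by (intro bexI[of _ "\<lambda>i. - x i"]) auto
    qed (auto simp: ac_simps)
  next
    fix a :: "'g \<Rightarrow> 'k" and x assume "a \<in> carrier (group_algebra G)" "x \<in> carrier ?M"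
    \<comment> \<open>At a coordinate \<open>i \<ge> n\<close> every summand vanishes, because the
      equivalence in \<open>perm_action\<close> also keeps indices from \<open>n\<close> on out of
      \<open>{..<n}\<close>.\<close>
    then show "a \<odot>\<^bsub>?M\<^esub> x \<in> carrier ?M"
      using assms by (auto simp: perm_action_def not_less[symmetric] intro!: sum.neutral)
  next
    fix a b :: "'g \<Rightarrow> 'k" and x
    have "(\<Sum>h\<in>carrier G. \<Sum>k\<in>carrier G. a h * b k * x (\<alpha> (h \<otimes> k) i)) =
      (\<Sum>h\<in>carrier G. a h * (\<Sum>k\<in>carrier G. b k * x (\<alpha> k (\<alpha> h i))))" for i
      using assms by (auto simp: perm_action_def sum_distrib_left mult.assoc intro!: sum.cong)
    then show "(a \<otimes>\<^bsub>group_algebra G\<^esub> b) \<odot>\<^bsub>?M\<^esub> x = a \<odot>\<^bsub>?M\<^esub> (b \<odot>\<^bsub>?M\<^esub> x)"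
      by (simp add: sum_ga_mult)
  next
    fix x assume "x \<in> carrier ?M"
    show "\<one>\<^bsub>group_algebra G\<^esub> \<odot>\<^bsub>?M\<^esub> x = x"
      using assms by (simp add: perm_action_def)
  qed (simp_all add: distrib_right distrib_left sum.distrib)
  let ?e = "\<lambda>i j. if j = i then 1 else (0::'k)"
  show "finite (?e ` {..<n})" "?e ` {..<n} \<subseteq> carrier ?M" by auto
  fix N
  assume N: "\<zero>\<^bsub>?M\<^esub> \<in> N" "\<And>x y. x \<in> N \<Longrightarrow> y \<in> N \<Longrightarrow> x \<oplus>\<^bsub>?M\<^esub> y \<in> N"
    "\<And>c x. x \<in> N \<Longrightarrow> ga_single \<one> c \<odot>\<^bsub>?M\<^esub> x \<in> N" "?e ` {..<n} \<subseteq> N" "N \<subseteq> carrier ?M"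
  have "v \<in> N" if "v \<in> carrier ?M" for v
  proof (rule coordinate_induct[where n = n])
    fix k and c :: 'k assume "k < n"
    then have "?e k \<in> N" using N(4) by auto
    from N(3)[OF this, of c] show "(\<lambda>i. if i = k then c else 0) \<in> N"
      using assms by (simp add: perm_action_def if_distrib[of "\<lambda>x. c * x"] cong: if_cong)
  qed (use N that in auto)
  with N(5) show "N = carrier ?M" by auto
qed

end


section \<open>Classes in the Grothendieck group\<close>

definition gclass :: "('g, 'b) monoid_scheme \<Rightarrow> (('g, 'k::field) gmod \<Rightarrow>\<^sub>0 int) \<Rightarrow> (('g, 'k) gmod \<Rightarrow>\<^sub>0 int) set" where
  "gclass H x = exact_relations H +>\<^bsub>free_gmods H\<^esub> x"

lemma add_monoid_free_gmods: "add_monoid (free_gmods H) = free_Abelian_group (fg_gmods H)"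
  by (simp add: free_gmods_def free_Abelian_group_def)

lemma free_gmods_simps [simp]:
  "carrier (free_gmods H) = {x. Poly_Mapping.keys x \<subseteq> fg_gmods H}"
  "x \<oplus>\<^bsub>free_gmods H\<^esub> y = x + y"
  "\<zero>\<^bsub>free_gmods H\<^esub> = 0"
  by (auto simp: free_gmods_def free_Abelian_group_def)

lemma exact_relations_subgroup:
  fixes H :: "('g, 'b) monoid_scheme"
  shows "subgroup (exact_relations H :: (('g, 'k::field) gmod \<Rightarrow>\<^sub>0 int) set) (free_Abelian_group (fg_gmods H))"
  unfolding exact_relations_def add_monoid_free_gmods
proof (rule group.generate_is_subgroup[OF group_free_Abelian_group], safe)
  fix A B C :: "('g, 'k) gmod"
  assume "A \<in> fg_gmods H" "B \<in> fg_gmods H" "C \<in> fg_gmods H"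
  moreover have "Poly_Mapping.keys (frag_of B - frag_of A - frag_of C) \<subseteq> {A, B, C}"
    using keys_diff[of "frag_of B - frag_of A" "frag_of C"] keys_diff[of "frag_of B" "frag_of A"] by auto
  ultimately show "frag_of B - frag_of A - frag_of C \<in> carrier (free_Abelian_group (fg_gmods H))"
    by auto
qed

lemma exact_relations_closed:
  "0 \<in> exact_relations H"
  "x \<in> exact_relations H \<Longrightarrow> y \<in> exact_relations H \<Longrightarrow> x + y \<in> exact_relations H"
  "x \<in> exact_relations H \<Longrightarrow> - x \<in> exact_relations H"
  "x \<in> exact_relations H \<Longrightarrow> y \<in> exact_relations H \<Longrightarrow> x - y \<in> exact_relations H"
  "x \<in> exact_relations H \<Longrightarrow> Poly_Mapping.keys x \<subseteq> fg_gmods H"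
proof -
  interpret subgroup "exact_relations H" "free_Abelian_group (fg_gmods H)" by (rule exact_relations_subgroup)
  show keys: "Poly_Mapping.keys x \<subseteq> fg_gmods H" if "x \<in> exact_relations H" for x
    using mem_carrier[OF that] by simp
  show "0 \<in> exact_relations H" using one_closed by simp
  show add: "x + y \<in> exact_relations H" if "x \<in> exact_relations H" "y \<in> exact_relations H" for x y
    using m_closed[OF that] by simp
  show inv: "- x \<in> exact_relations H" if "x \<in> exact_relations H" for x
    using m_inv_closed[OF that] keys[OF that] by simp
  show "x - y \<in> exact_relations H" if "x \<in> exact_relations H" "y \<in> exact_relations H" for x y
    using add[OF that(1) inv[OF that(2)]] by simp
qed

lemma exact_relations_incl:
  assumes "A \<in> fg_gmods H" "B \<in> fg_gmods H" "C \<in> fg_gmods H"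
    and "lmod_short_exact (group_algebra H) A f B g C"
  shows "frag_of B - frag_of A - frag_of C \<in> exact_relations H"
  unfolding exact_relations_def using assms by (intro generate.incl) blast

text \<open>Zero and differences yield sums and inverses, so an additive property has to be checked
  on the relations of exact sequences and in one closure step.\<close>

lemma exact_relations_induct [consumes 1, case_names zero exact diff]:
  assumes x: "x \<in> exact_relations H" and "P 0"
    and exact: "\<And>A B C f g. \<lbrakk>A \<in> fg_gmods H; B \<in> fg_gmods H; C \<in> fg_gmods H;
      lmod_short_exact (group_algebra H) A f B g C\<rbrakk> \<Longrightarrow> P (frag_of B - frag_of A - frag_of C)"
    and diff: "\<And>x y. P x \<Longrightarrow> P y \<Longrightarrow> P (x - y)"
  shows "P x"
proof -
  let ?S = "{frag_of B - frag_of A - frag_of C | A B C.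
        A \<in> fg_gmods H \<and> B \<in> fg_gmods H \<and> C \<in> fg_gmods H \<and>
        (\<exists>f g. lmod_short_exact (group_algebra H) A f B g C)}"
  have neg: "P (- x)" if "P x" for x
    using diff[OF \<open>P 0\<close> that] by simp
  have S: "P x" if "x \<in> ?S" for x
    using that exact by blast
  have keys: "Poly_Mapping.keys x \<subseteq> fg_gmods H" if "x \<in> ?S" for x
    using that exact_relations_incl exact_relations_closed(5) by blast
  from x have "x \<in> generate (free_Abelian_group (fg_gmods H)) ?S"
    unfolding exact_relations_def add_monoid_free_gmods .
  then show ?thesis
  proof induction
    case one
    then show ?case using \<open>P 0\<close> by simp
  next
    case (incl h)
    then show ?case by (rule S)
  next
    case (inv h)
    then show ?case using neg[OF S[OF inv]] keys[OF inv] by (simp only: inv_free_Abelian_group)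
  next
    case (eng h1 h2)
    then show ?case using diff[OF eng.IH(1) neg[OF eng.IH(2)]] by simp
  qed
qed

text \<open>Addition of formal sums is total, so this holds for every representative, without a
  condition on its support.\<close>

lemma mem_gclass_iff: "z \<in> gclass H x \<longleftrightarrow> z - x \<in> exact_relations H"
  by (auto simp: gclass_def a_r_coset_def r_coset_def intro!: bexI[of _ "z - x"])

lemma gclass_eq_iff: "gclass H x = gclass H y \<longleftrightarrow> x - y \<in> exact_relations H"
proof
  assume "gclass H x = gclass H y"
  moreover have "x \<in> gclass H x" by (simp add: mem_gclass_iff exact_relations_closed)
  ultimately show "x - y \<in> exact_relations H" by (simp add: mem_gclass_iff)
next
  assume xy: "x - y \<in> exact_relations H"
  have "z - x \<in> exact_relations H \<longleftrightarrow> z - y \<in> exact_relations H" for z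
    using exact_relations_closed(2)[OF xy, of "z - x"] exact_relations_closed(4)[OF _ xy, of "z - y"]
    by (auto simp: algebra_simps)
  then show "gclass H x = gclass H y" by (auto simp: mem_gclass_iff)
qed

text \<open>The sum of two classes is the setwise sum of cosets, for which closure of the relations
  under addition is enough. Products of classes are treated separately, over the trivial group, in
  \<open>groth_ring_mult\<close>.\<close>

lemma groth_ring_simps:
  "carrier (groth_ring H) = gclass H ` {x. Poly_Mapping.keys x \<subseteq> fg_gmods H}"
  "\<one>\<^bsub>groth_ring H\<^esub> = gclass H (frag_of (trivial_gmod H))"
  "gclass H x \<oplus>\<^bsub>groth_ring H\<^esub> gclass H y = gclass H (x + y)"
proof -
  show "carrier (groth_ring H) = gclass H ` {x. Poly_Mapping.keys x \<subseteq> fg_gmods H}"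
    by (auto simp: groth_ring_def FactRing_def A_RCOSETS_def RCOSETS_def gclass_def a_r_coset_def)
  show "\<one>\<^bsub>groth_ring H\<^esub> = gclass H (frag_of (trivial_gmod H))"
    by (simp add: groth_ring_def FactRing_def gclass_def free_gmods_def)
  show "gclass H x \<oplus>\<^bsub>groth_ring H\<^esub> gclass H y = gclass H (x + y)"
  proof (rule Set.set_eqI)
    fix z
    have "z \<in> gclass H x \<oplus>\<^bsub>groth_ring H\<^esub> gclass H y \<longleftrightarrow> (\<exists>a\<in>gclass H x. \<exists>b\<in>gclass H y. z = a + b)"
      by (simp add: groth_ring_def FactRing_def set_add_def set_mult_def)
    also have "\<dots> \<longleftrightarrow> z \<in> gclass H (x + y)"
    proof safe
      fix a b assume "a \<in> gclass H x" "b \<in> gclass H y"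
      then show "a + b \<in> gclass H (x + y)"
        using exact_relations_closed(2)[of "a - x" H "b - y"] by (simp add: mem_gclass_iff algebra_simps)
    next
      assume "z \<in> gclass H (x + y)"
      then show "\<exists>a\<in>gclass H x. \<exists>b\<in>gclass H y. z = a + b"
        by (intro bexI[of _ "z - y"] bexI[of _ y])
          (auto simp: mem_gclass_iff exact_relations_closed algebra_simps)
    qed
    finally show "z \<in> gclass H x \<oplus>\<^bsub>groth_ring H\<^esub> gclass H y \<longleftrightarrow> z \<in> gclass H (x + y)" .
  qed
qed

text \<open>\<open>groth_pullback\<close> is a union over all representatives. Since pulling back
  preserves exact sequences, it maps relations to relations, so the members of this union coincide
  and a single coset remains.\<close>

lemma (in finite_group_hom) groth_pullback_gclass:
  assumes x: "Poly_Mapping.keys x \<subseteq> fg_gmods G"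
  shows "groth_pullback H \<phi> (gclass G x) = gclass H (frag_extend (\<lambda>M. frag_of (pullback H \<phi> M)) x)"
proof -
  let ?p = "frag_extend (\<lambda>M. frag_of (pullback H \<phi> M))"
  have p: "?p z \<in> exact_relations H" if "z \<in> exact_relations G" for z
    using that
  proof (induction rule: exact_relations_induct)
    case (exact A B C f g)
    then show ?case
      using exact_relations_incl[OF _ _ _ lmod_short_exact_pullback[OF exact(4)]]
      by (simp add: frag_extend_diff pullback_fg_gmods)
  next
    case (diff x y)
    then show ?case using exact_relations_closed(4) by (simp only: frag_extend_diff)
  qed (simp add: exact_relations_closed(1))
  have "gclass H (?p z) = gclass H (?p x)" if "z \<in> gclass G x" for z
    using p[of "z - x"] that by (simp add: gclass_eq_iff mem_gclass_iff frag_extend_diff)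
  then have "(\<Union>z\<in>gclass G x. gclass H (?p z)) = (\<Union>z\<in>gclass G x. gclass H (?p x))" by (rule SUP_cong[OF refl])
  moreover have "x \<in> gclass G x" by (simp add: mem_gclass_iff exact_relations_closed)
  moreover have "groth_pullback H \<phi> (gclass G x) = (\<Union>z\<in>gclass G x. gclass H (?p z))"
    by (simp only: groth_pullback_def gclass_def)
  ultimately show ?thesis by (metis UN_constant empty_iff)
qed

context finite_group
begin

text \<open>The zero module forms an exact sequence with itself in all three places; its relation is
  [Z] - [Z] - [Z] = -[Z].\<close>

lemma frag_of_zero_gmod: "frag_of (perm_gmod G 0 (\<lambda>_ i. i)) \<in> exact_relations G"
proof -
  let ?Z = "perm_gmod G 0 (\<lambda>_ i. i) :: ('g, 'a) gmod"
  have Z: "?Z \<in> fg_gmods G" by (intro perm_gmod_fg_gmods perm_action_trivial)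
  have "lmod_short_exact (group_algebra G) ?Z (\<lambda>x. x) ?Z (\<lambda>x. x) ?Z"
    by (auto simp: lmod_short_exact_def a_kernel_def' intro!: lmod_homI)
  from exact_relations_closed(3)[OF exact_relations_incl[OF Z Z Z this]]
  show ?thesis by simp
qed

text \<open>An isomorphism is a short exact sequence with third term zero. Its relation carries an
  extra class of the zero module, which is removed by \<open>frag_of_zero_gmod\<close>.\<close>

lemma frag_of_iso:
  assumes "A \<in> fg_gmods G" "B \<in> fg_gmods G" "f \<in> lmod_hom (group_algebra G) A B"
    "bij_betw f (carrier A) (carrier B)"
  shows "frag_of B - frag_of A \<in> exact_relations G"
proof -
  let ?Z = "perm_gmod G 0 (\<lambda>_ i. i) :: ('g, 'a) gmod"
  have Z: "?Z \<in> fg_gmods G" by (intro perm_gmod_fg_gmods perm_action_trivial)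
  have "\<zero>\<^bsub>B\<^esub> \<in> carrier B"
    using fg_gmodsD(2)[OF assms(2)] by (rule abelian_groupE)
  then have "lmod_short_exact (group_algebra G) A f B (\<lambda>_ _. 0) ?Z"
    using assms by (auto simp: lmod_short_exact_def bij_betw_def a_kernel_def' image_constant_conv intro!: lmod_homI)
  from exact_relations_closed(2)[OF exact_relations_incl[OF assms(1,2) Z this] frag_of_zero_gmod]
  show ?thesis by simp
qed

end

section \<open>Coordinate spaces\<close>

text \<open>Sets independent in \<open>W\<close> are independent in \<open>V\<close>, so their size
  is bounded by \<open>dim\<close>. Hence a maximal one exists and is finite, and it is a basis of
  \<open>W\<close>.\<close>

lemma (in vectorspace) subspace_fin_dim:
  assumes "fin_dim" "VectorSpace.subspace K W V"
  shows "vectorspace.fin_dim K (vs W)"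
proof -
  interpret W: vectorspace K "vs W" by (rule subspace_is_vs[OF assms(2)])
  have sub: "LinearCombinations.submodule K W V" "W \<subseteq> carrier V"
    using assms(2) by (auto simp: subspace_def LinearCombinations.submodule_def)
  have "\<exists>A. finite A \<and> maximal A (\<lambda>S. S \<subseteq> W \<and> W.lin_indpt S)"
  proof (rule maximal_exists[where N = dim])
    show "finite A \<and> card A \<le> dim" if "A \<subseteq> W \<and> W.lin_indpt A" for A
      using that li_le_dim[OF assms(1), of A] span_li_not_depend(2)[of A W] sub by blast
    show "{} \<subseteq> W \<and> W.lin_indpt {}" by (auto simp: W.lin_dep_def)
  qed
  then obtain A where A: "finite A" "maximal A (\<lambda>S. S \<subseteq> carrier (vs W) \<and> W.lin_indpt S)" by auto
  from W.max_li_is_basis[OF A(2)] have "W.basis A" .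
  with A(1) show ?thesis unfolding W.fin_dim_def W.basis_def by blast
qed

text \<open>A basis of \<open>W\<close> is independent in \<open>V\<close> and has the right number
  of elements to be a basis of \<open>V\<close>. This later turns an equality of dimensions into the
  statement that every vector is fixed.\<close>

lemma (in vectorspace) subspace_dim_eq:
  assumes "fin_dim" "VectorSpace.subspace K W V" "vectorspace.dim K (vs W) = dim"
  shows "W = carrier V"
proof -
  interpret W: vectorspace K "vs W" by (rule subspace_is_vs[OF assms(2)])
  have sub: "LinearCombinations.submodule K W V" "W \<subseteq> carrier V"
    using assms(2) by (auto simp: subspace_def LinearCombinations.submodule_def)
  obtain B where B: "finite B" "W.basis B"
    using W.finite_basis_exists[OF subspace_fin_dim[OF assms(1,2)]] by blast
  then have BW: "B \<subseteq> W" "W.lin_indpt B" "W.span B = W" by (auto simp: W.basis_def)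
  have "basis B"
    using B BW sub span_li_not_depend(2)[of B W] assms(3) W.dim_basis[of B]
    by (intro dim_li_is_basis assms(1)) auto
  then have "span B = carrier V" by (simp add: basis_def)
  with BW span_li_not_depend(1)[of B W] sub show ?thesis by simp
qed

lemma linear_mapI:
  assumes "vectorspace K V" "vectorspace K W" "f \<in> lmod_hom K V W"
  shows "linear_map K V W f"
proof -
  interpret V: vectorspace K V by fact
  interpret W: vectorspace K W by fact
  show ?thesis
    using lmod_homD[OF assms(3)]
    by unfold_locales (auto simp: module_hom_def)
qed

text \<open>K^n, placed in the carrier type shared by all modules, so that it can itself serve as a
  module there, notably as a tensor product.\<close>

definition coord_space :: "nat \<Rightarrow> ('k::field, nat \<Rightarrow> 'k) module" where
  "coord_space n =
    \<lparr>carrier = {v. \<forall>i\<ge>n. v i = 0}, mult = undefined, one = undefined,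
     zero = (\<lambda>_. 0), add = (\<lambda>v w i. v i + w i), smult = (\<lambda>c v i. c * v i)\<rparr>"

definition unit_coord :: "nat \<Rightarrow> nat \<Rightarrow> 'k::field" where
  "unit_coord i = (\<lambda>j. if j = i then 1 else 0)"

lemma coord_space_simps [simp]:
  "carrier (coord_space n) = {v. \<forall>i\<ge>n. v i = 0}"
  "\<zero>\<^bsub>coord_space n\<^esub> = (\<lambda>_. 0)"
  "v \<oplus>\<^bsub>coord_space n\<^esub> w = (\<lambda>i. v i + w i)"
  "c \<odot>\<^bsub>coord_space n\<^esub> v = (\<lambda>i. c * v i)"
  by (simp_all add: coord_space_def)

lemma unit_coord_closed [simp]: "k < n \<Longrightarrow> unit_coord k \<in> carrier (coord_space n)"
  by (auto simp: unit_coord_def)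

lemma vectorspace_coord_space: "vectorspace class_ring (coord_space n :: ('k::field, nat \<Rightarrow> 'k) module)"
proof -
  let ?V = "coord_space n :: ('k, nat \<Rightarrow> 'k) module"
  have "left_module class_ring ?V"
  proof (rule left_moduleI)
    show "ring (class_ring :: 'k ring)" by (rule field.is_ring[OF class_field])
    show "abelian_group ?V"
    proof (rule abelian_groupI)
      fix x assume "x \<in> carrier ?V"
      then show "\<exists>y\<in>carrier ?V. y \<oplus>\<^bsub>?V\<^esub> x = \<zero>\<^bsub>?V\<^esub>"
        by (intro bexI[of _ "\<lambda>i. - x i"]) auto
    qed (auto simp: ac_simps)
  qed (auto simp: algebra_simps)
  then show ?thesis by (simp add: left_module_class_ring_iff)
qed

lemma coord_space_hom_eq:
  assumes f: "f \<in> lmod_hom class_ring (coord_space n) V" and g: "g \<in> lmod_hom class_ring (coord_space n) V"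
    and V: "abelian_group V" and eq: "\<And>k. k < n \<Longrightarrow> f (unit_coord k) = g (unit_coord k)"
    and v: "v \<in> carrier (coord_space n)"
  shows "f v = g v"
proof -
  have "v \<in> {v \<in> carrier (coord_space n). f v = g v}"
  proof (rule coordinate_induct[where n = n])
    have "abelian_group (coord_space n :: ('a, nat \<Rightarrow> 'a) module)"
      using vectorspace_coord_space by (auto simp: vectorspace_def module_def)
    then show "(\<lambda>_. 0) \<in> {v \<in> carrier (coord_space n). f v = g v}"
      using lmod_hom_zero[OF f _ V] lmod_hom_zero[OF g _ V] by simp
  next
    fix v w assume "v \<in> {v \<in> carrier (coord_space n). f v = g v}" "w \<in> {v \<in> carrier (coord_space n). f v = g v}"
    then show "(\<lambda>i. v i + w i) \<in> {v \<in> carrier (coord_space n). f v = g v}"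
      using lmod_homD(2)[OF f, of v w] lmod_homD(2)[OF g, of v w] by simp
  next
    fix k and c :: 'a assume k: "k < n"
    have "(\<lambda>i. if i = k then c else 0) = c \<odot>\<^bsub>coord_space n\<^esub> unit_coord k"
      by (auto simp: unit_coord_def)
    moreover have "f (c \<odot>\<^bsub>coord_space n\<^esub> unit_coord k) = g (c \<odot>\<^bsub>coord_space n\<^esub> unit_coord k)"
      using lmod_homD(3)[OF f _ unit_coord_closed[OF k], of c] lmod_homD(3)[OF g _ unit_coord_closed[OF k], of c]
        eq[OF k] by (simp del: coord_space_simps)
    ultimately have "f (\<lambda>i. if i = k then c else 0) = g (\<lambda>i. if i = k then c else 0)"
      by (simp only:)
    then show "(\<lambda>i. if i = k then c else 0) \<in> {v \<in> carrier (coord_space n). f v = g v}"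
      using k by simp
  qed (use v in simp)
  then show ?thesis by simp
qed

lemma coord_space_hom_exists:
  assumes "vectorspace class_ring (V :: ('k::field, 'v) module)" and b: "\<And>i. i < n \<Longrightarrow> b i \<in> carrier V"
  defines "f \<equiv> \<lambda>v. \<Oplus>\<^bsub>V\<^esub>i\<in>{..<n}. v i \<odot>\<^bsub>V\<^esub> b i"
  shows "f \<in> lmod_hom class_ring (coord_space n) V" and "\<And>k. k < n \<Longrightarrow> f (unit_coord k) = b k"
proof -
  interpret V: vectorspace class_ring V by fact
  have cl: "c \<odot>\<^bsub>V\<^esub> b i \<in> carrier V" if "i < n" for c i using b[OF that] by simp
  show "f \<in> lmod_hom class_ring (coord_space n) V"
  proof (rule lmod_homI)
    show "f x \<in> carrier V" for x
      unfolding f_def using cl by (intro V.finsum_closed) auto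
  next
    fix x y
    have "f (\<lambda>i. x i + y i) = (\<Oplus>\<^bsub>V\<^esub>i\<in>{..<n}. x i \<odot>\<^bsub>V\<^esub> b i \<oplus>\<^bsub>V\<^esub> y i \<odot>\<^bsub>V\<^esub> b i)"
      unfolding f_def using cl b V.smult_l_distr by (intro V.finsum_cong') auto
    also have "\<dots> = f x \<oplus>\<^bsub>V\<^esub> f y"
      unfolding f_def using cl by (intro V.finsum_addf) auto
    finally show "f (x \<oplus>\<^bsub>coord_space n\<^esub> y) = f x \<oplus>\<^bsub>V\<^esub> f y" by simp
  next
    fix a :: 'k and x
    have "f (\<lambda>i. a * x i) = (\<Oplus>\<^bsub>V\<^esub>i\<in>{..<n}. a \<odot>\<^bsub>V\<^esub> (x i \<odot>\<^bsub>V\<^esub> b i))"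
      unfolding f_def using cl b V.smult_assoc1 by (intro V.finsum_cong') auto
    also have "\<dots> = a \<odot>\<^bsub>V\<^esub> f x"
      unfolding f_def using cl by (intro V.finsum_smult_ldistr[symmetric]) auto
    finally show "f (a \<odot>\<^bsub>coord_space n\<^esub> x) = a \<odot>\<^bsub>V\<^esub> f x" by simp
  qed
  fix k assume k: "k < n"
  have "f (unit_coord k) = (\<Oplus>\<^bsub>V\<^esub>i\<in>{..<n}. if k = i then b i else \<zero>\<^bsub>V\<^esub>)"
    unfolding f_def using b V.smult_one V.smult_l_null
    by (intro V.finsum_cong') (auto simp: unit_coord_def)
  also have "\<dots> = b k" using k b by (intro V.finsum_singleton) auto
  finally show "f (unit_coord k) = b k" .
qed

lemma unit_coord_eq_iff [simp]: "(unit_coord i :: nat \<Rightarrow> 'k::field) = unit_coord j \<longleftrightarrow> i = j"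
  by (metis unit_coord_def zero_neq_one)

lemma (in vectorspace) lincomb_reindex:
  assumes "inj_on b {..<n}" "\<And>i. i < n \<Longrightarrow> b i \<in> carrier V" "\<And>i. i < n \<Longrightarrow> a (b i) \<in> carrier K"
  shows "lincomb a (b ` {..<n}) = (\<Oplus>\<^bsub>V\<^esub>i\<in>{..<n::nat}. a (b i) \<odot>\<^bsub>V\<^esub> b i)"
  unfolding lincomb_def using assms by (intro finsum_reindex) auto

lemma
  shows fin_dim_coord_space: "vectorspace.fin_dim class_ring (coord_space n :: ('k::field, nat \<Rightarrow> 'k) module)"
    and dim_coord_space: "vectorspace.dim class_ring (coord_space n :: ('k::field, nat \<Rightarrow> 'k) module) = n"
proof -
  let ?V = "coord_space n :: ('k, nat \<Rightarrow> 'k) module"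
  interpret V: vectorspace class_ring ?V by (rule vectorspace_coord_space)
  let ?E = "unit_coord ` {..<n} :: (nat \<Rightarrow> 'k) set"
  have inj: "inj_on (unit_coord :: nat \<Rightarrow> nat \<Rightarrow> 'k) {..<n}" by (auto simp: inj_on_def)
  have inv: "inv_into {..<n} unit_coord (unit_coord i :: nat \<Rightarrow> 'k) = i" if "i < n" for i
    using inv_into_f_f[OF inj, of i] that by simp
  have id: "(\<lambda>x. x) \<in> lmod_hom class_ring ?V ?V" by (rule lmod_homI) auto
  have comb: "V.lincomb a ?E = (\<lambda>i. if i < n then a (unit_coord i) else 0)" for a
  proof -
    let ?v = "\<lambda>i. if i < n then a (unit_coord i) else 0"
    have "V.lincomb a ?E = (\<Oplus>\<^bsub>?V\<^esub>i\<in>{..<n}. ?v i \<odot>\<^bsub>?V\<^esub> unit_coord i)"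
      using inj by (subst V.lincomb_reindex) (auto simp: unit_coord_def intro!: V.finsum_cong')
    \<comment> \<open>The sum is the value at \<open>?v\<close> of the linear map that sends each
      unit vector to itself, and the identity is the only such map.\<close>
    also have "\<dots> = ?v"
      by (rule coord_space_hom_eq[OF coord_space_hom_exists(1)[OF V.vectorspace_axioms] id V.abelian_group_axioms])
        (use coord_space_hom_exists(2)[OF V.vectorspace_axioms, of n unit_coord] unit_coord_closed in auto)
    finally show ?thesis .
  qed
  have "V.basis ?E"
  proof (subst V.basis_criterion; (intro allI impI)?)
    fix v assume v: "v \<in> carrier ?V"
    show "\<exists>!a. a \<in> ?E \<rightarrow>\<^sub>E carrier class_ring \<and> V.lincomb a ?E = v"
    proof (intro ex1I conjI)
      let ?a = "\<lambda>x\<in>?E. v (inv_into {..<n} unit_coord x)"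
      show "?a \<in> ?E \<rightarrow>\<^sub>E carrier class_ring" by auto
      show "V.lincomb ?a ?E = v"
        using v inv by (intro ext) (simp add: comb)
      fix a assume a: "a \<in> ?E \<rightarrow>\<^sub>E carrier class_ring \<and> V.lincomb a ?E = v"
      then have "a (unit_coord i) = v i" if "i < n" for i
        using fun_cong[OF comb[of a], of i] a that by simp
      then show "a = ?a"
        using a inv by (intro PiE_ext[of a ?E _ ?a]) auto
    qed
  qed (auto simp: unit_coord_def)
  then show "V.fin_dim" "V.dim = n"
    using V.dim_basis[of ?E] inj by (auto simp: V.fin_dim_def V.basis_def card_image)
qed

lemma coord_space_iso:
  assumes "vectorspace class_ring (V :: ('k::field, 'v) module)" "vectorspace.fin_dim class_ring V"
  obtains f where "f \<in> lmod_hom class_ring (coord_space (vectorspace.dim class_ring V)) V"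
    "bij_betw f (carrier (coord_space (vectorspace.dim class_ring V) :: ('k, nat \<Rightarrow> 'k) module)) (carrier V)"
proof -
  interpret V: vectorspace class_ring V by fact
  obtain B where B: "finite B" "V.basis B" using V.finite_basis_exists[OF assms(2)] by blast
  define n where "n = V.dim"
  have "card B = n" using V.dim_basis[OF B] by (simp add: n_def)
  then obtain b where b: "bij_betw b {..<n} B" using B(1) by (metis bij_betw_from_nat_into_finite)
  have bc: "b i \<in> carrier V" if "i < n" for i
    using b B(2) that by (auto simp: bij_betw_def V.basis_def)
  have inj: "inj_on b {..<n}" and img: "b ` {..<n} = B" using b by (auto simp: bij_betw_def)
  let ?f = "\<lambda>v. \<Oplus>\<^bsub>V\<^esub>i\<in>{..<n}. v i \<odot>\<^bsub>V\<^esub> b i"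
  have f: "?f \<in> lmod_hom class_ring (coord_space n) V"
    using coord_space_hom_exists(1)[OF assms(1)] bc by blast
  have comb: "V.lincomb a B = ?f (\<lambda>i. if i < n then a (b i) else 0)" for a
    using V.lincomb_reindex[OF inj bc] bc by (auto simp: img intro!: V.finsum_cong')
  have B': "B \<subseteq> carrier V" using B(2) by (simp add: V.basis_def)
  note crit = V.basis_criterion[OF B(1) B', THEN iffD1, OF B(2), rule_format]
  \<comment> \<open>\<open>basis_criterion\<close> gives uniqueness among coefficient functions that
    are undefined off \<open>B\<close>; hence the restriction to \<open>B\<close>.\<close>
  let ?c = "\<lambda>v. \<lambda>x\<in>B. v (inv_into {..<n} b x)"
  have fc: "V.lincomb (?c v) B = ?f v" for v
    unfolding comb using bc inj img by (intro V.finsum_cong') auto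
  have "inj_on ?f (carrier (coord_space n))"
  proof (rule inj_onI)
    fix v w assume v: "v \<in> carrier (coord_space n)" and w: "w \<in> carrier (coord_space n)" and eq: "?f v = ?f w"
    have "?f w \<in> carrier V" using lmod_homD(1)[OF f w] .
    from crit[OF this] obtain a where a: "\<And>a'. a' \<in> B \<rightarrow>\<^sub>E carrier class_ring \<and> V.lincomb a' B = ?f w \<Longrightarrow> a' = a"
      by (elim ex1E) blast
    have "?c v = a" using fc[of v] eq by (intro a) simp
    moreover have "?c w = a" using fc[of w] by (intro a) simp
    ultimately have c: "?c v (b i) = ?c w (b i)" for i by simp
    have "v i = w i" if "i < n" for i
      using c[of i] that img inv_into_f_f[OF inj, of i] by auto
    moreover have "v i = w i" if "\<not> i < n" for i
      using v w that by simp
    ultimately show "v = w" by blast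
  qed
  moreover have "?f ` carrier (coord_space n) = carrier V"
  proof
    show "?f ` carrier (coord_space n) \<subseteq> carrier V" by (intro image_subsetI lmod_homD(1)[OF f])
    show "carrier V \<subseteq> ?f ` carrier (coord_space n)"
    proof
      fix x assume "x \<in> carrier V"
      from crit[OF this] obtain a where "V.lincomb a B = x" by (elim ex1E) blast
      then have "x = ?f (\<lambda>i. if i < n then a (b i) else 0)" unfolding comb ..
      then show "x \<in> ?f ` carrier (coord_space n)" 
        by (rule image_eqI[where x = "\<lambda>i. if i < n then a (b i) else 0"]) simp
    qed
  qed
  ultimately have "bij_betw ?f (carrier (coord_space n)) (carrier V)" by (simp add: bij_betw_def)
  with f that show thesis unfolding n_def by blast
qed

section \<open>Dimensions of fixed spaces\<close>

definition fixed_points :: "('g, 'b) monoid_scheme \<Rightarrow> 'g set \<Rightarrow> ('g, 'k::field) gmod \<Rightarrow> (nat \<Rightarrow> 'k) set" where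
  "fixed_points H S M = {x \<in> carrier M. \<forall>s\<in>S. ga_single s 1 \<odot>\<^bsub>M\<^esub> x = x}"

definition fixed_space ::
  "('g, 'b) monoid_scheme \<Rightarrow> 'g set \<Rightarrow> ('g, 'k::field) gmod \<Rightarrow> ('k, nat \<Rightarrow> 'k) module" where
  "fixed_space H S M = (restrict_scalars H M)\<lparr>carrier := fixed_points H S M\<rparr>"

definition fixed_dim :: "('g, 'b) monoid_scheme \<Rightarrow> 'g set \<Rightarrow> ('g, 'k::field) gmod \<Rightarrow> nat" where
  "fixed_dim H S M = vectorspace.dim class_ring (fixed_space H S M)"

context finite_group
begin

lemma fixed_space_simps [simp]:
  "carrier (fixed_space G S M) = fixed_points G S M"
  "x \<oplus>\<^bsub>fixed_space G S M\<^esub> y = x \<oplus>\<^bsub>M\<^esub> y"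
  "\<zero>\<^bsub>fixed_space G S M\<^esub> = \<zero>\<^bsub>M\<^esub>"
  "c \<odot>\<^bsub>fixed_space G S M\<^esub> x = ga_single \<one> c \<odot>\<^bsub>M\<^esub> x"
  by (simp_all add: fixed_space_def)

lemma subspace_fixed_points:
  assumes "left_module (group_algebra G) (M :: ('g, 'k::field) gmod)" "S \<subseteq> carrier G"
  shows "VectorSpace.subspace class_ring (fixed_points G S M) (restrict_scalars G M)"
proof -
  interpret left_module "group_algebra G" M by fact
  have V: "vectorspace class_ring (restrict_scalars G M)" by (rule vectorspace_restrict_scalars[OF assms(1)])
  have S: "ga_single s c \<in> carrier (group_algebra G :: ('g \<Rightarrow> 'k) ring)" if "s \<in> S" for s c
    using that assms(2) by (intro ga_single_closed) auto
  have "LinearCombinations.submodule class_ring (fixed_points G S M) (restrict_scalars G M)"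
  proof (rule LinearCombinations.submodule.intro)
    show "Module.module class_ring (restrict_scalars G M)" using V by (simp add: vectorspace_def)
    show "c \<odot>\<^bsub>restrict_scalars G M\<^esub> v \<in> fixed_points G S M" if "v \<in> fixed_points G S M" for c v
      using that assms(2) smult_closed[OF ga_single_one_closed, of v c]
      by (auto simp: fixed_points_def ga_single_smult_commute[OF assms(1)])
  qed (use smult_r_distr[OF S] smult_zero_right[OF S] in \<open>auto simp: fixed_points_def\<close>)
  with V show ?thesis by (simp add: subspace_def)
qed

lemma
  assumes "M \<in> fg_gmods G" "S \<subseteq> carrier G"
  shows vectorspace_fixed_space: "vectorspace class_ring (fixed_space G S M)"
    and fin_dim_fixed_space: "vectorspace.fin_dim class_ring (fixed_space G S M)"
proof -
  interpret V: vectorspace class_ring "restrict_scalars G M"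
    by (intro vectorspace_restrict_scalars fg_gmodsD assms)
  have sub: "VectorSpace.subspace class_ring (fixed_points G S M) (restrict_scalars G M)"
    by (intro subspace_fixed_points fg_gmodsD assms)
  show "vectorspace class_ring (fixed_space G S M)"
    using V.subspace_is_vs[OF sub] by (simp add: fixed_space_def)
  show "vectorspace.fin_dim class_ring (fixed_space G S M)"
    using V.subspace_fin_dim[OF fin_dim_restrict_scalars[OF assms(1)] sub] by (simp add: fixed_space_def)
qed

lemma fixed_points_hom:
  assumes "f \<in> lmod_hom (group_algebra G) A B" "S \<subseteq> carrier G" "x \<in> fixed_points G S A"
  shows "f x \<in> fixed_points G S B"
proof -
  have "ga_single s 1 \<odot>\<^bsub>B\<^esub> f x = f x" if "s \<in> S" for s
    using lmod_homD(3)[OF assms(1) ga_single_closed[of s 1], of x] that assms(2,3)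
    by (auto simp: fixed_points_def)
  then show ?thesis using lmod_homD(1)[OF assms(1)] assms(3) by (auto simp: fixed_points_def)
qed

lemma fixed_space_hom:
  assumes "f \<in> lmod_hom (group_algebra G) A B" "S \<subseteq> carrier G"
  shows "f \<in> lmod_hom class_ring (fixed_space G S A) (fixed_space G S B)"
  using fixed_points_hom[OF assms] lmod_homD[OF assms(1)] lmod_homD(3)[OF assms(1) ga_single_one_closed]
  by (intro lmod_homI) (auto simp: fixed_points_def)

text \<open>The idempotent (1/|S|) times the sum of S, which projects a module onto its S-fixed
  vectors. Characteristic zero makes |S| invertible.\<close>

definition averaging :: "'g set \<Rightarrow> 'g \<Rightarrow> 'k::field_char_0" where
  "averaging S = (\<lambda>g. if g \<in> S then 1 / of_nat (card S) else 0)"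

lemma averaging_closed: "S \<subseteq> carrier G \<Longrightarrow> averaging S \<in> carrier (group_algebra G)"
  by (auto simp: averaging_def)

text \<open>Left translation by \<open>s\<close> permutes \<open>S\<close>, and all coefficients on
  \<open>S\<close> are equal.\<close>

lemma ga_single_averaging:
  assumes S: "subgroup S G" and s: "s \<in> S"
  shows "ga_single s 1 \<otimes>\<^bsub>group_algebra G\<^esub> averaging S = (averaging S :: 'g \<Rightarrow> 'k::field_char_0)"
proof
  fix g
  interpret S: subgroup S G by fact
  show "(ga_single s 1 \<otimes>\<^bsub>group_algebra G\<^esub> averaging S) g = (averaging S g :: 'k)"
  proof (cases "g \<in> carrier G")
    case True
    have sG: "s \<in> carrier G" using s by auto
    have eq: "s \<otimes> k = g \<longleftrightarrow> k = inv s \<otimes> g" if "k \<in> carrier G" for k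
      using True sG that by (metis inv_closed inv_solve_left m_assoc r_inv l_one)
    have "(ga_single s 1 \<otimes>\<^bsub>group_algebra G\<^esub> averaging S) g =
        (\<Sum>h\<in>carrier G. ga_single s 1 h * (\<Sum>k\<in>carrier G. averaging S k * (if h \<otimes> k = g then 1 else 0)))"
      using True by (simp add: ga_mult_apply sum_distrib_left mult.assoc)
    also have "\<dots> = (\<Sum>k\<in>carrier G. averaging S k * (if s \<otimes> k = g then 1 else 0))"
      using sG by simp
    also have "\<dots> = (\<Sum>k\<in>carrier G. if k = inv s \<otimes> g then averaging S k else 0)"
      by (intro sum.cong refl) (simp add: eq)
    also have "\<dots> = averaging S (inv s \<otimes> g)"
      using True sG by simp
    also have "\<dots> = averaging S g"
    proof -
      have "inv s \<otimes> g \<in> S \<longleftrightarrow> g \<in> S"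
      proof
        assume "inv s \<otimes> g \<in> S"
        with s have "s \<otimes> (inv s \<otimes> g) \<in> S" by (rule S.m_closed)
        then show "g \<in> S" using True sG by (simp add: m_assoc[symmetric])
      qed (use s in simp)
      then show ?thesis by (simp add: averaging_def)
    qed
    finally show ?thesis .
  next
    case False
    then show ?thesis by (auto simp: ga_mult_outside averaging_def)
  qed
qed

text \<open>On fixed vectors K[S] acts through the augmentation, the sum of the coefficients. For
  \<open>averaging S\<close> that sum is 1, which is how fixed vectors turn out to be left alone by
  the projection.\<close>

lemma smult_fixed_point:
  assumes "left_module (group_algebra G) (M :: ('g, 'k::field) gmod)"
    and S: "S \<subseteq> carrier G" and a: "\<And>g. g \<notin> S \<Longrightarrow> a g = 0" and x: "x \<in> fixed_points G S M"
  shows "a \<odot>\<^bsub>M\<^esub> x = ga_single \<one> (\<Sum>g\<in>S. a g) \<odot>\<^bsub>M\<^esub> x"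
proof -
  interpret left_module "group_algebra G" M by fact
  have fin: "finite S" by (rule finite_subset[OF S finite_carrier])
  have xM: "x \<in> carrier M" using x by (simp add: fixed_points_def)
  show ?thesis
  proof (rule ga_support_induct[where S = S and a = a and P = "\<lambda>a. a \<odot>\<^bsub>M\<^esub> x = ga_single \<one> (\<Sum>g\<in>S. a g) \<odot>\<^bsub>M\<^esub> x"])
    fix h c b
    assume h: "h \<in> S" "\<And>g. g \<notin> S \<Longrightarrow> b g = 0" and IH: "b \<odot>\<^bsub>M\<^esub> x = ga_single \<one> (\<Sum>g\<in>S. b g) \<odot>\<^bsub>M\<^esub> x"
    have hG: "h \<in> carrier G" using h S by auto
    have b: "b \<in> carrier (group_algebra G)" using h S by auto
    have "(\<lambda>g. ga_single h c g + b g) \<odot>\<^bsub>M\<^esub> x = ga_single h c \<odot>\<^bsub>M\<^esub> x \<oplus>\<^bsub>M\<^esub> b \<odot>\<^bsub>M\<^esub> x"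
      using smult_l_distr[OF ga_single_closed[OF hG] b xM] by simp
    also have "ga_single h c \<odot>\<^bsub>M\<^esub> x = ga_single \<one> c \<odot>\<^bsub>M\<^esub> x"
      using ga_single_smult[OF assms(1) hG xM, of c] h(1) x by (simp add: fixed_points_def)
    also have "ga_single \<one> c \<odot>\<^bsub>M\<^esub> x \<oplus>\<^bsub>M\<^esub> b \<odot>\<^bsub>M\<^esub> x = ga_single \<one> (c + (\<Sum>g\<in>S. b g)) \<odot>\<^bsub>M\<^esub> x"
      using smult_l_distr[OF ga_single_one_closed ga_single_one_closed xM, of c "\<Sum>g\<in>S. b g"] IH
      by (simp add: ga_single_add)
    also have "c + (\<Sum>g\<in>S. b g) = (\<Sum>g\<in>S. ga_single h c g + b g)"
      using fin h(1) by (simp add: sum.distrib)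
    finally show "(\<lambda>g. ga_single h c g + b g) \<odot>\<^bsub>M\<^esub> x = ga_single \<one> (\<Sum>g\<in>S. ga_single h c g + b g) \<odot>\<^bsub>M\<^esub> x" .
  qed (use fin a in auto)
qed

lemma
  assumes M: "left_module (group_algebra G) (M :: ('g, 'k::field_char_0) gmod)" and S: "subgroup S G"
  shows averaging_fixes: "x \<in> carrier M \<Longrightarrow> averaging S \<odot>\<^bsub>M\<^esub> x \<in> fixed_points G S M"
    and averaging_fixed_point: "x \<in> fixed_points G S M \<Longrightarrow> averaging S \<odot>\<^bsub>M\<^esub> x = x"
proof -
  interpret left_module "group_algebra G" M by fact
  have sub: "S \<subseteq> carrier G" using S by (rule subgroup.subset)
  note e = averaging_closed[OF sub]
  show "averaging S \<odot>\<^bsub>M\<^esub> x \<in> fixed_points G S M" if x: "x \<in> carrier M"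
    unfolding fixed_points_def
  proof (intro CollectI conjI ballI)
    fix s assume s: "s \<in> S"
    then have "s \<in> carrier G" using sub by auto
    from smult_assoc[OF ga_single_closed[OF this] e x, of 1]
    show "ga_single s 1 \<odot>\<^bsub>M\<^esub> (averaging S \<odot>\<^bsub>M\<^esub> x) = averaging S \<odot>\<^bsub>M\<^esub> x"
      by (simp add: ga_single_averaging[OF S s])
  qed (rule smult_closed[OF e x])
  have fin: "finite S" "S \<noteq> {}"
    using finite_subset[OF sub finite_carrier] subgroup.one_closed[OF S] by auto
  show "averaging S \<odot>\<^bsub>M\<^esub> x = x" if x: "x \<in> fixed_points G S M"
  proof -
    have "averaging S \<odot>\<^bsub>M\<^esub> x = ga_single \<one> (\<Sum>g\<in>S. averaging S g) \<odot>\<^bsub>M\<^esub> x"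
      by (rule smult_fixed_point[OF M sub _ x]) (simp add: averaging_def)
    also have "(\<Sum>g\<in>S. averaging S g) = (1::'k)" using fin by (simp add: averaging_def)
    finally show ?thesis using x smult_one by (simp add: fixed_points_def)
  qed
qed

text \<open>Fixed vectors are left exact over any field: the kernel of \<open>g\<close> on fixed
  vectors is the image of the fixed vectors of \<open>A\<close>. Averaging supplies surjectivity,
  and this is where the characteristic enters. The dimension formula is then rank-nullity for
  \<open>g\<close>.\<close>

lemma fixed_dim_exact:
  fixes A B C :: "('g, 'k::field_char_0) gmod"
  assumes A: "A \<in> fg_gmods G" and B: "B \<in> fg_gmods G" and C: "C \<in> fg_gmods G"
    and ex: "lmod_short_exact (group_algebra G) A f B g C" and S: "subgroup S G"
  shows "fixed_dim G S B = fixed_dim G S A + fixed_dim G S C"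
proof -
  have sub: "S \<subseteq> carrier G" using S by (rule subgroup.subset)
  have f: "f \<in> lmod_hom (group_algebra G) A B" "inj_on f (carrier A)"
    and g: "g \<in> lmod_hom (group_algebra G) B C" "g ` carrier B = carrier C"
    and fg: "f ` carrier A = {x \<in> carrier B. g x = \<zero>\<^bsub>C\<^esub>}"
    using ex by (auto simp: lmod_short_exact_def a_kernel_def')
  let ?A = "fixed_space G S A" and ?B = "fixed_space G S B" and ?C = "fixed_space G S C"
  interpret g: linear_map class_ring ?B ?C g
    by (intro linear_mapI vectorspace_fixed_space fixed_space_hom A B C g sub)
  have surj: "g ` carrier ?B = carrier ?C"
  proof
    show "g ` carrier ?B \<subseteq> carrier ?C" using fixed_points_hom[OF g(1) sub] by auto
    show "carrier ?C \<subseteq> g ` carrier ?B"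
    proof
      fix c assume "c \<in> carrier ?C"
      then have c: "c \<in> fixed_points G S C" by simp
      then have "c \<in> g ` carrier B" using g(2) by (simp add: fixed_points_def)
      then obtain b where b: "b \<in> carrier B" "g b = c" by blast
      \<comment> \<open>An arbitrary preimage of the fixed vector \<open>c\<close> becomes a fixed
        preimage by averaging: \<open>g\<close> commutes with the averaging element, which does not
        move \<open>c\<close>.\<close>
      have "g (averaging S \<odot>\<^bsub>B\<^esub> b) = c"
        using lmod_homD(3)[OF g(1) averaging_closed[OF sub] b(1)] b(2)
          averaging_fixed_point[OF fg_gmodsD(1)[OF C] S c] by simp
      moreover have "averaging S \<odot>\<^bsub>B\<^esub> b \<in> carrier ?B"
        using averaging_fixes[OF fg_gmodsD(1)[OF B] S b(1)] by simp
      ultimately show "c \<in> g ` carrier ?B" by blast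
    qed
  qed
  have kerV: "vectorspace class_ring (g.V.vs g.kerT)"
    by (rule g.V.subspace_is_vs[OF g.kerT_is_subspace])
  have fker: "f ` fixed_points G S A = g.kerT"
  proof
    show "f ` fixed_points G S A \<subseteq> g.kerT"
      using fixed_points_hom[OF f(1) sub] fg by (auto simp: g.ker_def fixed_points_def)
    show "g.kerT \<subseteq> f ` fixed_points G S A"
    proof
      fix b assume "b \<in> g.kerT"
      then have b: "b \<in> fixed_points G S B" "g b = \<zero>\<^bsub>C\<^esub>" by (auto simp: g.ker_def)
      then have "b \<in> f ` carrier A" unfolding fg by (simp add: fixed_points_def)
      then obtain a where a: "a \<in> carrier A" "b = f a" by blast
      interpret A: left_module "group_algebra G" A by (rule fg_gmodsD[OF A])
      \<comment> \<open>The fixed vector \<open>b\<close> has a fixed preimage: \<open>f\<close>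
        maps both \<open>a\<close> and its translate to \<open>b\<close>, and \<open>f\<close> is
        injective.\<close>
      have "ga_single s 1 \<odot>\<^bsub>A\<^esub> a = a" if s: "s \<in> S" for s
      proof -
        have cl: "ga_single s 1 \<in> carrier (group_algebra G :: ('g \<Rightarrow> 'k) ring)"
          using s sub by (intro ga_single_closed) auto
        have "f (ga_single s 1 \<odot>\<^bsub>A\<^esub> a) = f a"
          using lmod_homD(3)[OF f(1) cl a(1)] b(1) a(2) s by (simp add: fixed_points_def)
        then show ?thesis using f(2) A.smult_closed[OF cl a(1)] a(1) by (auto dest: inj_onD)
      qed
      then show "b \<in> f ` fixed_points G S A" using a by (auto simp: fixed_points_def)
    qed
  qed
  have "f \<in> lmod_hom class_ring ?A (g.V.vs g.kerT)"
    using lmod_homD[OF fixed_space_hom[OF f(1) sub]] fker by (intro lmod_homI) auto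
  then interpret f: linear_map class_ring ?A "g.V.vs g.kerT" f
    by (intro linear_mapI vectorspace_fixed_space kerV A sub)
  have "inj_on f (carrier ?A)"
    using f(2) by (rule inj_on_subset) (auto simp: fixed_points_def)
  then have "fixed_dim G S A = vectorspace.dim class_ring (g.V.vs g.kerT)"
    unfolding fixed_dim_def using fker fin_dim_fixed_space[OF A sub] by (intro f.dim_eq) auto
  moreover have "vectorspace.dim class_ring (g.W.vs g.imT) = fixed_dim G S C"
    using g.surj_imp_imT_carrier[OF surj] by (simp add: fixed_dim_def) (simp add: fixed_space_def)
  ultimately show ?thesis
    using g.rank_nullity[OF fin_dim_fixed_space[OF B sub]] by (simp add: fixed_dim_def)
qed

end

text \<open>The additive extension of \<open>d\<close> to formal sums. Encoding it through the free
  abelian group on one generator makes additivity an instance of the laws of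
  \<open>frag_extend\<close>.\<close>

definition frag_weight :: "('a \<Rightarrow> nat) \<Rightarrow> ('a \<Rightarrow>\<^sub>0 int) \<Rightarrow> int" where
  "frag_weight d x = Poly_Mapping.lookup (frag_extend (\<lambda>M. frag_cmul (int (d M)) (frag_of ())) x) ()"

lemma frag_weight_simps [simp]:
  "frag_weight d 0 = 0"
  "frag_weight d (frag_of M) = int (d M)"
  "frag_weight d (x + y) = frag_weight d x + frag_weight d y"
  "frag_weight d (x - y) = frag_weight d x - frag_weight d y"
  "frag_weight d (frag_cmul c x) = c * frag_weight d x"
  by (simp_all add: frag_weight_def frag_extend_add frag_extend_diff lookup_add lookup_minus frag_extend_cmul)

lemma (in finite_group) fixed_dim_exact_relations:
  assumes S: "subgroup S G" and x: "x \<in> (exact_relations G :: (('g, 'k::field_char_0) gmod \<Rightarrow>\<^sub>0 int) set)"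
  shows "frag_weight (fixed_dim G S) x = 0"
  using x
proof (induction rule: exact_relations_induct)
  case (exact A B C f g)
  then show ?case using fixed_dim_exact[OF exact S] by simp
qed auto

section \<open>Free actions\<close>

text \<open>A free right action, on an arbitrary set instead of \<open>{..<n}\<close> so that orbits
  can be removed in an induction.\<close>

definition free_on :: "('g, 'b) monoid_scheme \<Rightarrow> 'a set \<Rightarrow> ('g \<Rightarrow> 'a \<Rightarrow> 'a) \<Rightarrow> bool" where
  "free_on G A \<alpha> \<longleftrightarrow>
    (\<forall>h\<in>carrier G. \<forall>i\<in>A. \<alpha> h i \<in> A) \<and> (\<forall>i\<in>A. \<alpha> \<one>\<^bsub>G\<^esub> i = i) \<and>
    (\<forall>h\<in>carrier G. \<forall>k\<in>carrier G. \<forall>i\<in>A. \<alpha> (h \<otimes>\<^bsub>G\<^esub> k) i = \<alpha> k (\<alpha> h i)) \<and>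
    (\<forall>h\<in>carrier G. \<forall>i\<in>A. \<alpha> h i = i \<longrightarrow> h = \<one>\<^bsub>G\<^esub>)"

lemma (in group)
  assumes free: "free_on G A \<alpha>" and x: "x \<in> A"
  shows inj_on_orbit: "inj_on (\<lambda>h. \<alpha> h x) (carrier G)"
    and free_on_diff_orbit: "free_on G (A - (\<lambda>h. \<alpha> h x) ` carrier G) \<alpha>"
proof -
  note closed = free[unfolded free_on_def, THEN conjunct1, rule_format]
  note one = free[unfolded free_on_def, THEN conjunct2, THEN conjunct1, rule_format]
  note mult = free[unfolded free_on_def, THEN conjunct2, THEN conjunct2, THEN conjunct1, rule_format]
  note faithful = free[unfolded free_on_def, THEN conjunct2, THEN conjunct2, THEN conjunct2, rule_format]
  show "inj_on (\<lambda>h. \<alpha> h x) (carrier G)"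
  proof (rule inj_onI)
    fix h k assume hk: "h \<in> carrier G" "k \<in> carrier G" and eq: "\<alpha> h x = \<alpha> k x"
    \<comment> \<open>Let \<open>inv k\<close> act on both sides of \<open>eq\<close>; in a right
      action the second factor of a product acts last.\<close>
    have "\<alpha> (h \<otimes> inv k) x = \<alpha> (k \<otimes> inv k) x"
      using hk x eq by (simp only: mult inv_closed)
    then have "\<alpha> (h \<otimes> inv k) x = x" using hk x by (simp add: one)
    then have "h \<otimes> inv k = \<one>" using hk x by (intro faithful) auto
    then show "h = k" using hk by (metis inv_closed inv_equality inv_inv)
  qed
  have "\<alpha> h i \<notin> (\<lambda>h. \<alpha> h x) ` carrier G"
    if h: "h \<in> carrier G" and i: "i \<in> A" "i \<notin> (\<lambda>h. \<alpha> h x) ` carrier G" for h i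
  proof
    assume "\<alpha> h i \<in> (\<lambda>h. \<alpha> h x) ` carrier G"
    then obtain k where k: "k \<in> carrier G" "\<alpha> h i = \<alpha> k x" by blast
    have "i = \<alpha> (h \<otimes> inv h) i" using h i by (simp add: one)
    also have "\<dots> = \<alpha> (inv h) (\<alpha> k x)" using h i k by (simp only: mult inv_closed)
    also have "\<dots> = \<alpha> (k \<otimes> inv h) x" using h k x by (simp only: mult inv_closed)
    finally show False using i(2) h k(1) by blast
  qed
  then show "free_on G (A - (\<lambda>h. \<alpha> h x) ` carrier G) \<alpha>"
    unfolding free_on_def
  proof (intro conjI ballI impI)
    fix h i assume "h \<in> carrier G" "i \<in> A - (\<lambda>h. \<alpha> h x) ` carrier G" "\<alpha> h i = i"
    then show "h = \<one>" using faithful by blast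
  qed (use closed one mult in auto)
qed

text \<open>Induction on cardinality, removing one orbit on each side. Once base points
  \<open>x\<close> and \<open>y\<close> are chosen, an orbit of a free action is a copy of the
  group, so \<open>\<alpha> h x \<mapsto> \<beta> h y\<close> is a well-defined equivariant
  bijection of the two orbits. They have equal size, so the complements again match.\<close>

lemma (in finite_group) free_actions_isomorphic:
  assumes "finite A" "finite B" "card A = card B" "free_on G A \<alpha>" "free_on G B \<beta>"
  shows "\<exists>\<sigma>. bij_betw \<sigma> A B \<and> (\<forall>h\<in>carrier G. \<forall>i\<in>A. \<sigma> (\<alpha> h i) = \<beta> h (\<sigma> i))"
  using assms
proof (induction "card A" arbitrary: A B rule: less_induct)
  case less
  show ?case
  proof (cases "A = {}")
    case True
    then show ?thesis using less.prems by (auto simp: bij_betw_def)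
  next
    case False
    then obtain x where x: "x \<in> A" by blast
    have "B \<noteq> {}" using False less.prems by auto
    then obtain y where y: "y \<in> B" by blast
    let ?f = "\<lambda>h. \<alpha> h x" and ?g = "\<lambda>h. \<beta> h y"
    let ?O = "?f ` carrier G" and ?P = "?g ` carrier G"
    note f = inj_on_orbit[OF less.prems(4) x] and g = inj_on_orbit[OF less.prems(5) y]
    have OA: "?O \<subseteq> A" and PB: "?P \<subseteq> B"
      using less.prems(4,5) x y by (auto simp: free_on_def)
    have "card (A - ?O) = card (B - ?P)"
      using OA PB less.prems(3) card_image[OF f] card_image[OF g] by (simp add: card_Diff_subset)
    moreover have "card (A - ?O) < card A"
      using x OA less.prems(1) one_closed by (intro psubset_card_mono) blast+
    ultimately obtain \<sigma> where \<sigma>: "bij_betw \<sigma> (A - ?O) (B - ?P)"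
      "\<And>h i. h \<in> carrier G \<Longrightarrow> i \<in> A - ?O \<Longrightarrow> \<sigma> (\<alpha> h i) = \<beta> h (\<sigma> i)"
      using less.hyps[of "A - ?O" "B - ?P"] less.prems
        free_on_diff_orbit[OF less.prems(4) x] free_on_diff_orbit[OF less.prems(5) y] by auto
    \<comment> \<open>On the removed orbit, \<open>inv_into\<close> recovers the unique group
      element that carries \<open>x\<close> to \<open>i\<close>; elsewhere the bijection from the
      induction hypothesis is kept.\<close>
    define \<tau> where "\<tau> i = (if i \<in> ?O then ?g (inv_into (carrier G) ?f i) else \<sigma> i)" for i
    have \<tau>f: "\<tau> (?f h) = ?g h" if "h \<in> carrier G" for h
      using that inv_into_f_f[OF f that] by (simp add: \<tau>_def)
    have "bij_betw \<tau> ?O ?P"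
      unfolding bij_betw_def
    proof
      show "inj_on \<tau> ?O" using g \<tau>f by (auto simp: inj_on_def)
      show "\<tau> ` ?O = ?P" using \<tau>f by (auto simp: image_image)
    qed
    moreover have "bij_betw \<tau> (A - ?O) (B - ?P) = bij_betw \<sigma> (A - ?O) (B - ?P)"
      by (rule bij_betw_cong) (simp add: \<tau>_def)
    with \<sigma>(1) have "bij_betw \<tau> (A - ?O) (B - ?P)" by simp
    ultimately have "bij_betw \<tau> (?O \<union> (A - ?O)) (?P \<union> (B - ?P))"
      by (rule bij_betw_combine) blast
    then have bij: "bij_betw \<tau> A B" using OA PB by (simp add: Un_absorb1)
    have "\<tau> (\<alpha> h i) = \<beta> h (\<tau> i)" if h: "h \<in> carrier G" and i: "i \<in> A" for h i
    proof (cases "i \<in> ?O")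
      case True
      then obtain k where k: "k \<in> carrier G" "i = ?f k" by blast
      have "\<alpha> h i = ?f (k \<otimes> h)" using less.prems(4) k h x by (simp add: free_on_def)
      then have "\<tau> (\<alpha> h i) = ?g (k \<otimes> h)" using \<tau>f[of "k \<otimes> h"] k(1) h by simp
      also have "\<dots> = \<beta> h (?g k)" using less.prems(5) k(1) h y by (simp add: free_on_def)
      finally show ?thesis using \<tau>f[OF k(1)] k(2) by simp
    next
      case False
      then have "\<alpha> h i \<in> A - ?O"
        using free_on_diff_orbit[OF less.prems(4) x] h i unfolding free_on_def by blast
      then show ?thesis using False i \<sigma>(2)[OF h, of i] by (simp add: \<tau>_def)
    qed
    with bij show ?thesis by blast
  qed
qed

text \<open>Right multiplication on \<open>n div card (carrier G)\<close> disjoint copies of the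
  group is free. Divisibility makes the total number of points exactly \<open>n\<close>, so the
  action can be transported to \<open>{..<n}\<close>.\<close>

lemma (in finite_group) free_action_exists:
  assumes "card (carrier G) dvd n"
  shows "\<exists>\<alpha>. perm_action G n \<alpha> \<and> free_on G {..<n} \<alpha>"
proof -
  let ?Q = "carrier G \<times> {..<n div card (carrier G)}"
  have "card {..<n} = card ?Q" using assms by (simp add: card_cartesian_product)
  then obtain e where e: "bij_betw e {..<n} ?Q"
    using finite_same_card_bij[of "{..<n}" ?Q] by auto
  \<comment> \<open>The identity from \<open>n\<close> on makes the laws in
    \<open>perm_action\<close> hold at every index.\<close>
  define \<alpha> where "\<alpha> h i = (if i < n then inv_into {..<n} e (fst (e i) \<otimes> h, snd (e i)) else i)" for h i
  have eQ: "e i \<in> ?Q" if "i < n" for i using e that by (auto simp: bij_betw_def)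
  have \<alpha>: "\<alpha> h i < n" "e (\<alpha> h i) = (fst (e i) \<otimes> h, snd (e i))" if "i < n" "h \<in> carrier G" for h i
  proof -
    have "(fst (e i) \<otimes> h, snd (e i)) \<in> e ` {..<n}"
      using eQ[OF that(1)] that(2) e by (auto simp: bij_betw_def mem_Times_iff)
    then show "\<alpha> h i < n" "e (\<alpha> h i) = (fst (e i) \<otimes> h, snd (e i))"
      using that(1) inv_into_into[of _ e "{..<n}"] f_inv_into_f[of _ e "{..<n}"] by (auto simp: \<alpha>_def)
  qed
  have inj: "i = j" if "i < n" "j < n" "e i = e j" for i j
    using e that by (auto simp: bij_betw_def inj_on_def)
  have one: "\<alpha> \<one> i = i" for i
  proof (cases "i < n")
    case True
    then show ?thesis using \<alpha>[OF True one_closed] eQ[OF True] by (intro inj) (auto simp: prod_eq_iff mem_Times_iff)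
  qed (simp add: \<alpha>_def)
  have mult: "\<alpha> (h \<otimes> k) i = \<alpha> k (\<alpha> h i)" if "h \<in> carrier G" "k \<in> carrier G" for h k i
  proof (cases "i < n")
    case True
    have "e (\<alpha> (h \<otimes> k) i) = e (\<alpha> k (\<alpha> h i))"
      using \<alpha>(2)[OF True, of "h \<otimes> k"] \<alpha>(2)[OF \<alpha>(1)[OF True that(1)] that(2)] \<alpha>(2)[OF True that(1)] that eQ[OF True]
      by (simp add: m_assoc mem_Times_iff)
    then show ?thesis using True that \<alpha>(1) by (intro inj) auto
  qed (simp add: \<alpha>_def)
  have "h = \<one>" if "h \<in> carrier G" "i < n" "\<alpha> h i = i" for h i
    using \<alpha>(2)[OF that(2,1)] that eQ[OF that(2)] by (simp add: prod_eq_iff mem_Times_iff)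
  then have "free_on G {..<n} \<alpha>" using one mult \<alpha>(1) by (simp add: free_on_def)
  moreover have "perm_action G n \<alpha>" using one mult \<alpha>(1) by (auto simp: perm_action_def \<alpha>_def)
  ultimately show ?thesis by blast
qed

text \<open>Functions pull back: an equivariant bijection \<open>\<sigma>\<close> from the
  \<open>\<alpha>\<close>-set to the \<open>\<beta>\<close>-set induces an isomorphism from the
  module of \<open>\<beta>\<close> to that of \<open>\<alpha>\<close>.\<close>

lemma (in finite_group) perm_gmod_iso:
  fixes \<alpha> \<beta> :: "'g \<Rightarrow> nat \<Rightarrow> nat"
  assumes \<alpha>: "perm_action G n \<alpha>" and \<beta>: "perm_action G n \<beta>"
    and \<sigma>: "bij_betw \<sigma> {..<n} {..<n}" and eq: "\<And>h i. h \<in> carrier G \<Longrightarrow> i < n \<Longrightarrow> \<sigma> (\<alpha> h i) = \<beta> h (\<sigma> i)"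
  shows "frag_of (perm_gmod G n \<alpha>) - frag_of (perm_gmod G n \<beta>) \<in>
    (exact_relations G :: (('g, 'k::field) gmod \<Rightarrow>\<^sub>0 int) set)"
proof (rule frag_of_iso[OF perm_gmod_fg_gmods perm_gmod_fg_gmods])
  let ?A = "perm_gmod G n \<beta> :: ('g, 'k) gmod" and ?B = "perm_gmod G n \<alpha> :: ('g, 'k) gmod"
  \<comment> \<open>The cut at \<open>n\<close> is needed because \<open>\<sigma>\<close> is
    controlled on \<open>{..<n}\<close> only; it respects the action since \<open>\<alpha>\<close>
    keeps indices on their side of \<open>n\<close>.\<close>
  let ?f = "\<lambda>(v :: nat \<Rightarrow> 'k) i. if i < n then v (\<sigma> i) else 0"
  show "?f \<in> lmod_hom (group_algebra G) ?A ?B"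
  proof (rule lmod_homI)
    fix a v
    show "?f (a \<odot>\<^bsub>?A\<^esub> v) = a \<odot>\<^bsub>?B\<^esub> ?f v"
    proof
      fix i
      show "?f (a \<odot>\<^bsub>?A\<^esub> v) i = (a \<odot>\<^bsub>?B\<^esub> ?f v) i"
        using \<alpha> eq by (auto simp: perm_action_def intro!: sum.cong)
    qed
  qed auto
  show "bij_betw ?f (carrier ?A) (carrier ?B)"
    unfolding bij_betw_def
  proof
    show "inj_on ?f (carrier ?A)"
    proof (rule inj_onI)
      fix v w assume v: "v \<in> carrier ?A" and w: "w \<in> carrier ?A" and "?f v = ?f w"
      then have vw: "v (\<sigma> i) = w (\<sigma> i)" if "i < n" for i using that by (metis (no_types, lifting))
      show "v = w"
      proof
        fix j
        show "v j = w j"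
        proof (cases "j < n")
          case True
          then obtain i where "i < n" "j = \<sigma> i" using \<sigma> by (auto simp: bij_betw_def)
          then show ?thesis using vw by simp
        qed (use v w in simp)
      qed
    qed
    show "?f ` carrier ?A = carrier ?B"
    proof
      show "?f ` carrier ?A \<subseteq> carrier ?B" by auto
      show "carrier ?B \<subseteq> ?f ` carrier ?A"
      proof
        fix w assume w: "w \<in> carrier ?B"
        let ?v = "\<lambda>j. if j < n then w (inv_into {..<n} \<sigma> j) else 0"
        have "w i = ?f ?v i" for i
          using w \<sigma> inv_into_f_f[of \<sigma> "{..<n}" i] by (auto simp: bij_betw_def)
        then have "w = ?f ?v" by blast
        then show "w \<in> ?f ` carrier ?A" by (rule image_eqI[where x = ?v]) simp
      qed
    qed
  qed
qed (fact \<alpha> \<beta>)+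

text \<open>An equality of records, not just an isomorphism; in particular the trivial module pulls
  back to the trivial module itself.\<close>

lemma (in finite_group_hom) pullback_perm_gmod:
  "pullback H \<phi> (perm_gmod G n \<alpha>) = perm_gmod H n (\<lambda>h. \<alpha> (\<phi> h))"
  by (simp add: pullback_def perm_gmod_def sum_ga_map)

text \<open>A free action stays free along an injective homomorphism and keeps its \<open>n\<close>
  points, and the number of points decides the isomorphism class. This is why one \<open>n\<close>
  has to serve all subgroups.\<close>

lemma (in finite_group_hom) pullback_free_perm_gmod:
  assumes "perm_action G n \<alpha>" "free_on G {..<n} \<alpha>" "perm_action H n \<beta>" "free_on H {..<n} \<beta>"
    and inj: "inj_on \<phi> (carrier H)"
  shows "frag_of (pullback H \<phi> (perm_gmod G n \<alpha>)) - frag_of (perm_gmod H n \<beta>) \<in>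
    (exact_relations H :: (('g, 'k::field) gmod \<Rightarrow>\<^sub>0 int) set)"
proof -
  let ?\<alpha> = "\<lambda>h. \<alpha> (\<phi> h)"
  have perm: "perm_action H n ?\<alpha>"
    using assms(1) hom_closed hom_one hom_mult[OF hom] by (simp add: perm_action_def)
  have "h = \<one>\<^bsub>H\<^esub>" if "h \<in> carrier H" "\<phi> h = \<one>\<^bsub>G\<^esub>" for h
    using inj_onD[OF inj, of h "\<one>\<^bsub>H\<^esub>"] that hom_one by simp
  then have "free_on H {..<n} ?\<alpha>"
    using assms(2) hom_closed hom_one hom_mult[OF hom] by (simp add: free_on_def)
  from H.free_actions_isomorphic[OF _ _ _ this assms(4)]
  obtain \<sigma> where "bij_betw \<sigma> {..<n} {..<n}" "\<forall>h\<in>carrier H. \<forall>i\<in>{..<n}. \<sigma> (?\<alpha> h i) = \<beta> h (\<sigma> i)" by auto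
  then show ?thesis
    unfolding pullback_perm_gmod by (intro H.perm_gmod_iso[OF perm assms(3)]) auto
qed

context finite_group
begin

lemma fixed_points_one: "M \<in> fg_gmods G \<Longrightarrow> fixed_points G {\<one>} M = carrier M"
  using left_module.smult_one[OF fg_gmodsD(1)] by (auto simp: fixed_points_def)

lemma fixed_points_trivial_gmod:
  "S \<subseteq> carrier G \<Longrightarrow> fixed_points G S (trivial_gmod G) = carrier (trivial_gmod G)"
  by (auto simp: fixed_points_def trivial_gmod_eq_perm_gmod)

lemma trivial_gmod_fg_gmods: "trivial_gmod G \<in> fg_gmods G"
  unfolding trivial_gmod_eq_perm_gmod by (intro perm_gmod_fg_gmods perm_action_trivial)

text \<open>In a multiple of the trivial module, \<open>G\<close> fixes a subspace of full dimension.\<close>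

lemma perm_gmod_not_multiple_of_trivial:
  assumes \<alpha>: "perm_action G n \<alpha>" "free_on G {..<n} \<alpha>" and "n > 0" and G: "carrier G \<noteq> {\<one>}"
  shows "frag_of (perm_gmod G n \<alpha>) - frag_cmul m (frag_of (trivial_gmod G)) \<notin>
    (exact_relations G :: (('g, 'k::field_char_0) gmod \<Rightarrow>\<^sub>0 int) set)"
proof
  let ?P = "perm_gmod G n \<alpha> :: ('g, 'k) gmod" and ?K = "trivial_gmod G :: ('g, 'k) gmod"
  assume rel: "frag_of ?P - frag_cmul m (frag_of ?K) \<in> exact_relations G"
  have P: "?P \<in> fg_gmods G" by (rule perm_gmod_fg_gmods[OF \<alpha>(1)])
  have one: "subgroup {\<one>} G" by (rule triv_subgroup)
  have "fixed_dim G (carrier G) ?K = fixed_dim G {\<one>} ?K"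
    by (simp add: fixed_dim_def fixed_space_def fixed_points_trivial_gmod)
  \<comment> \<open>The same \<open>m\<close> occurs for every \<open>S\<close>. Taking
    \<open>S\<close> trivial and \<open>S\<close> the whole group, the two fixed dimensions of the
    permutation module are equal multiples of the same number.\<close>
  moreover have "int (fixed_dim G S ?P) = m * int (fixed_dim G S ?K)" if "subgroup S G" for S
    using fixed_dim_exact_relations[OF that rel] by simp
  ultimately have "int (fixed_dim G (carrier G) ?P) = int (fixed_dim G {\<one>} ?P)"
    using one subgroup_self by simp
  then have eq: "fixed_dim G (carrier G) ?P = fixed_dim G {\<one>} ?P" by simp
  interpret V: vectorspace class_ring "restrict_scalars G ?P"
    by (intro vectorspace_restrict_scalars fg_gmodsD P)
  have "(restrict_scalars G ?P)\<lparr>carrier := carrier ?P\<rparr> = restrict_scalars G ?P"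
    by (simp add: restrict_scalars_def)
  with eq have "vectorspace.dim class_ring (V.vs (fixed_points G (carrier G) ?P)) = V.dim"
    by (simp only: fixed_dim_def fixed_space_def fixed_points_one[OF P])
  from V.subspace_dim_eq[OF fin_dim_restrict_scalars[OF P] subspace_fixed_points[OF fg_gmodsD(1)[OF P] subset_refl] this]
  have full: "fixed_points G (carrier G) ?P = carrier ?P" by simp
  obtain h where h: "h \<in> carrier G" "h \<noteq> \<one>" using G one_closed by blast
  \<comment> \<open>The indicator of the point 0, which exists as \<open>n > 0\<close>. If
    \<open>h\<close> fixes this vector, then \<open>h\<close> fixes the point 0, and freeness gives
    \<open>h = \<one>\<close>.\<close>
  have "unit_coord 0 \<in> carrier ?P" using \<open>n > 0\<close> by (auto simp: unit_coord_def)
  then have "unit_coord 0 \<in> fixed_points G (carrier G) ?P" unfolding full .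
  then have "ga_single h 1 \<odot>\<^bsub>?P\<^esub> unit_coord 0 = (unit_coord 0 :: nat \<Rightarrow> 'k)"
    using h(1) unfolding fixed_points_def by blast
  then have "unit_coord 0 (\<alpha> h 0) = (unit_coord 0 0 :: 'k)"
    using h(1) by (auto dest!: fun_cong[of _ _ 0])
  then have "\<alpha> h 0 = 0" by (simp add: unit_coord_def split: if_splits)
  then show False using \<alpha>(2) h \<open>n > 0\<close> by (auto simp: free_on_def)
qed

end

section \<open>Families of finite subgroups\<close>

context group
begin

lemma finite_group_subgroup: "H \<in> finite_subgroups G \<Longrightarrow> finite_group (G\<lparr>carrier := H\<rparr>)"
  by (intro finite_group.intro finite_group_axioms.intro subgroup.subgroup_is_group is_group)
    (auto simp: finite_subgroups_def)

lemma finite_group_hom_inclusion: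
  "\<lbrakk>H \<in> finite_subgroups G; L \<in> finite_subgroups G; H \<subseteq> L\<rbrakk> \<Longrightarrow>
    finite_group_hom (G\<lparr>carrier := H\<rparr>) (G\<lparr>carrier := L\<rparr>) (\<lambda>h. h)"
  by (intro finite_group_hom.intro finite_group_hom_axioms.intro finite_group_subgroup)
    (auto simp: hom_def)

lemma conj_subgroup_eq_image: "conj_subgroup G \<gamma> H = (\<lambda>h. \<gamma> \<otimes> h \<otimes> inv \<gamma>) ` H"
  by (auto simp: conj_subgroup_def l_coset_def r_coset_def)

lemma conjugation_inj_on: "\<gamma> \<in> carrier G \<Longrightarrow> H \<subseteq> carrier G \<Longrightarrow> inj_on (\<lambda>h. \<gamma> \<otimes> h \<otimes> inv \<gamma>) H"
  by (auto simp: inj_on_def subset_iff)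

lemma finite_group_hom_conjugation:
  assumes H: "H \<in> finite_subgroups G" and L: "conj_subgroup G \<gamma> H \<in> finite_subgroups G" and \<gamma>: "\<gamma> \<in> carrier G"
  shows "finite_group_hom (G\<lparr>carrier := H\<rparr>) (G\<lparr>carrier := conj_subgroup G \<gamma> H\<rparr>) (\<lambda>h. \<gamma> \<otimes> h \<otimes> inv \<gamma>)"
proof (intro finite_group_hom.intro finite_group_hom_axioms.intro finite_group_subgroup H L)
  have HG: "H \<subseteq> carrier G" using H by (auto simp: finite_subgroups_def dest: subgroup.subset)
  have "\<gamma> \<otimes> (h \<otimes> k) \<otimes> inv \<gamma> = (\<gamma> \<otimes> h \<otimes> inv \<gamma>) \<otimes> (\<gamma> \<otimes> k \<otimes> inv \<gamma>)"
    if "h \<in> carrier G" "k \<in> carrier G" for h k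
  proof -
    have "(\<gamma> \<otimes> h \<otimes> inv \<gamma>) \<otimes> (\<gamma> \<otimes> k \<otimes> inv \<gamma>) = \<gamma> \<otimes> h \<otimes> (inv \<gamma> \<otimes> \<gamma>) \<otimes> k \<otimes> inv \<gamma>"
      using that \<gamma> by (simp only: m_assoc m_closed inv_closed)
    also have "\<dots> = \<gamma> \<otimes> (h \<otimes> k) \<otimes> inv \<gamma>" using that \<gamma> by (simp add: m_assoc)
    finally show ?thesis by simp
  qed
  then show "(\<lambda>h. \<gamma> \<otimes> h \<otimes> inv \<gamma>) \<in> hom (G\<lparr>carrier := H\<rparr>) (G\<lparr>carrier := conj_subgroup G \<gamma> H\<rparr>)"
    using HG by (auto simp: hom_def conj_subgroup_eq_image subset_iff)
qed

text \<open>The order of a subgroup is that of any representative of its conjugacy class, so only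
  finitely many orders occur; their product is the common multiple. This is where finiteness of the
  number of conjugacy classes enters.\<close>

lemma finite_subgroups_common_multiple:
  assumes "finite (finite_subgroups G // conjugacy G)"
  obtains n where "n > 0" "\<And>H. H \<in> finite_subgroups G \<Longrightarrow> card H dvd n"
proof -
  have "card H \<in> (\<lambda>C. card (SOME L. L \<in> C)) ` (finite_subgroups G // conjugacy G)"
    if H: "H \<in> finite_subgroups G" for H
  proof (rule image_eqI)
    show "conjugacy G `` {H} \<in> finite_subgroups G // conjugacy G" using H by (rule quotientI)
    have HG: "H \<subseteq> carrier G" using H by (auto simp: finite_subgroups_def dest: subgroup.subset)
    have "conj_subgroup G \<one> H = H"
      using HG by (force simp: conj_subgroup_eq_image)
    then have "H \<in> conjugacy G `` {H}" using H one_closed by (auto simp: conjugacy_def)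
    then have "(SOME L. L \<in> conjugacy G `` {H}) \<in> conjugacy G `` {H}" by (rule someI)
    then obtain \<gamma> where "\<gamma> \<in> carrier G" "(SOME L. L \<in> conjugacy G `` {H}) = conj_subgroup G \<gamma> H"
      by (auto simp: conjugacy_def)
    then show "card H = card (SOME L. L \<in> conjugacy G `` {H})"
      using card_image[OF conjugation_inj_on[OF _ HG, of \<gamma>]] by (simp add: conj_subgroup_eq_image)
  qed
  then have fin: "finite (card ` finite_subgroups G)"
    using assms by (intro finite_surj[OF assms]) auto
  show thesis
  proof (rule that)
    have "card H > 0" if "H \<in> finite_subgroups G" for H
      using that by (auto simp: finite_subgroups_def card_gt_0_iff dest: subgroup.one_closed)
    then show "\<Prod>(card ` finite_subgroups G) > 0" by (intro prod_pos) auto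
    show "card H dvd \<Prod>(card ` finite_subgroups G)" if "H \<in> finite_subgroups G" for H
      using that fin by (intro dvd_prodI) auto
  qed
qed

end

section \<open>Compatible families of classes\<close>

locale group_with_family = group G for G :: "('g, 'b) monoid_scheme" (structure) +
  fixes \<F> :: "'g set set"
  assumes family: "subgroup_family G \<F>"
begin

lemma family_finite_subgroups: "H \<in> \<F> \<Longrightarrow> H \<in> finite_subgroups G"
  using family by (auto simp: subgroup_family_def)

lemma family_conj: "H \<in> \<F> \<Longrightarrow> \<gamma> \<in> carrier G \<Longrightarrow> conj_subgroup G \<gamma> H \<in> \<F>"
  using family by (auto simp: subgroup_family_def)

lemma family_finite_group: "H \<in> \<F> \<Longrightarrow> finite_group (G\<lparr>carrier := H\<rparr>)"
  by (intro finite_group_subgroup family_finite_subgroups)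

lemma family_trivial_subgroup: "{\<one>} \<in> \<F>"
proof -
  obtain H where H: "H \<in> \<F>" using family by (auto simp: subgroup_family_def)
  then have "subgroup H G" using family_finite_subgroups by (auto simp: finite_subgroups_def)
  then have "{\<one>} \<subseteq> H" by (auto dest: subgroup.one_closed)
  then show ?thesis using H family triv_subgroup by (auto simp: subgroup_family_def)
qed

text \<open>\<open>c\<close> chooses a formal sum for each member of the family. The restriction is
  there because elements of the product are undefined off the family.\<close>

definition family_class ::
  "('g set \<Rightarrow> (('g, 'k::field) gmod \<Rightarrow>\<^sub>0 int)) \<Rightarrow> 'g set \<Rightarrow> (('g, 'k) gmod \<Rightarrow>\<^sub>0 int) set" where
  "family_class c = (\<lambda>H\<in>\<F>. gclass (G\<lparr>carrier := H\<rparr>) (c H))"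

text \<open>Inclusions and conjugations are both injective homomorphisms between members of the
  family. Asking for compatibility along all injective homomorphisms treats both conditions of the
  inverse limit at once, and free as well as trivial permutation modules satisfy it.\<close>

lemma family_class_carrier:
  fixes c :: "'g set \<Rightarrow> (('g, 'k::field) gmod \<Rightarrow>\<^sub>0 int)"
  assumes keys: "\<And>H. H \<in> \<F> \<Longrightarrow> Poly_Mapping.keys (c H) \<subseteq> fg_gmods (G\<lparr>carrier := H\<rparr>)"
    and compat: "\<And>H L \<phi>. \<lbrakk>H \<in> \<F>; L \<in> \<F>; finite_group_hom (G\<lparr>carrier := H\<rparr>) (G\<lparr>carrier := L\<rparr>) \<phi>; inj_on \<phi> H\<rbrakk> \<Longrightarrow>
      frag_extend (\<lambda>M. frag_of (pullback (G\<lparr>carrier := H\<rparr>) \<phi> M)) (c L) - c H \<in> exact_relations (G\<lparr>carrier := H\<rparr>)"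
  shows "family_class c \<in> carrier (family_groth_ring G \<F>)"
proof -
  have pb: "groth_pullback (G\<lparr>carrier := H\<rparr>) \<phi> (family_class c L) = family_class c H"
    if "H \<in> \<F>" "L \<in> \<F>" "finite_group_hom (G\<lparr>carrier := H\<rparr>) (G\<lparr>carrier := L\<rparr>) \<phi>" "inj_on \<phi> H" for H L \<phi>
    using finite_group_hom.groth_pullback_gclass[OF that(3) keys[OF that(2)]] compat[OF that] that(1,2)
    by (simp add: family_class_def gclass_eq_iff)
  have HG: "H \<subseteq> carrier G" if "H \<in> \<F>" for H
    using family_finite_subgroups[OF that] by (auto simp: finite_subgroups_def dest: subgroup.subset)
  show ?thesis
    unfolding family_groth_ring_def Let_def partial_object.simps
  proof (intro CollectI conjI ballI impI PiE_I)
    show "family_class c H \<in> carrier (groth_ring (G\<lparr>carrier := H\<rparr>))" if "H \<in> \<F>" for H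
      using keys[OF that] that by (auto simp: family_class_def groth_ring_simps)
    show "family_class c H = undefined" if "H \<notin> \<F>" for H
      using that by (simp add: family_class_def)
    show "groth_pullback (G\<lparr>carrier := H\<rparr>) (\<lambda>h. h) (family_class c L) = family_class c H"
      if "H \<in> \<F>" "L \<in> \<F>" "H \<subseteq> L" for H L
      by (intro pb finite_group_hom_inclusion family_finite_subgroups that) simp
    show "groth_pullback (G\<lparr>carrier := H\<rparr>) (\<lambda>h. \<gamma> \<otimes> h \<otimes> inv \<gamma>) (family_class c (conj_subgroup G \<gamma> H)) = family_class c H"
      if "H \<in> \<F>" "\<gamma> \<in> carrier G" for H \<gamma>
      by (intro pb finite_group_hom_conjugation family_finite_subgroups family_conj conjugation_inj_on that HG)
  qed
qed

definition multiple_of_one :: "int \<Rightarrow> 'g set \<Rightarrow> (('g, 'k::field) gmod \<Rightarrow>\<^sub>0 int)" where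
  "multiple_of_one m H = frag_cmul m (frag_of (trivial_gmod (G\<lparr>carrier := H\<rparr>)))"

lemma multiple_of_one_carrier: "family_class (multiple_of_one m) \<in> carrier (family_groth_ring G \<F>)"
proof (rule family_class_carrier)
  show "Poly_Mapping.keys (multiple_of_one m H) \<subseteq> fg_gmods (G\<lparr>carrier := H\<rparr>)" if "H \<in> \<F>" for H
    using finite_group.trivial_gmod_fg_gmods[OF family_finite_group[OF that]]
    by (auto simp: multiple_of_one_def)
  show "frag_extend (\<lambda>M. frag_of (pullback (G\<lparr>carrier := H\<rparr>) \<phi> M)) (multiple_of_one m L) - multiple_of_one m H
      \<in> exact_relations (G\<lparr>carrier := H\<rparr>)"
    if "finite_group_hom (G\<lparr>carrier := H\<rparr>) (G\<lparr>carrier := L\<rparr>) \<phi>" for H L \<phi>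
    by (simp add: multiple_of_one_def frag_extend_cmul trivial_gmod_eq_perm_gmod
        finite_group_hom.pullback_perm_gmod[OF that] exact_relations_closed)
qed

lemma family_groth_ring_simps:
  "\<one>\<^bsub>family_groth_ring G \<F>\<^esub> = family_class (multiple_of_one 1)"
  "family_class c \<oplus>\<^bsub>family_groth_ring G \<F>\<^esub> family_class d = family_class (\<lambda>H. c H + d H)"
  by (auto simp: family_groth_ring_def Let_def family_class_def multiple_of_one_def groth_ring_simps
      intro!: restrict_ext)

text \<open>\<open>f\<close> is additive and unital, which fixes its values on integer multiples of
  1. Together with injectivity, any element with value \<open>m\<close> must be \<open>m\<close>
  times 1.\<close>

lemma ring_iso_multiple_of_one:
  fixes f :: "('g set \<Rightarrow> (('g, 'k::field) gmod \<Rightarrow>\<^sub>0 int) set) \<Rightarrow> int"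
  assumes f: "f \<in> ring_iso (family_groth_ring G \<F>) \<Z>"
  shows "f (family_class (multiple_of_one m)) = m"
proof -
  let ?g = "\<lambda>m. f (family_class (multiple_of_one m))"
  have hom: "f \<in> Ring.ring_hom (family_groth_ring G \<F>) \<Z>" using f by (simp add: ring_iso_def)
  have add: "?g (a + b) = ?g a + ?g b" for a b
  proof -
    have "multiple_of_one (a + b) = (\<lambda>H. multiple_of_one a H + multiple_of_one b H :: ('g, 'k) gmod \<Rightarrow>\<^sub>0 int)"
      by (rule ext) (simp add: multiple_of_one_def frag_cmul_distrib)
    then show ?thesis
      using ring_hom_add[OF hom multiple_of_one_carrier multiple_of_one_carrier, of a b]
      by (simp add: family_groth_ring_simps)
  qed
  have one: "?g 1 = 1" using ring_hom_one[OF hom] by (simp add: family_groth_ring_simps)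
  have zero: "?g 0 = 0" using add[of 0 0] by simp
  show ?thesis
  proof (induction m rule: int_induct[of _ 0])
    case (step1 i)
    then show ?case using add[of i 1] one by simp
  next
    case (step2 i)
    then show ?case using add[of "i - 1" 1] one by simp
  qed (rule zero)
qed

theorem iso_integers_imp_trivial:
  assumes fin: "finite (finite_subgroups G // conjugacy G)"
    and iso: "(family_groth_ring G \<F> :: ('g set \<Rightarrow> (('g, 'k::field_char_0) gmod \<Rightarrow>\<^sub>0 int) set) ring) \<simeq> \<Z>"
  shows "\<F> = {{\<one>}}"
proof (rule ccontr)
  assume "\<F> \<noteq> {{\<one>}}"
  then obtain H0 where H0: "H0 \<in> \<F>" "H0 \<noteq> {\<one>}" using family_trivial_subgroup by blast
  obtain n where n: "n > 0" "\<And>H. H \<in> finite_subgroups G \<Longrightarrow> card H dvd n"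
    by (rule finite_subgroups_common_multiple[OF fin]) blast
  \<comment> \<open>The actions for different members are chosen independently of each other;
    compatibility is needed only between classes, and free actions on \<open>n\<close> points are
    isomorphic anyway.\<close>
  have "\<exists>\<alpha>. perm_action (G\<lparr>carrier := H\<rparr>) n \<alpha> \<and> free_on (G\<lparr>carrier := H\<rparr>) {..<n} \<alpha>" if "H \<in> \<F>" for H
    using finite_group.free_action_exists[OF family_finite_group[OF that], of n]
      n(2)[OF family_finite_subgroups[OF that]] by simp
  then obtain \<alpha> where \<alpha>: "\<And>H. H \<in> \<F> \<Longrightarrow> perm_action (G\<lparr>carrier := H\<rparr>) n (\<alpha> H)"
    "\<And>H. H \<in> \<F> \<Longrightarrow> free_on (G\<lparr>carrier := H\<rparr>) {..<n} (\<alpha> H)"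
    by metis
  define c :: "'g set \<Rightarrow> (('g, 'k) gmod \<Rightarrow>\<^sub>0 int)"
    where "c H = frag_of (perm_gmod (G\<lparr>carrier := H\<rparr>) n (\<alpha> H))" for H
  have c: "family_class c \<in> carrier (family_groth_ring G \<F>)"
  proof (rule family_class_carrier)
    show "Poly_Mapping.keys (c H) \<subseteq> fg_gmods (G\<lparr>carrier := H\<rparr>)" if "H \<in> \<F>" for H
      using finite_group.perm_gmod_fg_gmods[OF family_finite_group[OF that] \<alpha>(1)[OF that]]
      by (simp add: c_def)
    show "frag_extend (\<lambda>M. frag_of (pullback (G\<lparr>carrier := H\<rparr>) \<phi> M)) (c L) - c H \<in> exact_relations (G\<lparr>carrier := H\<rparr>)"
      if "H \<in> \<F>" "L \<in> \<F>" "finite_group_hom (G\<lparr>carrier := H\<rparr>) (G\<lparr>carrier := L\<rparr>) \<phi>" "inj_on \<phi> H" for H L \<phi>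
      using finite_group_hom.pullback_free_perm_gmod[OF that(3) \<alpha>[OF that(2)] \<alpha>[OF that(1)]] that(4)
      by (simp add: c_def)
  qed
  obtain f where f: "f \<in> ring_iso (family_groth_ring G \<F> :: ('g set \<Rightarrow> (('g, 'k) gmod \<Rightarrow>\<^sub>0 int) set) ring) \<Z>"
    using iso by (auto simp: is_ring_iso_def)
  \<comment> \<open>The only candidate for the multiple, since \<open>f\<close> takes the value
    \<open>m\<close> on \<open>m\<close> times 1.\<close>
  define m where "m = f (family_class c)"
  have eq: "f (family_class (multiple_of_one m)) = f (family_class c)"
    by (simp add: ring_iso_multiple_of_one[OF f] m_def)
  have inj: "inj_on f (carrier (family_groth_ring G \<F>))"
    using f by (auto simp: ring_iso_def bij_betw_def)
  have "family_class c = family_class (multiple_of_one m)"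
    using inj_onD[OF inj eq multiple_of_one_carrier c] by simp
  \<comment> \<open>The contradiction is read off in the component of the nontrivial member
    \<open>H0\<close>.\<close>
  from fun_cong[OF this, of H0]
  have "c H0 - multiple_of_one m H0 \<in> exact_relations (G\<lparr>carrier := H0\<rparr>)"
    using H0(1) by (simp add: family_class_def gclass_eq_iff)
  then have rel: "frag_of (perm_gmod (G\<lparr>carrier := H0\<rparr>) n (\<alpha> H0)) -
      frag_cmul m (frag_of (trivial_gmod (G\<lparr>carrier := H0\<rparr>)))
      \<in> (exact_relations (G\<lparr>carrier := H0\<rparr>) :: (('g, 'k) gmod \<Rightarrow>\<^sub>0 int) set)"
    by (simp only: c_def multiple_of_one_def)
  have "carrier (G\<lparr>carrier := H0\<rparr>) \<noteq> {\<one>\<^bsub>G\<lparr>carrier := H0\<rparr>\<^esub>}" using H0(2) by simp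
  from finite_group.perm_gmod_not_multiple_of_trivial[OF family_finite_group[OF H0(1)] \<alpha>[OF H0(1)] n(1) this] rel
  show False by (rule notE)
qed

end

section \<open>Tensor products of coordinate spaces\<close>

lemma lmod_hom_restrict:
  assumes "f \<in> lmod_hom R M N" "left_module R M"
  shows "restrict f (carrier M) \<in> lmod_hom R M N"
proof -
  interpret left_module R M by fact
  show ?thesis using lmod_homD[OF assms(1)] smult_closed by (intro lmod_homI) auto
qed

text \<open>The universal property speaks of a unique extensional map. The last clause frees
  uniqueness of that normalisation: arbitrary homomorphisms with the same values on pure tensors
  agree on the carrier.\<close>

lemma is_tensorD:
  assumes "is_tensor R M N T \<tau>"
  shows "left_module R T" "lmod_bilinear R M N T \<tau>"
    and "\<lbrakk>left_module R V; lmod_bilinear R M N V \<beta>\<rbrakk> \<Longrightarrow>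
      \<exists>f\<in>lmod_hom R T V. \<forall>x\<in>carrier M. \<forall>y\<in>carrier N. f (\<tau> x y) = \<beta> x y"
    and "\<lbrakk>f \<in> lmod_hom R T V; g \<in> lmod_hom R T V; left_module R V; lmod_bilinear R M N V \<beta>;
      \<And>x y. x \<in> carrier M \<Longrightarrow> y \<in> carrier N \<Longrightarrow> f (\<tau> x y) = \<beta> x y;
      \<And>x y. x \<in> carrier M \<Longrightarrow> y \<in> carrier N \<Longrightarrow> g (\<tau> x y) = \<beta> x y; t \<in> carrier T\<rbrakk> \<Longrightarrow> f t = g t"
proof -
  show T: "left_module R T" and bil: "lmod_bilinear R M N T \<tau>" using assms by (auto simp: is_tensor_def)
  have univ: "\<exists>!f. f \<in> extensional (carrier T) \<and> f \<in> lmod_hom R T V \<and>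
        (\<forall>x\<in>carrier M. \<forall>y\<in>carrier N. f (\<tau> x y) = \<beta> x y)"
    if "left_module R V" "lmod_bilinear R M N V \<beta>" for V \<beta>
    using assms that unfolding is_tensor_def by blast
  have cl: "\<tau> x y \<in> carrier T" if "x \<in> carrier M" "y \<in> carrier N" for x y
  proof (rule lmod_homD(1)[OF _ that(2)])
    show "\<tau> x \<in> lmod_hom R N T" using bil that(1) by (simp add: lmod_bilinear_def)
  qed
  show "\<exists>f\<in>lmod_hom R T V. \<forall>x\<in>carrier M. \<forall>y\<in>carrier N. f (\<tau> x y) = \<beta> x y"
    if "left_module R V" "lmod_bilinear R M N V \<beta>"
    using ex1_implies_ex[OF univ[OF that]] by blast
  assume f: "f \<in> lmod_hom R T V" and g: "g \<in> lmod_hom R T V" and V: "left_module R V" "lmod_bilinear R M N V \<beta>"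
    and f\<beta>: "\<And>x y. x \<in> carrier M \<Longrightarrow> y \<in> carrier N \<Longrightarrow> f (\<tau> x y) = \<beta> x y"
    and g\<beta>: "\<And>x y. x \<in> carrier M \<Longrightarrow> y \<in> carrier N \<Longrightarrow> g (\<tau> x y) = \<beta> x y" and t: "t \<in> carrier T"
  from univ[OF V] obtain u where u: "\<And>f. f \<in> extensional (carrier T) \<and> f \<in> lmod_hom R T V \<and>
        (\<forall>x\<in>carrier M. \<forall>y\<in>carrier N. f (\<tau> x y) = \<beta> x y) \<Longrightarrow> f = u"
    by (elim ex1E) blast
  have "restrict f (carrier T) = u" using lmod_hom_restrict[OF f T] f\<beta> cl by (intro u) simp
  moreover have "restrict g (carrier T) = u" using lmod_hom_restrict[OF g T] g\<beta> cl by (intro u) simp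
  ultimately have "restrict f (carrier T) t = restrict g (carrier T) t" by simp
  then show "f t = g t" using t by simp
qed

lemma tensor_unique:
  assumes S: "is_tensor R M N S \<sigma>" and T: "is_tensor R M N T \<tau>"
  obtains f where "f \<in> lmod_hom R S T" "bij_betw f (carrier S) (carrier T)"
proof -
  \<comment> \<open>Each composite agrees with the identity on pure tensors. Stated for arbitrary
    tensor products so that both orders of composition are instances.\<close>
  have inverse: "w (u t) = t"
    if S: "is_tensor R M N S \<sigma>" and T: "is_tensor R M N T \<tau>"
      and u: "u \<in> lmod_hom R S T" "\<forall>x\<in>carrier M. \<forall>y\<in>carrier N. u (\<sigma> x y) = \<tau> x y"
      and w: "w \<in> lmod_hom R T S" "\<forall>x\<in>carrier M. \<forall>y\<in>carrier N. w (\<tau> x y) = \<sigma> x y"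
      and t: "t \<in> carrier S" for S T \<sigma> \<tau> u w t
    by (rule is_tensorD(4)[OF S lmod_hom_comp[OF u(1) w(1)] _ is_tensorD(1,2)[OF S] _ _ t])
      (use u(2) w(2) in \<open>auto intro: lmod_homI\<close>)
  obtain u where u: "u \<in> lmod_hom R S T" "\<forall>x\<in>carrier M. \<forall>y\<in>carrier N. u (\<sigma> x y) = \<tau> x y"
    using is_tensorD(3)[OF S is_tensorD(1,2)[OF T]] by blast
  obtain w where w: "w \<in> lmod_hom R T S" "\<forall>x\<in>carrier M. \<forall>y\<in>carrier N. w (\<tau> x y) = \<sigma> x y"
    using is_tensorD(3)[OF T is_tensorD(1,2)[OF S]] by blast
  have "bij_betw u (carrier S) (carrier T)"
    using lmod_homD(1)[OF u(1)] lmod_homD(1)[OF w(1)] inverse[OF S T u w] inverse[OF T S w u]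
    by (intro bij_betw_byWitness[where f' = w]) auto
  with u(1) that show thesis by blast
qed

text \<open>In coordinates, the tensor of the \<open>i\<close>-th and \<open>j\<close>-th basis
  vectors is the unit vector at \<open>i * n + j\<close>; \<open>div n\<close> and
  \<open>mod n\<close> recover the two indices. The isomorphisms \<open>f\<close> and
  \<open>g\<close> carry this over to arbitrary finite-dimensional spaces.\<close>

lemma tensor_coord_space:
  fixes V W :: "('k::field, nat \<Rightarrow> 'k) module"
  assumes V: "vectorspace class_ring V" and W: "vectorspace class_ring W"
    and f: "f \<in> lmod_hom class_ring (coord_space m) V" "bij_betw f (carrier (coord_space m :: ('k, nat \<Rightarrow> 'k) module)) (carrier V)"
    and g: "g \<in> lmod_hom class_ring (coord_space n) W" "bij_betw g (carrier (coord_space n :: ('k, nat \<Rightarrow> 'k) module)) (carrier W)"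
  shows "\<exists>\<tau>. is_tensor class_ring V W (coord_space (m * n)) \<tau>"
proof -
  let ?C = "\<lambda>n. coord_space n :: ('k, nat \<Rightarrow> 'k) module"
  have C: "left_module class_ring (?C n)" for n
    by (simp add: left_module_class_ring_iff vectorspace_coord_space)
  define f' where "f' = inv_into (carrier (?C m)) f"
  define g' where "g' = inv_into (carrier (?C n)) g"
  have f': "f' \<in> lmod_hom class_ring V (?C m)" unfolding f'_def by (rule lmod_hom_inv_into[OF f C])
  have g': "g' \<in> lmod_hom class_ring W (?C n)" unfolding g'_def by (rule lmod_hom_inv_into[OF g C])
  have f'f: "f' (f v) = v" if "v \<in> carrier (?C m)" for v
    unfolding f'_def by (rule bij_betw_inv_into_left[OF f(2) that])
  have g'g: "g' (g v) = v" if "v \<in> carrier (?C n)" for v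
    unfolding g'_def by (rule bij_betw_inv_into_left[OF g(2) that])
  have ff': "f (f' x) = x" if "x \<in> carrier V" for x
    unfolding f'_def by (rule bij_betw_inv_into_right[OF f(2) that])
  have gg': "g (g' y) = y" if "y \<in> carrier W" for y
    unfolding g'_def by (rule bij_betw_inv_into_right[OF g(2) that])
  define \<tau> where "\<tau> x y = (\<lambda>k. if k < m * n then f' x (k div n) * g' y (k mod n) else 0)" for x y
  have \<tau>_closed: "\<tau> x y \<in> carrier (?C (m * n))" for x y by (simp add: \<tau>_def)
  have \<tau>1: "\<tau> x \<in> lmod_hom class_ring W (?C (m * n))" if x: "x \<in> carrier V" for x
  proof (rule lmod_homI[OF \<tau>_closed])
    fix y z assume "y \<in> carrier W" "z \<in> carrier W"
    then show "\<tau> x (y \<oplus>\<^bsub>W\<^esub> z) = \<tau> x y \<oplus>\<^bsub>?C (m * n)\<^esub> \<tau> x z"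
      using lmod_homD(2)[OF g', of y z] by (auto simp: \<tau>_def distrib_left)
  next
    fix a :: 'k and y assume "y \<in> carrier W"
    then show "\<tau> x (a \<odot>\<^bsub>W\<^esub> y) = a \<odot>\<^bsub>?C (m * n)\<^esub> \<tau> x y"
      using lmod_homD(3)[OF g', of a y] by (auto simp: \<tau>_def)
  qed
  have \<tau>2: "(\<lambda>x. \<tau> x y) \<in> lmod_hom class_ring V (?C (m * n))" if y: "y \<in> carrier W" for y
  proof (rule lmod_homI[OF \<tau>_closed])
    fix x z assume "x \<in> carrier V" "z \<in> carrier V"
    then show "\<tau> (x \<oplus>\<^bsub>V\<^esub> z) y = \<tau> x y \<oplus>\<^bsub>?C (m * n)\<^esub> \<tau> z y"
      using lmod_homD(2)[OF f', of x z] by (auto simp: \<tau>_def distrib_right)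
  next
    fix a :: 'k and x assume "x \<in> carrier V"
    then show "\<tau> (a \<odot>\<^bsub>V\<^esub> x) y = a \<odot>\<^bsub>?C (m * n)\<^esub> \<tau> x y"
      using lmod_homD(3)[OF f', of a x] by (auto simp: \<tau>_def)
  qed
  have bil: "lmod_bilinear class_ring V W (?C (m * n)) \<tau>"
    unfolding lmod_bilinear_def using \<tau>1 \<tau>2 by blast
  have index: "i * n + j < m * n" if "i < m" "j < n" for i j
  proof -
    have "i * n + j < Suc i * n" using that by simp
    also have "\<dots> \<le> m * n" using that by (intro mult_le_mono1) simp
    finally show ?thesis .
  qed
  have \<tau>_unit: "\<tau> (f (unit_coord i)) (g (unit_coord j)) = unit_coord (i * n + j)" if "i < m" "j < n" for i j
  proof
    fix k
    have "k = i * n + j \<longleftrightarrow> k div n = i \<and> k mod n = j"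
      using that div_mult_mod_eq[of k n] by auto
    then show "\<tau> (f (unit_coord i)) (g (unit_coord j)) k = unit_coord (i * n + j) k"
      using f'f[OF unit_coord_closed[OF that(1)]] g'g[OF unit_coord_closed[OF that(2)]]
        index[OF that] by (auto simp: \<tau>_def unit_coord_def)
  qed
  have div_mod: "k div n < m" "k mod n < n" if "k < m * n" for k
  proof -
    \<comment> \<open>Division by \<open>n\<close> is meaningful here: for \<open>n = 0\<close> no
      index \<open>k < m * n\<close> exists.\<close>
    have "n > 0" using that by (cases n) auto
    then show "k div n < m" "k mod n < n" using that by (simp_all add: less_mult_imp_div_less)
  qed
  have fV: "f v \<in> carrier V" if "v \<in> carrier (?C m)" for v using lmod_homD(1)[OF f(1) that] .
  have gW: "g v \<in> carrier W" if "v \<in> carrier (?C n)" for v using lmod_homD(1)[OF g(1) that] .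
  have "is_tensor class_ring V W (?C (m * n)) \<tau>"
    unfolding is_tensor_def
  proof (intro conjI allI impI C bil)
    fix U :: "('k, nat \<Rightarrow> 'k) module" and \<beta>
    assume "left_module class_ring U \<and> lmod_bilinear class_ring V W U \<beta>"
    then have U: "vectorspace class_ring U" and \<beta>: "lmod_bilinear class_ring V W U \<beta>"
      by (auto simp: left_module_class_ring_iff)
    have abU: "abelian_group U" using U by (auto simp: vectorspace_def module_def)
    have \<beta>1: "\<beta> x \<in> lmod_hom class_ring W U" if "x \<in> carrier V" for x
      using \<beta> that by (auto simp: lmod_bilinear_def)
    have \<beta>2: "(\<lambda>x. \<beta> x y) \<in> lmod_hom class_ring V U" if "y \<in> carrier W" for y
      using \<beta> that by (auto simp: lmod_bilinear_def)
    define b where "b k = \<beta> (f (unit_coord (k div n))) (g (unit_coord (k mod n)))" for k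
    have bU: "b k \<in> carrier U" if "k < m * n" for k
      unfolding b_def
      by (intro lmod_homD(1)[OF \<beta>1] fV gW unit_coord_closed div_mod[OF that])
    obtain h where h: "h \<in> lmod_hom class_ring (?C (m * n)) U" "\<And>k. k < m * n \<Longrightarrow> h (unit_coord k) = b k"
      using coord_space_hom_exists[OF U, of "m * n" b] bU by blast
    have h\<tau>: "h (\<tau> x y) = \<beta> x y" if x: "x \<in> carrier V" and y: "y \<in> carrier W" for x y
    proof -
      \<comment> \<open>The two bilinear maps agree on pairs of basis vectors. Linearity in the
        second argument gives agreement on \<open>f (unit_coord i)\<close> with any
        \<open>g w\<close>; linearity in the first argument then gives all pairs.\<close>
      have unit: "h (\<tau> (f (unit_coord i)) (g w)) = \<beta> (f (unit_coord i)) (g w)"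
        if i: "i < m" and w: "w \<in> carrier (?C n)" for i w
      proof (rule coord_space_hom_eq[OF _ _ abU _ w])
        show "(\<lambda>w. h (\<tau> (f (unit_coord i)) (g w))) \<in> lmod_hom class_ring (?C n) U"
          by (rule lmod_hom_comp[OF lmod_hom_comp[OF g(1) \<tau>1] h(1)]) (intro fV unit_coord_closed i)
        show "(\<lambda>w. \<beta> (f (unit_coord i)) (g w)) \<in> lmod_hom class_ring (?C n) U"
          by (rule lmod_hom_comp[OF g(1) \<beta>1]) (intro fV unit_coord_closed i)
        fix j assume j: "j < n"
        show "h (\<tau> (f (unit_coord i)) (g (unit_coord j))) = \<beta> (f (unit_coord i)) (g (unit_coord j))"
          using j by (simp add: \<tau>_unit[OF i j] h(2)[OF index[OF i j]] b_def)
      qed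
      have "h (\<tau> (f (f' x)) (g (g' y))) = \<beta> (f (f' x)) (g (g' y))"
      proof (rule coord_space_hom_eq[where f = "\<lambda>v. h (\<tau> (f v) (g (g' y)))" and g = "\<lambda>v. \<beta> (f v) (g (g' y))"])
        have gy: "g (g' y) \<in> carrier W" using y by (simp add: gg')
        show "(\<lambda>v. h (\<tau> (f v) (g (g' y)))) \<in> lmod_hom class_ring (?C m) U"
          by (rule lmod_hom_comp[OF lmod_hom_comp[OF f(1) \<tau>2[OF gy]] h(1)])
        show "(\<lambda>v. \<beta> (f v) (g (g' y))) \<in> lmod_hom class_ring (?C m) U"
          by (rule lmod_hom_comp[OF f(1) \<beta>2[OF gy]])
        show "f' x \<in> carrier (?C m)" by (rule lmod_homD(1)[OF f' x])
      qed (rule abU, rule unit, assumption, rule lmod_homD(1)[OF g' y])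
      then show ?thesis by (simp add: ff'[OF x] gg'[OF y])
    qed
    show "\<exists>!h. h \<in> extensional (carrier (?C (m * n))) \<and> h \<in> lmod_hom class_ring (?C (m * n)) U \<and>
        (\<forall>x\<in>carrier V. \<forall>y\<in>carrier W. h (\<tau> x y) = \<beta> x y)"
    proof (intro ex1I conjI ballI)
      show "restrict h (carrier (?C (m * n))) \<in> lmod_hom class_ring (?C (m * n)) U"
        by (rule lmod_hom_restrict[OF h(1) C])
      show "restrict h (carrier (?C (m * n))) (\<tau> x y) = \<beta> x y" if "x \<in> carrier V" "y \<in> carrier W" for x y
        using h\<tau>[OF that] by (simp add: \<tau>_def)
      fix h2
      assume h2: "h2 \<in> extensional (carrier (?C (m * n))) \<and> h2 \<in> lmod_hom class_ring (?C (m * n)) U \<and>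
        (\<forall>x\<in>carrier V. \<forall>y\<in>carrier W. h2 (\<tau> x y) = \<beta> x y)"
      have "h2 v = h v" if v: "v \<in> carrier (?C (m * n))" for v
      proof (rule coord_space_hom_eq[OF _ h(1) abU _ v])
        fix k assume k: "k < m * n"
        \<comment> \<open>Every unit vector is a pure tensor, so a map with prescribed values on
          pure tensors is determined on a basis.\<close>
        have "\<tau> (f (unit_coord (k div n))) (g (unit_coord (k mod n))) = unit_coord k"
          by (simp add: \<tau>_unit[OF div_mod[OF k]])
        moreover have "h2 (\<tau> (f (unit_coord (k div n))) (g (unit_coord (k mod n)))) = b k"
          using h2 fV[OF unit_coord_closed] gW[OF unit_coord_closed] div_mod[OF k] unfolding b_def by blast
        ultimately show "h2 (unit_coord k) = h (unit_coord k)" using h(2)[OF k] by simp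
      qed (use h2 in blast)
      then show "h2 = restrict h (carrier (?C (m * n)))"
        using h2 by (intro extensionalityI[of _ "carrier (?C (m * n))"]) auto
    qed simp
  qed
  then show ?thesis by blast
qed

section \<open>The trivial group\<close>

lemma frag_support_induct [consumes 1, case_names zero diff of]:
  assumes "Poly_Mapping.keys x \<subseteq> S" "P 0" "\<And>x y. P x \<Longrightarrow> P y \<Longrightarrow> P (x - y)"
    "\<And>a. a \<in> S \<Longrightarrow> P (frag_of a)"
  shows "P x"
  using assms(1) by (rule free_Abelian_group_induct) (use assms in auto)

context finite_group
begin

abbreviation trivial_power :: "nat \<Rightarrow> ('g, 'k::field) gmod" where
  "trivial_power n \<equiv> perm_gmod G n (\<lambda>_ i. i)"

lemma trivial_power_fg_gmods: "trivial_power n \<in> fg_gmods G"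
  by (intro perm_gmod_fg_gmods perm_action_trivial)

lemma restrict_scalars_trivial_power: "restrict_scalars G (trivial_power n) = coord_space n"
  by (simp add: restrict_scalars_def coord_space_def) (simp add: perm_gmod_def)

lemma fixed_space_one: "M \<in> fg_gmods G \<Longrightarrow> fixed_space G {\<one>} M = restrict_scalars G M"
  by (simp add: fixed_space_def fixed_points_one restrict_scalars_def)

lemma fixed_dim_trivial_power:
  "fixed_dim G {\<one>} (trivial_power n :: ('g, 'k::field) gmod) = n"
  by (simp add: fixed_dim_def fixed_space_one[OF trivial_power_fg_gmods] restrict_scalars_trivial_power
      dim_coord_space)

text \<open>Induction along the exact sequences K^n, K^(n+1), K with trivial action: each step adds
  one copy of the trivial module. The base case is the zero module.\<close>

lemma trivial_power_relation:
  "frag_of (trivial_power n) - frag_cmul (int n) (frag_of (trivial_gmod G)) \<in>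
    (exact_relations G :: (('g, 'k::field) gmod \<Rightarrow>\<^sub>0 int) set)"
proof (induction n)
  case 0
  then show ?case using frag_of_zero_gmod by simp
next
  case (Suc n)
  let ?P = "\<lambda>n. trivial_power n :: ('g, 'k) gmod"
  \<comment> \<open>Projection to the last coordinate, moved to position 0 because that is where the
    one-dimensional module \<open>?P 1\<close> lives.\<close>
  let ?g = "\<lambda>(v :: nat \<Rightarrow> 'k) i. if i = 0 then v n else 0"
  have "lmod_short_exact (group_algebra G) (?P n) (\<lambda>v. v) (?P (Suc n)) ?g (?P 1)"
    unfolding lmod_short_exact_def
  proof (intro conjI)
    show "?g ` carrier (?P (Suc n)) = carrier (?P 1)"
    proof
      show "carrier (?P 1) \<subseteq> ?g ` carrier (?P (Suc n))"
      proof
        fix w assume "w \<in> carrier (?P 1)"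
        then have "w = ?g (\<lambda>i. if i = n then w 0 else 0)" by auto
        then show "w \<in> ?g ` carrier (?P (Suc n))"
          by (rule image_eqI[where x = "\<lambda>i. if i = n then w 0 else 0"]) simp
      qed
    qed auto
    show "(\<lambda>v. v) ` carrier (?P n) = a_kernel (?P (Suc n)) (?P 1) ?g"
    proof -
      have "(\<forall>i\<ge>n. v i = 0) \<longleftrightarrow> (\<forall>i\<ge>Suc n. v i = 0) \<and> v n = 0" for v :: "nat \<Rightarrow> 'k"
        by (metis Suc_leD le_antisym not_less_eq_eq order_refl)
      then show ?thesis by (auto simp: a_kernel_def' fun_eq_iff)
    qed
  qed (auto intro!: lmod_homI)
  from exact_relations_incl[OF trivial_power_fg_gmods trivial_power_fg_gmods trivial_power_fg_gmods this]
  have "frag_of (?P (Suc n)) - frag_of (?P n) - frag_of (trivial_gmod G) \<in> exact_relations G"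
    by (simp add: trivial_gmod_eq_perm_gmod)
  from exact_relations_closed(2)[OF this Suc.IH] show ?case
    by (simp add: frag_cmul_distrib algebra_simps)
qed

end

section \<open>Dimension as a complete invariant over the trivial group\<close>

locale finite_trivial_group = finite_group G for G :: "('g, 'b) monoid_scheme" (structure) +
  assumes carrier_trivial: "carrier G = {\<one>}"
begin

abbreviation dimension :: "('g, 'k::field) gmod \<Rightarrow> nat" where
  "dimension \<equiv> fixed_dim G {\<one>}"

lemma dimension_eq: "M \<in> fg_gmods G \<Longrightarrow> dimension M = vectorspace.dim class_ring (restrict_scalars G M)"
  by (simp add: fixed_dim_def fixed_space_one)

text \<open>Over the trivial group, K[G] consists of scalars, so K-linear maps are
  K[G]-linear.\<close>

lemma lmod_hom_group_algebra:
  fixes A B :: "('g, 'k::field) gmod"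
  assumes "f \<in> lmod_hom class_ring (restrict_scalars G A) (restrict_scalars G B)"
  shows "f \<in> lmod_hom (group_algebra G) A B"
proof (rule lmod_homI)
  fix a :: "'g \<Rightarrow> 'k" and x assume a: "a \<in> carrier (group_algebra G)" and x: "x \<in> carrier A"
  have "a = ga_single \<one> (a \<one>)" using a carrier_trivial by (auto simp: ga_single_def)
  then show "f (a \<odot>\<^bsub>A\<^esub> x) = a \<odot>\<^bsub>B\<^esub> f x"
    using lmod_homD(3)[OF assms, of "a \<one>" x] x by simp
qed (use lmod_homD[OF assms] in auto)

lemma trivial_power_iso:
  assumes M: "M \<in> fg_gmods G"
  obtains f where "f \<in> lmod_hom class_ring (coord_space (dimension M)) (restrict_scalars G M)"
    "bij_betw f (carrier (coord_space (dimension M) :: ('k::field, nat \<Rightarrow> 'k) module)) (carrier (restrict_scalars G (M :: ('g, 'k) gmod)))"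
proof (rule coord_space_iso[OF vectorspace_restrict_scalars[OF fg_gmodsD(1)[OF M]] fin_dim_restrict_scalars[OF M]])
qed (rule that, simp_all only: dimension_eq[OF M])

lemma frag_of_dimension:
  assumes M: "M \<in> fg_gmods G"
  shows "frag_of M - frag_cmul (int (dimension M)) (frag_of (trivial_gmod G)) \<in>
    (exact_relations G :: (('g, 'k::field) gmod \<Rightarrow>\<^sub>0 int) set)"
proof -
  obtain f where f: "f \<in> lmod_hom class_ring (coord_space (dimension M)) (restrict_scalars G M)"
    "bij_betw f (carrier (coord_space (dimension M) :: ('k, nat \<Rightarrow> 'k) module)) (carrier (restrict_scalars G M))"
    by (rule trivial_power_iso[OF M])
  have "f \<in> lmod_hom (group_algebra G) (trivial_power (dimension M)) M"
    using f(1) by (intro lmod_hom_group_algebra) (simp add: restrict_scalars_trivial_power)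
  from frag_of_iso[OF trivial_power_fg_gmods M this] f(2)
  have "frag_of M - frag_of (trivial_power (dimension M)) \<in> exact_relations G" by simp
  from exact_relations_closed(2)[OF this trivial_power_relation[of "dimension M"]]
  show ?thesis by (simp only: add_diff_eq diff_add_cancel)
qed

lemma dimension_relation:
  assumes "Poly_Mapping.keys x \<subseteq> fg_gmods G"
  shows "x - frag_cmul (frag_weight dimension x) (frag_of (trivial_gmod G)) \<in>
    (exact_relations G :: (('g, 'k::field) gmod \<Rightarrow>\<^sub>0 int) set)"
  using assms
proof (induction rule: frag_support_induct)
  case (diff x y)
  from exact_relations_closed(4)[OF diff] show ?case
    by (simp add: frag_cmul_diff_distrib algebra_simps)
next
  case (of M)
  then show ?case using frag_of_dimension by simp
qed (simp add: exact_relations_closed(1))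

lemma dimension_zero:
  "x \<in> (exact_relations G :: (('g, 'k::field_char_0) gmod \<Rightarrow>\<^sub>0 int) set) \<Longrightarrow> frag_weight dimension x = 0"
  by (rule fixed_dim_exact_relations[OF triv_subgroup])

text \<open>\<open>dimension_zero\<close> makes the dimension well defined on classes, and
  \<open>dimension_relation\<close> writes each class as its dimension times the class of K.
  Identities between classes thereby reduce to integer arithmetic.\<close>

lemma gclass_eq_iff_dimension:
  fixes x y :: "('g, 'k::field_char_0) gmod \<Rightarrow>\<^sub>0 int"
  assumes "Poly_Mapping.keys x \<subseteq> fg_gmods G" "Poly_Mapping.keys y \<subseteq> fg_gmods G"
  shows "gclass G x = gclass G y \<longleftrightarrow> frag_weight dimension x = frag_weight dimension y"
proof
  assume "gclass G x = gclass G y"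
  then show "frag_weight dimension x = frag_weight dimension y"
    using dimension_zero[of "x - y"] by (simp add: gclass_eq_iff)
next
  assume eq: "frag_weight dimension x = frag_weight dimension y"
  from exact_relations_closed(4)[OF dimension_relation[OF assms(1)] dimension_relation[OF assms(2)]]
  show "gclass G x = gclass G y" by (simp add: gclass_eq_iff eq)
qed

text \<open>The single group element acts as the identity on all three modules, so the diagonal
  action condition is automatic.\<close>

lemma is_diag_tensor_trivial:
  assumes "M \<in> fg_gmods G" "N \<in> fg_gmods G" "T \<in> fg_gmods G"
    and T: "is_tensor class_ring (restrict_scalars G M) (restrict_scalars G N) (restrict_scalars G T) \<tau>"
  shows "is_diag_tensor G M N T \<tau>"
proof -
  have \<tau>: "\<tau> x y \<in> carrier T" if "x \<in> carrier M" "y \<in> carrier N" for x y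
  proof -
    have "\<tau> x \<in> lmod_hom class_ring (restrict_scalars G N) (restrict_scalars G T)"
      using is_tensorD(2)[OF T] that(1) by (simp add: lmod_bilinear_def)
    from lmod_homD(1)[OF this, of y] that(2) show ?thesis by simp
  qed
  have one: "ga_single \<one> 1 \<odot>\<^bsub>L\<^esub> x = x" if "L \<in> fg_gmods G" "x \<in> carrier L" for L :: "('g, 'a) gmod" and x
    using left_module.smult_one[OF fg_gmodsD(1)[OF that(1)] that(2)] by simp
  show ?thesis
    using T assms(1-3) by (simp add: is_diag_tensor_def carrier_trivial one \<tau>)
qed

text \<open>\<open>diag_tensor\<close> is an arbitrary choice. The coordinate space of dimension
  \<open>dimension M * dimension N\<close> shows that a choice exists, and uniqueness of tensor
  products gives the chosen module the same dimension.\<close>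

lemma diag_tensor_dimension:
  fixes M N :: "('g, 'k::field) gmod"
  assumes M: "M \<in> fg_gmods G" and N: "N \<in> fg_gmods G"
  shows "diag_tensor G M N \<in> fg_gmods G" "dimension (diag_tensor G M N) = dimension M * dimension N"
proof -
  let ?R = "restrict_scalars G :: ('g, 'k) gmod \<Rightarrow> ('k, nat \<Rightarrow> 'k) module"
  let ?n = "dimension M * dimension N" and ?T = "diag_tensor G M N"
  have VM: "vectorspace class_ring (?R M)" and VN: "vectorspace class_ring (?R N)"
    using vectorspace_restrict_scalars fg_gmodsD(1) M N by blast+
  obtain f where f: "f \<in> lmod_hom class_ring (coord_space (dimension M)) (?R M)"
    "bij_betw f (carrier (coord_space (dimension M) :: ('k, nat \<Rightarrow> 'k) module)) (carrier (?R M))"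
    by (rule trivial_power_iso[OF M])
  obtain g where g: "g \<in> lmod_hom class_ring (coord_space (dimension N)) (?R N)"
    "bij_betw g (carrier (coord_space (dimension N) :: ('k, nat \<Rightarrow> 'k) module)) (carrier (?R N))"
    by (rule trivial_power_iso[OF N])
  obtain \<tau> where \<tau>: "is_tensor class_ring (?R M) (?R N) (coord_space ?n) \<tau>"
    using tensor_coord_space[OF VM VN f g] by blast
  then have "is_diag_tensor G M N (trivial_power ?n) \<tau>"
    by (intro is_diag_tensor_trivial M N trivial_power_fg_gmods) (simp add: restrict_scalars_trivial_power)
  with trivial_power_fg_gmods
  have "trivial_power ?n \<in> fg_gmods G \<and> (\<exists>\<tau>. is_diag_tensor G M N (trivial_power ?n) \<tau>)" by blast
  then have "?T \<in> fg_gmods G \<and> (\<exists>\<tau>. is_diag_tensor G M N ?T \<tau>)"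
    unfolding diag_tensor_def by (rule someI)
  then obtain \<tau>' where T: "?T \<in> fg_gmods G" and \<tau>': "is_diag_tensor G M N ?T \<tau>'" by blast
  show "?T \<in> fg_gmods G" by (rule T)
  from \<tau>' have "is_tensor class_ring (?R M) (?R N) (?R ?T) \<tau>'" by (simp add: is_diag_tensor_def)
  from tensor_unique[OF \<tau> this] obtain u where
    u: "u \<in> lmod_hom class_ring (coord_space ?n) (?R ?T)" "bij_betw u (carrier (coord_space ?n)) (carrier (?R ?T))"
    by blast
  interpret u: linear_map class_ring "coord_space ?n :: ('k, nat \<Rightarrow> 'k) module" "?R ?T" u
    by (intro linear_mapI vectorspace_coord_space vectorspace_restrict_scalars fg_gmodsD(1) T u)
  have "vectorspace.dim class_ring (coord_space ?n :: ('k, nat \<Rightarrow> 'k) module) = vectorspace.dim class_ring (?R ?T)"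
    using u(2) by (intro u.dim_eq fin_dim_coord_space) (auto simp: bij_betw_def)
  then show "dimension ?T = ?n" by (simp add: dim_coord_space dimension_eq[OF T])
qed

lemma free_gmods_mult:
  fixes x y :: "('g, 'k::field) gmod \<Rightarrow>\<^sub>0 int"
  assumes x: "Poly_Mapping.keys x \<subseteq> fg_gmods G" and y: "Poly_Mapping.keys y \<subseteq> fg_gmods G"
  shows "Poly_Mapping.keys (x \<otimes>\<^bsub>free_gmods G\<^esub> y) \<subseteq> fg_gmods G"
    "frag_weight dimension (x \<otimes>\<^bsub>free_gmods G\<^esub> y) = frag_weight dimension x * frag_weight dimension y"
proof -
  let ?m = "\<lambda>x y. x \<otimes>\<^bsub>free_gmods G\<^esub> (y :: ('g, 'k) gmod \<Rightarrow>\<^sub>0 int)"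
  have m: "?m x y = frag_extend (\<lambda>M. frag_extend (\<lambda>N. frag_of (diag_tensor G M N)) y) x" for x y
    by (simp add: free_gmods_def)
  show "Poly_Mapping.keys (?m x y) \<subseteq> fg_gmods G"
    unfolding m using x y diag_tensor_dimension(1)
    by (intro order.trans[OF keys_frag_extend] UN_least) auto
  have single: "frag_weight dimension (frag_extend (\<lambda>N. frag_of (diag_tensor G M N)) y) =
      int (dimension M) * frag_weight dimension y" if M: "M \<in> fg_gmods G" for M
    using y by (induction rule: frag_support_induct)
      (simp_all add: frag_extend_diff diag_tensor_dimension(2)[OF M] right_diff_distrib)
  show "frag_weight dimension (?m x y) = frag_weight dimension x * frag_weight dimension y"
    unfolding m using x by (induction rule: frag_support_induct)
      (simp_all add: frag_extend_diff single left_diff_distrib)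
qed

text \<open>In characteristic zero the value does not depend on the chosen representative, by
  \<open>dimension_zero\<close>.\<close>

definition class_dimension :: "(('g, 'k::field) gmod \<Rightarrow>\<^sub>0 int) set \<Rightarrow> int" where
  "class_dimension A = frag_weight dimension (SOME x. x \<in> A)"

lemma class_dimension_gclass:
  "class_dimension (gclass G (x :: ('g, 'k::field_char_0) gmod \<Rightarrow>\<^sub>0 int)) = frag_weight dimension x"
proof -
  have "x \<in> gclass G x" by (simp add: mem_gclass_iff exact_relations_closed(1))
  then have "(SOME z. z \<in> gclass G x) \<in> gclass G x" by (rule someI)
  then show ?thesis using dimension_zero[of "(SOME z. z \<in> gclass G x) - x"]
    by (simp add: class_dimension_def mem_gclass_iff)
qed

text \<open>The product of cosets is a union over pairs of representatives. All pairs give products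
  of the same dimension, hence of the same class, and the union collapses.\<close>

lemma groth_ring_mult:
  fixes x y :: "('g, 'k::field_char_0) gmod \<Rightarrow>\<^sub>0 int"
  assumes x: "Poly_Mapping.keys x \<subseteq> fg_gmods G" and y: "Poly_Mapping.keys y \<subseteq> fg_gmods G"
  shows "gclass G x \<otimes>\<^bsub>groth_ring G\<^esub> gclass G y = gclass G (x \<otimes>\<^bsub>free_gmods G\<^esub> y)"
proof -
  have keys: "Poly_Mapping.keys a \<subseteq> fg_gmods G \<and> frag_weight dimension a = frag_weight dimension z"
    if "Poly_Mapping.keys z \<subseteq> fg_gmods G" "a \<in> gclass G z" for a z :: "('g, 'k) gmod \<Rightarrow>\<^sub>0 int"
  proof
    have rel: "a - z \<in> exact_relations G" using that(2) by (simp add: mem_gclass_iff)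
    show "Poly_Mapping.keys a \<subseteq> fg_gmods G"
      using keys_add[of "a - z" z] exact_relations_closed(5)[OF rel] that(1) by auto
    show "frag_weight dimension a = frag_weight dimension z" using dimension_zero[OF rel] by simp
  qed
  have "gclass G (a \<otimes>\<^bsub>free_gmods G\<^esub> b) = gclass G (x \<otimes>\<^bsub>free_gmods G\<^esub> y)"
    if "a \<in> gclass G x" "b \<in> gclass G y" for a b
    using keys[OF x that(1)] keys[OF y that(2)] x y
    by (simp add: gclass_eq_iff_dimension free_gmods_mult)
  then have "(\<Union>a\<in>gclass G x. \<Union>b\<in>gclass G y. gclass G (a \<otimes>\<^bsub>free_gmods G\<^esub> b)) =
      (\<Union>a\<in>gclass G x. \<Union>b\<in>gclass G y. gclass G (x \<otimes>\<^bsub>free_gmods G\<^esub> y))"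
    by (intro SUP_cong refl)
  moreover have "x \<in> gclass G x" "y \<in> gclass G y" by (simp_all add: mem_gclass_iff exact_relations_closed(1))
  then have "gclass G x \<noteq> {}" "gclass G y \<noteq> {}" by blast+
  then have "(\<Union>a\<in>gclass G x. \<Union>b\<in>gclass G y. gclass G (x \<otimes>\<^bsub>free_gmods G\<^esub> y)) = gclass G (x \<otimes>\<^bsub>free_gmods G\<^esub> y)"
    by (simp only: UN_constant if_False)
  moreover have "gclass G x \<otimes>\<^bsub>groth_ring G\<^esub> gclass G y =
      (\<Union>a\<in>gclass G x. \<Union>b\<in>gclass G y. gclass G (a \<otimes>\<^bsub>free_gmods G\<^esub> b))"
    by (simp add: groth_ring_def FactRing_def rcoset_mult_def gclass_def)
  ultimately show ?thesis by (simp only:)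
qed

end

theorem (in group_with_family) trivial_imp_iso_integers:
  assumes "\<F> = {{\<one>}}"
  shows "(family_groth_ring G \<F> :: ('g set \<Rightarrow> (('g, 'k::field_char_0) gmod \<Rightarrow>\<^sub>0 int) set) ring) \<simeq> \<Z>"
proof -
  let ?E = "G\<lparr>carrier := {\<one>}\<rparr>"
  let ?R = "family_groth_ring G \<F> :: ('g set \<Rightarrow> (('g, 'k) gmod \<Rightarrow>\<^sub>0 int) set) ring"
  have E: "{\<one>} \<in> \<F>" by (rule family_trivial_subgroup)
  have triv: "finite_trivial_group ?E"
    by (intro finite_trivial_group.intro finite_trivial_group_axioms.intro family_finite_group E) simp
  define w :: "(('g, 'k) gmod \<Rightarrow>\<^sub>0 int) \<Rightarrow> int" where "w = frag_weight (fixed_dim ?E {\<one>})"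
  \<comment> \<open>Evaluate at the only member of the family, then take the dimension.\<close>
  define f :: "('g set \<Rightarrow> (('g, 'k) gmod \<Rightarrow>\<^sub>0 int) set) \<Rightarrow> int"
    where "f \<xi> = finite_trivial_group.class_dimension ?E (\<xi> {\<one>})" for \<xi>
  have fw: "finite_trivial_group.class_dimension ?E (gclass ?E x) = w x" for x
    using finite_trivial_group.class_dimension_gclass[OF triv, of x] by (simp add: w_def)
  have one: "w (frag_of (trivial_gmod ?E)) = 1"
    using finite_group.fixed_dim_trivial_power[OF family_finite_group[OF E], of 1]
    by (simp add: w_def trivial_gmod_eq_perm_gmod)
  have rep: "\<exists>x. Poly_Mapping.keys x \<subseteq> fg_gmods ?E \<and> \<xi> {\<one>} = gclass ?E x" if "\<xi> \<in> carrier ?R" for \<xi>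
  proof -
    have "\<xi> {\<one>} \<in> carrier (groth_ring ?E)"
      using that E by (auto simp: family_groth_ring_def Let_def)
    then show ?thesis by (auto simp: groth_ring_simps)
  qed
  have "f \<in> ring_iso ?R \<Z>"
    unfolding ring_iso_def
  proof (intro CollectI conjI ring_hom_memI bij_betw_imageI)
    fix A B assume "A \<in> carrier ?R" "B \<in> carrier ?R"
    then obtain x y where xy: "Poly_Mapping.keys x \<subseteq> fg_gmods ?E" "A {\<one>} = gclass ?E x"
      "Poly_Mapping.keys y \<subseteq> fg_gmods ?E" "B {\<one>} = gclass ?E y"
      using rep by meson
    have "(A \<otimes>\<^bsub>?R\<^esub> B) {\<one>} = gclass ?E x \<otimes>\<^bsub>groth_ring ?E\<^esub> gclass ?E y"
      using E xy by (simp add: family_groth_ring_def Let_def)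
    then show "f (A \<otimes>\<^bsub>?R\<^esub> B) = f A \<otimes>\<^bsub>\<Z>\<^esub> f B"
      using finite_trivial_group.free_gmods_mult(2)[OF triv xy(1,3)] xy(2,4)
      by (simp add: f_def finite_trivial_group.groth_ring_mult[OF triv xy(1,3)] fw) (simp add: w_def)
    have "(A \<oplus>\<^bsub>?R\<^esub> B) {\<one>} = gclass ?E x \<oplus>\<^bsub>groth_ring ?E\<^esub> gclass ?E y"
      using E xy by (simp add: family_groth_ring_def Let_def)
    then show "f (A \<oplus>\<^bsub>?R\<^esub> B) = f A \<oplus>\<^bsub>\<Z>\<^esub> f B"
      using xy(2,4) by (simp add: f_def groth_ring_simps fw) (simp add: w_def)
  next
    show "f \<one>\<^bsub>?R\<^esub> = \<one>\<^bsub>\<Z>\<^esub>"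
      using E one by (simp add: f_def family_groth_ring_def Let_def groth_ring_simps fw)
    show "inj_on f (carrier ?R)"
    proof (rule inj_onI)
      fix A B assume A: "A \<in> carrier ?R" and B: "B \<in> carrier ?R" and eq: "f A = f B"
      then obtain x y where xy: "Poly_Mapping.keys x \<subseteq> fg_gmods ?E" "A {\<one>} = gclass ?E x"
        "Poly_Mapping.keys y \<subseteq> fg_gmods ?E" "B {\<one>} = gclass ?E y"
        using rep by meson
      have "gclass ?E x = gclass ?E y"
        using eq xy(2,4) finite_trivial_group.gclass_eq_iff_dimension[OF triv xy(1,3)]
        by (simp add: f_def fw) (simp add: w_def)
      then have "A {\<one>} = B {\<one>}" using xy by simp
      \<comment> \<open>Elements of the limit are undefined off the family, so agreement at its
        single member is equality.\<close>
      moreover have "A \<in> extensional \<F>" "B \<in> extensional \<F>"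
        using A B by (auto simp: family_groth_ring_def Let_def PiE_def)
      ultimately show "A = B" using assms by (intro extensionalityI[of A \<F> B]) auto
    qed
    show "f ` carrier ?R = carrier \<Z>"
    proof -
      \<comment> \<open>The preimage is \<open>m\<close> times 1, whose compatibility under
        restriction and conjugation has been established for every family.\<close>
      have "m \<in> f ` carrier ?R" for m
      proof (rule image_eqI)
        show "(family_class (multiple_of_one m) :: _ \<Rightarrow> (('g, 'k) gmod \<Rightarrow>\<^sub>0 int) set) \<in> carrier ?R"
          by (rule multiple_of_one_carrier)
        have "w (frag_cmul m (frag_of (trivial_gmod ?E))) = m" using one by (simp add: w_def)
        then show "m = f (family_class (multiple_of_one m))"
          using E by (simp add: f_def family_class_def multiple_of_one_def fw)
      qed
      then show ?thesis by auto
    qed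
  qed auto
  then show ?thesis by (auto simp: is_ring_iso_def)
qed

theorem proposition2p5:
  fixes \<Gamma> :: "('g, 'b) monoid_scheme" and \<F> :: "'g set set"
  assumes "group \<Gamma>"
    and "finite (finite_subgroups \<Gamma> // conjugacy \<Gamma>)"
    and "subgroup_family \<Gamma> \<F>"
  shows "(family_groth_ring \<Gamma> \<F> :: ('g set \<Rightarrow> (('g, 'k::field_char_0) gmod \<Rightarrow>\<^sub>0 int) set) ring) \<simeq> \<Z>
    \<longleftrightarrow> \<F> = {{\<one>\<^bsub>\<Gamma>\<^esub>}}"
proof -
  have "group_with_family \<Gamma> \<F>"
    using assms by (intro group_with_family.intro group_with_family_axioms.intro)
  then show ?thesis
    using group_with_family.iso_integers_imp_trivial group_with_family.trivial_imp_iso_integers assms(2) by blast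
qed

end
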